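(* Let $X$ be a complex Banach space and $(T_1,\ldots,T_n,T_{n+1})$ a commuting tuple of bounded linear operators on $X$. Let $\pi\colon\mathbb{C}^{n+1}\to\mathbb{C}^n$ be the projection onto the first $n$ coordinates. Then: (i) $\pi(sp_{\mathcal{B}_-}(T_1,\ldots,T_n,T_{n+1}))=sp_{\mathcal{B}_-}(T_1,\ldots,T_n)$; (ii) $\pi(sp_{\mathcal{B}_+}(T_1,\ldots,T_n,T_{n+1}))=sp_{\mathcal{B}_+}(T_1,\ldots,T_n)$.
   Context: Let $X$ be a complex Banach space and $T=(T_1,\ldots,T_n)$ an $n$-tuple of commuting bounded linear operators on $X$. $R(\cdot)$ and $N(\cdot)$ denote range and null space. For $\lambda\in\mathbb{C}^n$, $T-\lambda=(T_1-\lambda_1I,\ldots,T_n-\lambda_nI)$. Define $\hat{T}\colon X^n\to X$, $\hat{T}(x_1,\ldots,x_n)=T_1x_1+\cdots+T_nx_n$, and $\tilde{T}\colon X\to X^n$, $\tilde{T}(x)=(T_1x,\ldots,T_nx)$. Put $R^\infty(T)=\bigcap_{k\ge1}[R(T_1^k)+\cdots+R(T_n^k)]$ and $N^\infty(T)=\bigcup_{k\ge1}[N(T_1^k)\cap\cdots\cap N(T_n^k)]$. A subspace of a Banach space has a direct complement if there is a closed subspace such that the whole space is the direct sum of the two. $T$ is lower split semi-Browder if $\operatorname{codim}R^\infty(T)<\infty$ and $N(\hat{T})$ has a direct complement in $X^n$. $T$ is upper split semi-Browder if $\dim N(\tilde{T})<\infty$, $R(\tilde{T})$ is closed, $\dim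 N^\infty(T)<\infty$, and $R(\tilde{T})$ has a direct complement in $X^n$. $sp_{\mathcal{B}_-}(T)$ (respectively $sp_{\mathcal{B}_+}(T)$) is the set of $\lambda\in\mathbb{C}^n$ such that $T-\lambda$ is not lower (respectively upper) split semi-Browder. *)

theory Defs
  imports "HOL-Analysis.Analysis"
begin

section \<open>Complex Banach spaces\<close>

text \<open>
  The real structure of the class \<^class>\<open>real_normed_vector\<close> is kept, and a compatible
  multiplication by complex scalars is added.
\<close>

class scaleC = scaleR +
  fixes scaleC :: "complex \<Rightarrow> 'a \<Rightarrow> 'a"  (infixr \<open>*\<^sub>C\<close> 75)
  assumes scaleR_scaleC: "r *\<^sub>R x = complex_of_real r *\<^sub>C x"

class complex_vector = scaleC + ab_group_add +
  assumes scaleC_add_right: "a *\<^sub>C (x + y) = a *\<^sub>C x + a *\<^sub>C y"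
    and scaleC_add_left: "(a + b) *\<^sub>C x = a *\<^sub>C x + b *\<^sub>C x"
    and scaleC_scaleC: "a *\<^sub>C (b *\<^sub>C x) = (a * b) *\<^sub>C x"
    and scaleC_one: "1 *\<^sub>C x = x"

subclass (in complex_vector) real_vector
  by standard
    (simp_all add: scaleR_scaleC scaleC_add_right scaleC_add_left scaleC_scaleC scaleC_one)

class complex_normed_vector = complex_vector + real_normed_vector +
  assumes norm_scaleC: "norm (a *\<^sub>C x) = cmod a * norm x"

class complex_banach = complex_normed_vector + banach

global_interpretation complex_vector:
  vector_space "scaleC :: complex \<Rightarrow> 'a \<Rightarrow> 'a::complex_vector"
  by standard (simp_all add: scaleC_add_right scaleC_add_left scaleC_scaleC scaleC_one)

instantiation complex :: complex_banach
begin

definition scaleC_complex :: "complex \<Rightarrow> complex \<Rightarrow> complex"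
  where "a *\<^sub>C x = a * x"

instance
  by standard
    (simp_all add: scaleC_complex_def scaleR_conv_of_real algebra_simps norm_mult)

end

instantiation vec :: (complex_vector, finite) complex_vector
begin

definition scaleC_vec :: "complex \<Rightarrow> 'a ^ 'b \<Rightarrow> 'a ^ 'b"
  where "a *\<^sub>C x = (\<chi> i. a *\<^sub>C (x $ i))"

instance
  by standard
    (simp_all add: vec_eq_iff scaleC_vec_def scaleR_scaleC scaleC_add_right scaleC_add_left
      scaleC_scaleC scaleC_one)

end

instance vec :: (complex_normed_vector, finite) complex_normed_vector
  by standard (simp add: norm_vec_def scaleC_vec_def norm_scaleC L2_set_right_distrib)

instance vec :: (complex_banach, finite) complex_banach ..

definition bounded_clinear :: "('a::complex_normed_vector \<Rightarrow> 'b::complex_normed_vector) \<Rightarrow> bool"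
  where "bounded_clinear f \<longleftrightarrow>
    Vector_Spaces.linear scaleC scaleC f \<and> (\<exists>K. \<forall>x. norm (f x) \<le> norm x * K)"


section \<open>Dimension, codimension and direct complements of subspaces\<close>

definition finite_dim :: "'a::complex_vector set \<Rightarrow> bool"
  where "finite_dim V \<longleftrightarrow> (\<exists>B. finite B \<and> complex_vector.span B = V)"

text \<open>
  For a subspace \<open>V\<close>, the condition says that the cosets of the elements of some finite
  set \<open>B\<close> span the quotient of the whole space by \<open>V\<close>.
\<close>

definition finite_codim :: "'a::complex_vector set \<Rightarrow> bool"
  where "finite_codim V \<longleftrightarrow> (\<exists>B. finite B \<and> V + complex_vector.span B = UNIV)"

definition has_direct_complement :: "'a::complex_normed_vector set \<Rightarrow> bool"
  where "has_direct_complement V \<longleftrightarrow>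
    (\<exists>M. complex_vector.subspace M \<and> closed M \<and> V \<inter> M = {0} \<and> V + M = UNIV)"


section \<open>Tuples of operators\<close>

text \<open>
  An \<open>n\<close>-tuple is indexed by a finite type \<open>'n\<close> with \<open>n = CARD('n) \<ge> 1\<close>; an
  \<open>(n+1)\<close>-tuple is indexed by \<open>'n option\<close>, where the indices \<open>Some i\<close> are the first
  \<open>n\<close> ones and \<open>None\<close> is the last one. The space \<open>'a ^ 'n\<close> carries the Euclidean
  combination of the norms, which induces the product topology.
\<close>

definition shift_tuple :: "('n::finite \<Rightarrow> 'a \<Rightarrow> 'a) \<Rightarrow> complex ^ 'n \<Rightarrow> 'n \<Rightarrow> 'a \<Rightarrow> 'a::complex_vector"
  where "shift_tuple T l = (\<lambda>i x. T i x - (l $ i) *\<^sub>C x)"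

definition row_op :: "('n::finite \<Rightarrow> 'a \<Rightarrow> 'a) \<Rightarrow> 'a ^ 'n \<Rightarrow> 'a::complex_vector"
  where "row_op T x = (\<Sum>i\<in>UNIV. T i (x $ i))"

definition column_op :: "('n::finite \<Rightarrow> 'a \<Rightarrow> 'a) \<Rightarrow> 'a \<Rightarrow> 'a::complex_vector ^ 'n"
  where "column_op T x = (\<chi> i. T i x)"

definition null_space :: "('a \<Rightarrow> 'b::zero) \<Rightarrow> 'a set"
  where "null_space f = {x. f x = 0}"

text \<open>The sum over \<open>i\<close> is the Minkowski sum of sets.\<close>

definition range_infty :: "('n::finite \<Rightarrow> 'a \<Rightarrow> 'a) \<Rightarrow> 'a::complex_vector set"
  where "range_infty T = (\<Inter>k\<in>{1..}. \<Sum>i\<in>UNIV. range (T i ^^ k))"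

definition null_infty :: "('n::finite \<Rightarrow> 'a \<Rightarrow> 'a) \<Rightarrow> 'a::complex_vector set"
  where "null_infty T = (\<Union>k\<in>{1..}. \<Inter>i. null_space (T i ^^ k))"


section \<open>Split semi-Browder tuples and spectra\<close>

definition lower_split_semi_Browder :: "('n::finite \<Rightarrow> 'a::complex_banach \<Rightarrow> 'a) \<Rightarrow> bool"
  where "lower_split_semi_Browder T \<longleftrightarrow>
    finite_codim (range_infty T) \<and> has_direct_complement (null_space (row_op T))"

definition upper_split_semi_Browder :: "('n::finite \<Rightarrow> 'a::complex_banach \<Rightarrow> 'a) \<Rightarrow> bool"
  where "upper_split_semi_Browder T \<longleftrightarrow>
    finite_dim (null_space (column_op T)) \<and> closed (range (column_op T)) \<and>
    finite_dim (null_infty T) \<and> has_direct_complement (range (column_op T))"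

definition lower_sB_spectrum :: "('n::finite \<Rightarrow> 'a::complex_banach \<Rightarrow> 'a) \<Rightarrow> (complex ^ 'n) set"
  where "lower_sB_spectrum T = {l. \<not> lower_split_semi_Browder (shift_tuple T l)}"

definition upper_sB_spectrum :: "('n::finite \<Rightarrow> 'a::complex_banach \<Rightarrow> 'a) \<Rightarrow> (complex ^ 'n) set"
  where "upper_sB_spectrum T = {l. \<not> upper_split_semi_Browder (shift_tuple T l)}"

definition first_coords :: "complex ^ ('n::finite option) \<Rightarrow> complex ^ 'n"
  where "first_coords l = (\<chi> i. l $ Some i)"

end

theory Submission
  imports Defs "HOL-Computational_Algebra.Fundamental_Theorem_Algebra"
begin

text \<open>
  By the open mapping theorem and the Hahn-Banach theorem, a tuple \<open>T\<close> is lower (upper) split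
  semi-Browder if and only if \<open>R\<^sup>\<infinity>(T)\<close> has finite codimension (\<open>N\<^sup>\<infinity>(T)\<close> has finite dimension) and
  \<open>\<Sum> T\<^sub>i A\<^sub>i\<close> (\<open>\<Sum> A\<^sub>i T\<^sub>i\<close>) is the identity modulo finite rank for suitable bounded operators \<open>A\<^sub>i\<close>.
  Both conditions clearly survive when an operator \<open>S\<close> is added to the tuple.

  Conversely, suppose that \<open>(T, S - l)\<close> satisfies them for all \<open>l\<close>. Let \<open>J\<close> be the right ideal of all
  \<open>\<Sum> T\<^sub>i A\<^sub>i + F\<close> with \<open>F\<close> of finite rank. Left multiplication by \<open>S\<close> induces an operator on the bounded
  operators modulo the closure of \<open>J\<close> all of whose translates are surjective. Hence that quotient
  vanishes, and the identity is a limit of elements of \<open>J\<close>; the left ideal is treated in the same way.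
  Finally, \<open>p(S)\<close> maps the whole space into \<open>\<Sum> R(T\<^sub>i)\<close> for some polynomial \<open>p \<noteq> 0\<close>, so that some power
  of \<open>p(S)\<close> maps it into \<open>\<Sum> R(T\<^sub>i\<^sup>k)\<close>. Coprimality then shows that \<open>R\<^sup>\<infinity>(T)\<close> contains the
  intersection of the spaces \<open>R\<^sup>\<infinity>(T, S - l)\<close> over the finitely many roots \<open>l\<close> of \<open>p\<close>. Dually,
  \<open>N\<^sup>\<infinity>(T)\<close> is contained in the sum of the spaces \<open>N\<^sup>\<infinity>(T, S - l)\<close> over the roots of a polynomial
  that annihilates \<open>S\<close> on \<open>\<Inter> N(T\<^sub>i)\<close>.
\<close>

text \<open>The translates of the induced operator are only known to be surjective, so no resolvent
  is at hand and the usual proof that a spectrum is nonempty does not apply. The substitute is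
  quantitative: solutions with bounds uniform on a compact disc let the disc on which powers of zL
  contract grow by a fixed amount each time, until the contraction is incompatible with the
  surjectivity of L itself unless the quotient seminorm vanishes. As the ideal J need not be closed,
  the distance to J serves as a seminorm in place of a quotient norm. Returning from the closure to
  J is harmless: an element of J within 1/2 of the identity is invertible, and J is a one-sided
  ideal. The members of J and their coefficients are merely real-linear operators; complex-linear
  coefficients are recovered at the end by passing from A to the map that sends x to (A x - \<i>
  A(\<i> x)) / 2.\<close>

abbreviation clinear :: "('a::complex_vector \<Rightarrow> 'b::complex_vector) \<Rightarrow> bool"
  where "clinear \<equiv> Vector_Spaces.linear scaleC scaleC"

lemma clinear_iff:
  "clinear f \<longleftrightarrow> (\<forall>x y. f (x + y) = f x + f y) \<and> (\<forall>c x. f (c *\<^sub>C x) = c *\<^sub>C f x)"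
  by (simp add: Vector_Spaces.linear_def module_hom_def module_hom_axioms_def
      complex_vector.vector_space_axioms complex_vector.module_axioms)

lemma
  assumes "clinear f"
  shows clinear_add: "f (x + y) = f x + f y"
    and clinear_scaleC: "f (c *\<^sub>C x) = c *\<^sub>C f x"
    and clinear_0: "f 0 = 0"
    and clinear_diff: "f (x - y) = f x - f y"
    and clinear_sum: "f (sum g I) = (\<Sum>i\<in>I. f (g i))"
proof -
  interpret f: Vector_Spaces.linear scaleC scaleC f by fact
  show "f (x + y) = f x + f y" "f (c *\<^sub>C x) = c *\<^sub>C f x" "f 0 = 0" "f (x - y) = f x - f y"
    "f (sum g I) = (\<Sum>i\<in>I. f (g i))"
    by (simp_all add: f.add f.scale f.zero f.diff f.sum)
qed

lemma clinear_id [simp]: "clinear (\<lambda>x. x)"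
  and clinear_zero [simp]: "clinear (\<lambda>x. 0)"
  by (simp_all add: clinear_iff)

lemma clinear_compose: "clinear f \<Longrightarrow> clinear g \<Longrightarrow> clinear (\<lambda>x. f (g x))"
  by (simp add: clinear_iff)

lemma clinear_compose_diff: "clinear f \<Longrightarrow> clinear g \<Longrightarrow> clinear (\<lambda>x. f x - g x)"
  by (simp add: clinear_iff complex_vector.scale_right_diff_distrib)

lemma clinear_compose_scaleC: "clinear f \<Longrightarrow> clinear (\<lambda>x. c *\<^sub>C f x)"
  by (simp add: clinear_iff scaleC_add_right scaleC_scaleC mult.commute)

lemma clinear_compose_sum:
  assumes "\<And>i. i \<in> I \<Longrightarrow> clinear (f i)"
  shows "clinear (\<lambda>x. \<Sum>i\<in>I. f i x)"
  using assms by (simp add: clinear_iff sum.distrib complex_vector.scale_sum_right)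

lemma clinear_funpow: "clinear f \<Longrightarrow> clinear (f ^^ k)" for f :: "'a::complex_vector \<Rightarrow> 'a"
  by (induction k) (simp_all add: clinear_iff)

section \<open>Subspaces and their Minkowski sums\<close>

lemma subspace_null_space: "clinear f \<Longrightarrow> complex_vector.subspace (null_space f)"
  by (auto simp: complex_vector.subspace_def null_space_def clinear_0 clinear_add clinear_scaleC)

lemma subspace_range:
  assumes "clinear f"
  shows "complex_vector.subspace (range f)"
proof -
  interpret f: Vector_Spaces.linear scaleC scaleC f by fact
  show ?thesis by (rule f.subspace_image[OF complex_vector.subspace_UNIV])
qed

lemma subspace_plus:
  fixes V W :: "'a::complex_vector set"
  assumes "complex_vector.subspace V" "complex_vector.subspace W"
  shows "complex_vector.subspace (V + W)"
proof -
  have "V + W = {x + y |x y. x \<in> V \<and> y \<in> W}" by (auto simp: set_plus_def)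
  then show ?thesis using complex_vector.subspace_sums[OF assms] by simp
qed

lemma subspace_set_sum:
  fixes V :: "'i \<Rightarrow> 'a::complex_vector set"
  assumes "\<And>i. i \<in> I \<Longrightarrow> complex_vector.subspace (V i)"
  shows "complex_vector.subspace (\<Sum>i\<in>I. V i)"
  using assms
proof (induction I rule: infinite_finite_induct)
  case (insert i I)
  then show ?case by (simp add: subspace_plus)
qed (auto simp: set_zero)

lemma set_sum_memI:
  fixes V :: "'i \<Rightarrow> 'a::comm_monoid_add set"
  assumes "finite I" "\<And>i. i \<in> I \<Longrightarrow> f i \<in> V i"
  shows "(\<Sum>i\<in>I. f i) \<in> (\<Sum>i\<in>I. V i)"
  using set_sum_alt[OF assms(1), of V] assms(2) by auto

lemma set_sum_memD:
  fixes V :: "'i \<Rightarrow> 'a::comm_monoid_add set"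
  assumes "finite I" "x \<in> (\<Sum>i\<in>I. V i)"
  shows "\<exists>f. x = (\<Sum>i\<in>I. f i) \<and> (\<forall>i\<in>I. f i \<in> V i)"
  using set_sum_alt[OF assms(1), of V] assms(2) by auto

lemma set_sum_mono:
  fixes V W :: "'i \<Rightarrow> 'a::comm_monoid_add set"
  assumes "\<And>i. i \<in> I \<Longrightarrow> V i \<subseteq> W i"
  shows "(\<Sum>i\<in>I. V i) \<subseteq> (\<Sum>i\<in>I. W i)"
  using assms
  by (induction I rule: infinite_finite_induct) (simp_all add: set_plus_mono2)

lemma set_sum_member_subset:
  fixes V :: "'i \<Rightarrow> 'a::complex_vector set"
  assumes "finite I" "j \<in> I" "\<And>i. complex_vector.subspace (V i)"
  shows "V j \<subseteq> (\<Sum>i\<in>I. V i)"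
proof
  fix x assume "x \<in> V j"
  then have "(\<Sum>i\<in>I. if i = j then x else 0) \<in> (\<Sum>i\<in>I. V i)"
    using assms by (intro set_sum_memI) (auto intro: complex_vector.subspace_0)
  then show "x \<in> (\<Sum>i\<in>I. V i)"
    using assms by simp
qed

section \<open>Ideals of polynomials\<close>

text \<open>A nonzero element of least degree divides every element, and a root of it would be a
  common root, so it is constant by the fundamental theorem of algebra. Applied to the polynomials g
  for which g(S)x lies in a given subspace, this replaces a Bezout identity over the roots of one
  polynomial.\<close>

lemma ideal_without_common_root:
  fixes I :: "complex poly set"
  assumes add: "\<And>f g. f \<in> I \<Longrightarrow> g \<in> I \<Longrightarrow> f + g \<in> I"
    and mult: "\<And>f g. f \<in> I \<Longrightarrow> g * f \<in> I"
    and no_root: "\<And>l. \<exists>f\<in>I. poly f l \<noteq> 0"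
  shows "1 \<in> I"
proof -
  from no_root obtain f0 where f0: "f0 \<in> I" "f0 \<noteq> 0" by (metis poly_0)
  define g where "g = arg_min degree (\<lambda>f. f \<in> I \<and> f \<noteq> 0)"
  have g: "g \<in> I" "g \<noteq> 0"
    using arg_min_natI[of "\<lambda>f. f \<in> I \<and> f \<noteq> 0" f0 degree] f0 unfolding g_def by auto
  have min: "degree g \<le> degree f" if "f \<in> I" "f \<noteq> 0" for f
    using arg_min_nat_le[of "\<lambda>f. f \<in> I \<and> f \<noteq> 0" f degree] that unfolding g_def by auto
  have dvd: "g dvd f" if "f \<in> I" for f
  proof (rule ccontr)
    assume "\<not> g dvd f"
    then have "f mod g \<noteq> 0" by (simp add: dvd_eq_mod_eq_0)
    moreover have "f mod g = f + (- (f div g)) * g"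
      by (simp add: minus_div_mult_eq_mod[symmetric])
    then have "f mod g \<in> I" using add mult that g by metis
    ultimately show False
      using min[of "f mod g"] degree_mod_less[of g f] g by auto
  qed
  have "degree g = 0"
  proof (rule ccontr)
    assume "degree g \<noteq> 0"
    then have "\<not> constant (poly g)" by (simp add: constant_degree)
    then obtain l where l: "poly g l = 0" using fundamental_theorem_of_algebra by blast
    obtain f where f: "f \<in> I" "poly f l \<noteq> 0" using no_root by blast
    obtain h where "f = g * h" using dvd[OF f(1)] by (rule dvdE)
    with l f(2) show False by simp
  qed
  then obtain c where "g = [:c:]" by (elim degree_eq_zeroE)
  then have "[:inverse c:] * g = 1" using g by simp
  then show ?thesis using mult[OF g(1), of "[:inverse c:]"] by simp
qed

section \<open>Polynomials in an operator\<close>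

definition peval :: "('a::complex_vector \<Rightarrow> 'a) \<Rightarrow> complex poly \<Rightarrow> 'a \<Rightarrow> 'a"
  where "peval S p x = (\<Sum>i\<le>degree p. coeff p i *\<^sub>C (S ^^ i) x)"

lemma peval_eq_sum:
  assumes "degree p \<le> n"
  shows "peval S p x = (\<Sum>i\<le>n. coeff p i *\<^sub>C (S ^^ i) x)"
  unfolding peval_def using assms
  by (intro sum.mono_neutral_left) (auto simp: coeff_eq_0 not_le)

lemma peval_add: "peval S (p + q) x = peval S p x + peval S q x"
proof -
  define n where "n = max (degree p) (degree q)"
  have "degree p \<le> n" "degree q \<le> n" "degree (p + q) \<le> n"
    by (auto simp: n_def degree_add_le)
  then show ?thesis
    by (simp add: peval_eq_sum[of _ n] scaleC_add_left sum.distrib)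
qed

lemma peval_0 [simp]: "peval S 0 x = 0"
  and peval_1 [simp]: "peval S 1 x = x"
  by (simp_all add: peval_def scaleC_one)

lemma clinear_peval: "clinear S \<Longrightarrow> clinear (peval S p)"
  unfolding peval_def
  by (intro clinear_compose_sum clinear_compose_scaleC clinear_funpow)

lemma peval_pCons:
  assumes "clinear S"
  shows "peval S (pCons c p) x = c *\<^sub>C x + S (peval S p x)"
proof -
  have "peval S (pCons c p) x = (\<Sum>i\<le>Suc (degree p). coeff (pCons c p) i *\<^sub>C (S ^^ i) x)"
    by (rule peval_eq_sum) (rule degree_pCons_le)
  also have "\<dots> = c *\<^sub>C x + (\<Sum>i\<le>degree p. coeff p i *\<^sub>C S ((S ^^ i) x))"
    by (subst sum.atMost_Suc_shift) simp
  also have "\<dots> = c *\<^sub>C x + S (peval S p x)"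
    by (simp add: peval_def clinear_sum[OF assms] clinear_scaleC[OF assms])
  finally show ?thesis .
qed

lemma peval_smult: "peval S (smult c p) x = c *\<^sub>C peval S p x"
  unfolding peval_eq_sum[OF degree_smult_le]
  by (simp add: peval_def complex_vector.scale_sum_right scaleC_scaleC)

lemma peval_mult:
  assumes "clinear S"
  shows "peval S (p * q) x = peval S p (peval S q x)"
proof (induction p)
  case (pCons c p)
  have "peval S (pCons c p * q) x = peval S (smult c q) x + peval S (pCons 0 (p * q)) x"
    by (simp add: mult_pCons_left peval_add)
  then show ?case
    by (simp add: pCons peval_pCons[OF assms] peval_smult)
qed simp

lemma peval_power_linear:
  assumes "clinear S"
  shows "peval S ([:- l, 1:] ^ k) x = ((\<lambda>x. S x - l *\<^sub>C x) ^^ k) x"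
  by (induction k)
    (simp_all add: peval_mult[OF assms] peval_pCons[OF assms] clinear_0[OF assms]
      complex_vector.scale_minus_left del: mult_pCons_left)

lemma peval_commute:
  assumes "clinear R" "\<And>x. R (S x) = S (R x)"
  shows "R (peval S p x) = peval S p (R x)"
proof -
  have "R ((S ^^ i) x) = (S ^^ i) (R x)" for i
    by (induction i) (simp_all add: assms)
  then show ?thesis
    by (simp add: peval_def clinear_sum[OF assms(1)] clinear_scaleC[OF assms(1)])
qed

lemma peval_in_subspace:
  assumes "complex_vector.subspace V" "\<And>x. x \<in> V \<Longrightarrow> S x \<in> V" "x \<in> V"
  shows "peval S p x \<in> V"
proof -
  have "(S ^^ i) x \<in> V" for i by (induction i) (simp_all add: assms)
  then show ?thesis
    unfolding peval_def
    by (intro complex_vector.subspace_sum complex_vector.subspace_scale assms)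
qed

text \<open>Gaussian elimination on \<open>B\<close>: if some \<open>v j\<close> has a nonzero
  coefficient at \<open>b\<close>, subtracting multiples of it removes \<open>b\<close> from the
  other vectors. This costs one vector and one element of \<open>B\<close>, so the strict inequality
  of the cardinalities persists.\<close>

lemma relation_modulo_subspace:
  fixes v :: "'i \<Rightarrow> 'a::complex_vector"
  assumes "complex_vector.subspace V" "finite B" "finite I" "card B < card I"
    and "\<And>i. i \<in> I \<Longrightarrow> v i \<in> V + complex_vector.span B"
  shows "\<exists>c. (\<exists>i\<in>I. c i \<noteq> 0) \<and> (\<Sum>i\<in>I. c i *\<^sub>C v i) \<in> V"
  using assms(2-)
proof (induction B arbitrary: I v rule: finite_induct)
  case empty
  then obtain j where "j \<in> I" by (metis card.empty card_gt_0_iff equals0I)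
  moreover have "v i \<in> V" if "i \<in> I" for i using empty.prems(3)[OF that] by simp
  ultimately show ?case
    by (intro exI[of _ "\<lambda>_. 1"])
      (auto intro!: complex_vector.subspace_sum complex_vector.subspace_scale assms)
next
  case (insert b B)
  have "\<exists>d w. v i = d *\<^sub>C b + w \<and> w \<in> V + complex_vector.span B" if i: "i \<in> I" for i
  proof -
    obtain a s where "a \<in> V" "s \<in> complex_vector.span (insert b B)" "v i = a + s"
      using insert.prems(3)[OF i] by (auto elim: set_plus_elim)
    moreover from this(2) obtain k where "s - k *\<^sub>C b \<in> complex_vector.span B"
      by (auto simp: complex_vector.span_insert)
    ultimately show ?thesis
      by (intro exI[of _ k] exI[of _ "a + (s - k *\<^sub>C b)"]) (auto intro: set_plus_intro)
  qed
  then obtain d w where dw: "\<And>i. i \<in> I \<Longrightarrow> v i = d i *\<^sub>C b + w i"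
    "\<And>i. i \<in> I \<Longrightarrow> w i \<in> V + complex_vector.span B"
    by metis
  have sub: "complex_vector.subspace (V + complex_vector.span B)"
    by (intro subspace_plus assms complex_vector.subspace_span)
  show ?case
  proof (cases "\<forall>i\<in>I. d i = 0")
    case True
    then show ?thesis using insert dw by (intro insert.IH) auto
  next
    case False
    then obtain j where j: "j \<in> I" "d j \<noteq> 0" by blast
    define v' where "v' i = v i - (d i / d j) *\<^sub>C v j" for i
    have "v' i = w i - (d i / d j) *\<^sub>C w j" if "i \<in> I" for i
      using j that
      by (simp add: v'_def dw(1) scaleC_add_right scaleC_scaleC algebra_simps)
    then have mem: "v' i \<in> V + complex_vector.span B" if "i \<in> I - {j}" for i
      using that j dw by (auto intro!: complex_vector.subspace_diff[OF sub]
          complex_vector.subspace_scale[OF sub])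
    have "card B < card (I - {j})"
      using insert j by (simp add: card_Diff_singleton)
    then obtain c where c: "\<exists>i\<in>I - {j}. c i \<noteq> 0" "(\<Sum>i\<in>I - {j}. c i *\<^sub>C v' i) \<in> V"
      using insert.IH[of "I - {j}" v'] mem insert.prems(1) by auto
    \<comment> \<open>Undoing the elimination collects all subtracted multiples of
      \<open>v j\<close> in the single coefficient \<open>- e\<close>. A nonzero coefficient
      survives because it sits at an index other than \<open>j\<close>.\<close>
    define e where "e = (\<Sum>i\<in>I - {j}. c i * (d i / d j))"
    have "(\<Sum>i\<in>I - {j}. c i *\<^sub>C v' i) = (\<Sum>i\<in>I - {j}. c i *\<^sub>C v i) - e *\<^sub>C v j"
      by (simp add: v'_def e_def complex_vector.scale_right_diff_distrib sum_subtractf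
          scaleC_scaleC complex_vector.scale_sum_left)
    also have "\<dots> = (\<Sum>i\<in>I. (if i = j then - e else c i) *\<^sub>C v i)"
      using insert.prems(1) j
      by (simp add: sum.remove[OF insert.prems(1) j(1)] complex_vector.scale_minus_left)
    finally show ?thesis using c
      by (intro exI[of _ "\<lambda>i. if i = j then - e else c i"]) auto
  qed
qed

text \<open>The \<open>card B + 1\<close> iterates of \<open>x\<close> with exponents up to
  \<open>card B\<close> are too many to be independent modulo \<open>V\<close>, and a relation among
  them is a polynomial in \<open>S\<close>.\<close>

lemma annihilating_polynomial_vector:
  assumes "complex_vector.subspace V" "finite B"
    and "\<And>k. (S ^^ k) x \<in> V + complex_vector.span B"
  shows "\<exists>p. p \<noteq> 0 \<and> peval S p x \<in> V"
proof -
  obtain c where c: "\<exists>i\<in>{..card B}. c i \<noteq> 0" "(\<Sum>i\<le>card B. c i *\<^sub>C (S ^^ i) x) \<in> V"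
    using relation_modulo_subspace[OF assms(1,2), of "{..card B}" "\<lambda>k. (S ^^ k) x"] assms(3)
    by auto
  define p where "p = (\<Sum>i\<le>card B. monom (c i) i)"
  have coeff: "coeff p i = (if i \<le> card B then c i else 0)" for i
    by (simp add: p_def coeff_sum)
  have "degree p \<le> card B" by (intro degree_le) (simp add: coeff)
  then have "peval S p x = (\<Sum>i\<le>card B. c i *\<^sub>C (S ^^ i) x)"
    by (simp add: peval_eq_sum coeff)
  moreover have "p \<noteq> 0" using c(1) coeff by (metis atMost_iff coeff_0)
  ultimately show ?thesis using c(2) by auto
qed

text \<open>The product of polynomials that send the individual elements of \<open>B\<close> into
  \<open>V\<close> sends all of them there, because the factors commute and \<open>V\<close> is
  invariant. It is used with \<open>V\<close> the sum of the ranges inside the whole space, and with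
  \<open>V = {0}\<close> inside the joint kernel.\<close>

lemma annihilating_polynomial:
  fixes S :: "'a::complex_vector \<Rightarrow> 'a"
  assumes S: "clinear S" and V: "complex_vector.subspace V" "\<And>x. x \<in> V \<Longrightarrow> S x \<in> V"
    and B: "finite B" and inv: "\<And>x. x \<in> V + complex_vector.span B \<Longrightarrow> S x \<in> V + complex_vector.span B"
  shows "\<exists>p. p \<noteq> 0 \<and> (\<forall>x\<in>V + complex_vector.span B. peval S p x \<in> V)"
proof -
  have sub: "b \<in> V + complex_vector.span B" if "b \<in> B" for b
    using set_plus_intro[OF complex_vector.subspace_0[OF V(1)] complex_vector.span_base[OF that]]
    by simp
  have "(S ^^ k) b \<in> V + complex_vector.span B" if "b \<in> B" for k b
    by (induction k) (simp_all add: sub[OF that] inv)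
  then have "\<exists>p. p \<noteq> 0 \<and> peval S p b \<in> V" if "b \<in> B" for b
    by (rule annihilating_polynomial_vector[OF V(1) B]) (rule that)
  then obtain p where p: "\<And>b. b \<in> B \<Longrightarrow> p b \<noteq> 0" "\<And>b. b \<in> B \<Longrightarrow> peval S (p b) b \<in> V"
    by (metis (no_types, lifting))
  define q where "q = (\<Prod>b\<in>B. p b)"
  have "q \<noteq> 0" using B p(1) by (simp add: q_def)
  have q: "clinear (peval S q)" by (rule clinear_peval[OF S])
  have qB: "peval S q b \<in> V" if "b \<in> B" for b
  proof -
    have "q = (\<Prod>c\<in>B - {b}. p c) * p b"
      by (simp add: q_def prod.remove[OF B that] mult.commute)
    then show ?thesis
      using peval_in_subspace[OF V p(2)[OF that]] by (simp add: peval_mult[OF S])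
  qed
  have "complex_vector.span B \<subseteq> {x. peval S q x \<in> V}"
  proof (rule complex_vector.span_minimal)
    show "complex_vector.subspace {x. peval S q x \<in> V}"
      using V(1) unfolding complex_vector.subspace_def
      by (simp add: clinear_0[OF q] clinear_add[OF q] clinear_scaleC[OF q])
  qed (use qB in auto)
  then have qspan: "peval S q x \<in> V" if "x \<in> complex_vector.span B" for x
    using that by blast
  have "peval S q x \<in> V" if x: "x \<in> V + complex_vector.span B" for x
  proof -
    obtain v w where vw: "v \<in> V" "w \<in> complex_vector.span B" "x = v + w"
      using x by (rule set_plus_elim)
    have "peval S q v \<in> V" by (rule peval_in_subspace[OF V vw(1)])
    with qspan[OF vw(2)] show ?thesis
      by (simp add: vw(3) clinear_add[OF q] complex_vector.subspace_add[OF V(1)])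
  qed
  with \<open>q \<noteq> 0\<close> show ?thesis by blast
qed

section \<open>The open mapping theorem and the Hahn-Banach theorem\<close>

text \<open>The Baire category half of the open mapping theorem: the closures of the images of balls
  cover the complete target, so one of them has an interior point. The residual of half the size is
  removed later by iteration.\<close>

lemma approximate_preimages:
  fixes f :: "'a::real_normed_vector \<Rightarrow> 'b::banach"
  assumes f: "linear f" and S: "subspace S" and surj: "f ` S = UNIV"
  shows "\<exists>C>0. \<forall>y. \<exists>x\<in>S. norm x \<le> C * norm y \<and> norm (y - f x) \<le> norm y / 2"
proof -
  define A where "A n = closure (f ` (S \<inter> cball 0 (real n)))" for n
  have "\<exists>n. interior (A n) \<noteq> {}"
  proof (rule ccontr)
    assume "\<not> ?thesis"
    then have "Met_TC.mtopology interior_of \<Union>(range A) = {}"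
      by (intro Met_TC.metric_Baire_category_alt)
        (auto simp: A_def mtopology_is_euclidean complete_UNIV)
    moreover have "\<Union>(range A) = UNIV"
    proof -
      have "y \<in> \<Union>(range A)" for y
      proof -
        obtain x where x: "x \<in> S" "f x = y" using surj by (metis UNIV_I imageE)
        obtain n where "norm x \<le> real n" using real_arch_simple by blast
        then have "y \<in> f ` (S \<inter> cball 0 (real n))"
          using x by (intro image_eqI[of _ _ x]) simp_all
        then have "y \<in> A n" unfolding A_def by (rule subsetD[OF closure_subset])
        then show ?thesis by (rule UN_I[OF UNIV_I])
      qed
      then show ?thesis by blast
    qed
    ultimately show False by simp
  qed
  then obtain n y0 where "y0 \<in> interior (A n)" by blast
  then obtain e where e: "e > 0" "ball y0 e \<subseteq> A n"
    by (meson interior_subset open_contains_ball open_interior subset_trans)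
  have near: "\<exists>x\<in>S. norm x \<le> real n \<and> norm (y - f x) < d" if y: "norm y < e" "d > 0" for y d
  proof -
    have "y0 + y \<in> A n" "y0 - y \<in> A n" using e y by (auto simp: subset_iff dist_norm)
    then obtain x1 x2 where x: "x1 \<in> S" "norm x1 \<le> real n" "dist (f x1) (y0 + y) < d"
      "x2 \<in> S" "norm x2 \<le> real n" "dist (f x2) (y0 - y) < d"
      using y(2) unfolding A_def closure_approachable by (fastforce simp: dist_norm)
    \<comment> \<open>Half the difference of approximate preimages of \<open>y0 + y\<close> and
      \<open>y0 - y\<close> moves the centre of the ball from \<open>y0\<close> to the
      origin.\<close>
    define x where "x = (1/2) *\<^sub>R (x1 - x2)"
    have "x \<in> S" using x S by (simp add: x_def subspace_diff subspace_scale)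
    moreover have "norm x \<le> real n"
      using norm_triangle_ineq4[of x1 x2] x by (simp add: x_def)
    moreover have "norm (y - f x) < d"
    proof -
      have "y - f x = (1/2) *\<^sub>R ((f x2 - (y0 - y)) - (f x1 - (y0 + y)))"
        by (simp add: x_def linear_scale[OF f] linear_diff[OF f] scaleR_right_diff_distrib
            scaleR_right_distrib flip: scaleR_add_left)
      then show ?thesis
        using norm_triangle_ineq4[of "f x2 - (y0 - y)" "f x1 - (y0 + y)"] x(3,6)
        by (simp add: dist_norm)
    qed
    ultimately show ?thesis by blast
  qed
  \<comment> \<open>Scaling by \<open>t\<close> below brings \<open>y\<close> to norm
    \<open>e / 2\<close>, where a vector of norm at most \<open>n\<close> is an approximate
    preimage; scaling back gives this factor. The summand 1 keeps \<open>C\<close> positive when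
    \<open>n = 0\<close>.\<close>
  define C where "C = 2 * (real n + 1) / e"
  have "\<exists>x\<in>S. norm x \<le> C * norm y \<and> norm (y - f x) \<le> norm y / 2" for y
  proof (cases "y = 0")
    case True
    then show ?thesis using S linear_0[OF f] by (intro bexI[of _ 0]) (auto simp: subspace_0)
  next
    case False
    define t where "t = e / (2 * norm y)"
    have t: "t > 0" using False e by (simp add: t_def)
    have "norm (t *\<^sub>R y) < e" using False e t by (simp add: t_def)
    from near[OF this, of "t * norm y / 2"] t False
    obtain x where x: "x \<in> S" "norm x \<le> real n" "norm (t *\<^sub>R y - f x) < t * norm y / 2"
      by auto
    show ?thesis
    proof (intro bexI[of _ "x /\<^sub>R t"] conjI)
      show "x /\<^sub>R t \<in> S" using x S by (simp add: subspace_scale)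
      have "norm (x /\<^sub>R t) \<le> (real n + 1) / t" using x t by (simp add: divide_simps)
      also have "\<dots> = C * norm y" using False e by (simp add: t_def C_def)
      finally show "norm (x /\<^sub>R t) \<le> C * norm y" .
      have "y - f (x /\<^sub>R t) = (t *\<^sub>R y - f x) /\<^sub>R t"
        using t by (simp add: linear_scale[OF f] scaleR_right_diff_distrib)
      then show "norm (y - f (x /\<^sub>R t)) \<le> norm y / 2"
        using t x(3) by (simp add: divide_simps mult.commute)
    qed
  qed
  moreover have "C > 0" using e by (simp add: C_def)
  ultimately show ?thesis by blast
qed

text \<open>The residuals \<open>r k\<close> are halved at each step, so the corrections
  \<open>g (r k)\<close> form an absolutely convergent series whose sum is an exact preimage; the
  factor 2 is the sum of the geometric series. The domain is a closed subspace because the map will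
  be restricted to a product of two complements.\<close>

lemma open_mapping_subspace:
  fixes f :: "'a::banach \<Rightarrow> 'b::banach"
  assumes f: "bounded_linear f" and S: "subspace S" "closed S" and surj: "f ` S = UNIV"
  shows "\<exists>C>0. \<forall>y. \<exists>x\<in>S. f x = y \<and> norm x \<le> C * norm y"
proof -
  interpret f: bounded_linear f by fact
  have "linear f" by (rule f.linear_axioms)
  from approximate_preimages[OF this S(1) surj]
  obtain C g where C: "C > 0" and g: "\<And>y. g y \<in> S" "\<And>y. norm (g y) \<le> C * norm y"
    "\<And>y. norm (y - f (g y)) \<le> norm y / 2"
    by metis
  have "\<exists>x\<in>S. f x = y \<and> norm x \<le> (2 * C) * norm y" for y
  proof -
    define r where "r k = ((\<lambda>y. y - f (g y)) ^^ k) y" for k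
    have r_Suc: "r (Suc k) = r k - f (g (r k))" for k by (simp add: r_def)
    have r: "norm (r k) \<le> norm y * (1/2) ^ k" for k
      by (induction k) (use g(3)[of "r _"] in \<open>auto simp: r_Suc r_def[of 0] intro: order_trans\<close>)
    have gr: "norm (g (r k)) \<le> (C * norm y) * (1/2) ^ k" for k
      using order_trans[OF g(2)[of "r k"] mult_left_mono[OF r[of k], of C]] C by (simp add: mult.assoc)
    have geo: "(\<lambda>k. (C * norm y) * (1/2) ^ k) sums (C * norm y * 2)"
      using sums_mult[OF geometric_sums[of "1/2::real"]] by simp
    have summable: "summable (\<lambda>k. g (r k))"
      by (rule summable_comparison_test'[OF sums_summable[OF geo] gr])
    define x where "x = (\<Sum>k. g (r k))"
    have "r \<longlonglongrightarrow> 0"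
    proof (rule Lim_null_comparison)
      show "\<forall>\<^sub>F k in sequentially. norm (r k) \<le> norm y * (1/2) ^ k" using r by simp
      show "(\<lambda>k. norm y * (1/2) ^ k) \<longlonglongrightarrow> 0"
        by (intro tendsto_mult_right_zero LIMSEQ_power_zero) simp
    qed
    from telescope_sums'[OF this] have "(\<lambda>k. f (g (r k))) sums y"
      by (simp add: r_Suc r_def[of 0])
    moreover have "(\<lambda>k. f (g (r k))) sums f x"
      unfolding x_def by (rule f.sums[OF summable_sums[OF summable]])
    ultimately have "f x = y" by (rule sums_unique2[symmetric])
    moreover have "norm x \<le> (2 * C) * norm y"
      using norm_suminf_le[OF gr sums_summable[OF geo]] sums_unique[OF geo]
      by (simp add: x_def mult_ac)
    moreover have "x \<in> S"
    proof (rule closed_sequentially[OF S(2)])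
      show "(\<lambda>n. \<Sum>k<n. g (r k)) \<longlonglongrightarrow> x"
        unfolding x_def by (rule summable_LIMSEQ[OF summable])
      show "(\<Sum>k<n. g (r k)) \<in> S" for n by (intro subspace_sum S g)
    qed
    ultimately show ?thesis by blast
  qed
  then show ?thesis using C by (intro exI[of _ "2 * C"]) auto
qed

text \<open>A partially defined functional is represented by its graph, a subspace of \<open>'a \<times> real\<close>.\<close>

lemma norming_functional:
  fixes x0 :: "'a::real_normed_vector"
  shows "\<exists>f. bounded_linear f \<and> f x0 = norm x0"
proof -
  define \<A> where "\<A> = {G :: ('a \<times> real) set.
    subspace G \<and> (\<forall>(x, a)\<in>G. a \<le> norm x) \<and> (x0, norm x0) \<in> G}"
  have "span {(x0, norm x0)} \<in> \<A>"
  proof -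
    have "c * norm x0 \<le> \<bar>c\<bar> * norm x0" for c by (intro mult_right_mono) auto
    then show ?thesis
      using span_base[of "(x0, norm x0)" "{(x0, norm x0)}"] subspace_span[of "{(x0, norm x0)}"]
      by (auto simp: \<A>_def span_singleton)
  qed
  then have "\<exists>M\<in>\<A>. \<forall>G\<in>\<A>. M \<subseteq> G \<longrightarrow> G = M"
  proof (intro subset_Zorn_nonempty)
    fix \<C> assume C: "\<C> \<noteq> {}" "subset.chain \<A> \<C>"
    then have sub: "subspace G" if "G \<in> \<C>" for G
      using that by (auto simp: subset.chain_def \<A>_def)
    have "subspace (\<Union>\<C>)"
      unfolding subspace_def
    proof (intro conjI ballI allI)
      show "0 \<in> \<Union>\<C>" using C(1) sub subspace_0 by blast
      show "c *\<^sub>R x \<in> \<Union>\<C>" if "x \<in> \<Union>\<C>" for c x using that sub subspace_scale by blast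
      show "x + y \<in> \<Union>\<C>" if xy: "x \<in> \<Union>\<C>" "y \<in> \<Union>\<C>" for x y
      proof -
        obtain G H where GH: "G \<in> \<C>" "H \<in> \<C>" "x \<in> G" "y \<in> H" using xy by blast
        then have "G \<subseteq> H \<or> H \<subseteq> G" using C(2) by (auto simp: subset.chain_def)
        then show ?thesis using GH sub subspace_add by blast
      qed
    qed
    moreover have "(\<forall>(x, a)\<in>\<Union>\<C>. a \<le> norm x) \<and> (x0, norm x0) \<in> \<Union>\<C>"
      using C by (fastforce simp: subset.chain_def \<A>_def)
    ultimately show "\<Union>\<C> \<in> \<A>" by (simp add: \<A>_def)
  qed auto
  then obtain M where M: "M \<in> \<A>" and max: "\<And>G. G \<in> \<A> \<Longrightarrow> M \<subseteq> G \<Longrightarrow> G = M" by blast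
  from M have sub: "subspace M" and le: "\<And>x a. (x, a) \<in> M \<Longrightarrow> a \<le> norm x"
    and x0: "(x0, norm x0) \<in> M" by (auto simp: \<A>_def)
  have total: "\<exists>a. (x1, a) \<in> M" for x1
  proof (rule ccontr)
    assume x1: "\<nexists>a. (x1, a) \<in> M"
    \<comment> \<open>A dominated extension must take at \<open>x1\<close> a value above all of
      \<open>L\<close> and below all numbers \<open>norm (x + x1) - a\<close>; \<open>gap\<close>
      says that the first family lies below the second.\<close>
    define L where "L = (\<lambda>(y, b). b - norm (y - x1)) ` M"
    have gap: "b - norm (y - x1) \<le> norm (x + x1) - a" if "(x, a) \<in> M" "(y, b) \<in> M" for x a y b
    proof -
      have "a + b \<le> norm (x + y)" using subspace_add[OF sub that] by (intro le) simp
      also have "x + y = (x + x1) + (y - x1)" by simp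
      finally show ?thesis using norm_triangle_ineq[of "x + x1" "y - x1"] by linarith
    qed
    define \<alpha> where "\<alpha> = Sup L"
    have zero: "(0, 0) \<in> M" using subspace_0[OF sub] by (simp add: zero_prod_def)
    have bdd: "bdd_above L"
      unfolding L_def bdd_above_def using gap[OF zero] by (auto intro!: exI[of _ "norm x1"])
    have lower: "b - norm (y - x1) \<le> \<alpha>" if "(y, b) \<in> M" for y b
      unfolding \<alpha>_def using that by (intro cSup_upper bdd) (auto simp: L_def)
    have upper: "\<alpha> \<le> norm (x + x1) - a" if "(x, a) \<in> M" for x a
      unfolding \<alpha>_def using zero gap[OF that] by (intro cSup_least) (auto simp: L_def)
    define M' where "M' = {p + q |p q. p \<in> M \<and> q \<in> span {(x1, \<alpha>)}}"
    have "subspace M'" unfolding M'_def by (intro subspace_sums sub subspace_span)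
    moreover have MM': "M \<subseteq> M'"
    proof
      fix p assume "p \<in> M"
      then have "p + 0 \<in> M'" unfolding M'_def using span_zero by blast
      then show "p \<in> M'" by simp
    qed
    moreover have "a' \<le> norm x'" if mem: "(x', a') \<in> M'" for x' a'
    proof -
      obtain x a t where xa: "(x, a) \<in> M" "x' = x + t *\<^sub>R x1" "a' = a + t * \<alpha>"
        using mem by (auto simp: M'_def span_singleton)
      consider "t = 0" | "t > 0" | "t < 0" by linarith
      then show ?thesis
      proof cases
        case 2
        have "(x /\<^sub>R t, a / t) \<in> M"
          using subspace_scale[OF sub xa(1), of "inverse t"] by (simp add: divide_inverse_commute)
        from upper[OF this] have "t * \<alpha> \<le> t * (norm (x /\<^sub>R t + x1) - a / t)"
          using 2 by (intro mult_left_mono) auto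
        also have "t * (norm (x /\<^sub>R t + x1) - a / t) = norm (t *\<^sub>R (x /\<^sub>R t + x1)) - a"
          using 2 by (simp add: right_diff_distrib)
        also have "t *\<^sub>R (x /\<^sub>R t + x1) = x'"
          using 2 xa by (simp add: scaleR_right_distrib)
        finally show ?thesis using xa by simp
      next
        case 3
        define s where "s = - t"
        have s: "s > 0" using 3 by (simp add: s_def)
        have "(x /\<^sub>R s, a / s) \<in> M"
          using subspace_scale[OF sub xa(1), of "inverse s"] by (simp add: divide_inverse_commute)
        from lower[OF this] have "s * (a / s - norm (x /\<^sub>R s - x1)) \<le> s * \<alpha>"
          using s by (intro mult_left_mono) auto
        also have "s * (a / s - norm (x /\<^sub>R s - x1)) = a - norm (s *\<^sub>R (x /\<^sub>R s - x1))"
          using s by (simp add: right_diff_distrib)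
        also have "s *\<^sub>R (x /\<^sub>R s - x1) = x'"
          using s xa by (simp add: scaleR_right_diff_distrib s_def)
        finally show ?thesis using xa by (simp add: s_def)
      qed (use xa le in auto)
    qed
    ultimately have "M' \<in> \<A>" using x0 by (auto simp: \<A>_def)
    then have "M' = M" using max MM' by blast
    moreover have "0 + (x1, \<alpha>) \<in> M'"
      unfolding M'_def using subspace_0[OF sub] span_base[of "(x1, \<alpha>)" "{(x1, \<alpha>)}"] by blast
    ultimately show False using x1 by simp
  qed
  then obtain f where fM: "\<And>x. (x, f x) \<in> M" by metis
  \<comment> \<open>Two values at one point put their difference \<open>c\<close> over 0; domination
    at \<open>(0, c)\<close> and \<open>(0, - c)\<close> gives \<open>c = 0\<close>.\<close>
  have unique: "a = f x" if "(x, a) \<in> M" for x a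
  proof -
    have "a - f x \<le> 0" using le[of 0] subspace_diff[OF sub that fM[of x]] by force
    moreover have "f x - a \<le> 0" using le[of 0] subspace_diff[OF sub fM[of x] that] by force
    ultimately show ?thesis by simp
  qed
  have "bounded_linear f"
  proof (rule bounded_linear_intro)
    show "f (x + y) = f x + f y" for x y
      using subspace_add[OF sub fM[of x] fM[of y]] by (intro unique[symmetric]) simp
    show scale: "f (r *\<^sub>R x) = r *\<^sub>R f x" for r x
      using subspace_scale[OF sub fM[of x], of r] by (intro unique[symmetric]) simp
    show "norm (f x) \<le> norm x * 1" for x
      using le[OF fM[of x]] le[OF fM[of "- x"]] scale[of "- 1" x] by (auto simp: abs_le_iff)
  qed
  moreover have "f x0 = norm x0" using unique[OF x0] by simp
  ultimately show ?thesis by blast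
qed

section \<open>Closed subspaces, complements and generalised inverses\<close>

lemma bounded_clinear_clinear: "bounded_clinear f \<Longrightarrow> clinear f"
  by (simp add: bounded_clinear_def)

lemma clinear_linear:
  fixes f :: "'a::complex_normed_vector \<Rightarrow> 'b::complex_normed_vector"
  shows "clinear f \<Longrightarrow> linear f"
  by (rule linearI) (simp_all add: clinear_iff scaleR_scaleC)

lemma bounded_clinear_iff: "bounded_clinear f \<longleftrightarrow> clinear f \<and> bounded_linear f"
proof
  assume f: "bounded_clinear f"
  then have "linear f" by (intro clinear_linear bounded_clinear_clinear)
  moreover obtain K where "\<And>x. norm (f x) \<le> norm x * K"
    using f by (auto simp: bounded_clinear_def)
  ultimately show "clinear f \<and> bounded_linear f"
    using f by (auto simp: bounded_clinear_def bounded_linear_def bounded_linear_axioms_def)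
next
  assume "clinear f \<and> bounded_linear f"
  then show "bounded_clinear f"
    using bounded_linear.bounded[of f] by (simp add: bounded_clinear_def)
qed

lemma bounded_linear_scaleC: "bounded_linear (\<lambda>x. c *\<^sub>C x :: 'a::complex_normed_vector)"
proof -
  have "clinear (\<lambda>x. c *\<^sub>C x :: 'a)" by (rule clinear_compose_scaleC[OF clinear_id])
  then have "bounded_clinear (\<lambda>x. c *\<^sub>C x :: 'a)"
    unfolding bounded_clinear_def by (auto simp: norm_scaleC intro!: exI[of _ "cmod c"])
  then show ?thesis by (simp add: bounded_clinear_iff)
qed

lemma
  assumes "bounded_clinear f"
  shows bounded_clinear_compose_scaleC: "bounded_clinear (\<lambda>x. c *\<^sub>C f x)"
    and bounded_clinear_compose: "bounded_clinear g \<Longrightarrow> bounded_clinear (\<lambda>x. f (g x))"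
    and bounded_clinear_compose_diff: "bounded_clinear h \<Longrightarrow> bounded_clinear (\<lambda>x. f x - h x)"
proof -
  note f = assms[unfolded bounded_clinear_iff]
  show "bounded_clinear (\<lambda>x. c *\<^sub>C f x)"
    unfolding bounded_clinear_iff using f
      clinear_compose_scaleC bounded_linear_compose[OF bounded_linear_scaleC] by blast
  show "bounded_clinear (\<lambda>x. f (g x))" if "bounded_clinear g"
    using that f clinear_compose[of f g] bounded_linear_compose[of f g]
    unfolding bounded_clinear_iff by blast
  show "bounded_clinear (\<lambda>x. f x - h x)" if "bounded_clinear h"
    using that f clinear_compose_diff[of f h] bounded_linear_sub[of f h]
    unfolding bounded_clinear_iff by blast
qed

lemma bounded_clinear_ident: "bounded_clinear (\<lambda>x. x)"
  and bounded_clinear_zero: "bounded_clinear (\<lambda>x. 0)"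
  by (simp_all add: bounded_clinear_iff bounded_linear_ident bounded_linear_zero)

lemma bounded_clinear_sum:
  "(\<And>i. i \<in> I \<Longrightarrow> bounded_clinear (f i)) \<Longrightarrow> bounded_clinear (\<lambda>x. \<Sum>i\<in>I. f i x)"
  by (simp add: bounded_clinear_iff clinear_compose_sum bounded_linear_sum)

lemma continuous_bounded_clinear: "bounded_clinear f \<Longrightarrow> continuous_on S f"
  by (simp add: bounded_clinear_iff linear_continuous_on)

lemma closed_fixed_points: "bounded_clinear f \<Longrightarrow> closed {x. f x = x}"
  by (intro closed_Collect_eq continuous_bounded_clinear continuous_on_id)

lemma subspace_fixed_points: "clinear f \<Longrightarrow> complex_vector.subspace {x. f x = x}"
  using clinear_0[of f] by (auto simp: complex_vector.subspace_def clinear_iff)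

lemma closed_preimage:
  "bounded_clinear f \<Longrightarrow> closed W \<Longrightarrow> closed {x. f x \<in> W}"
  using continuous_closed_vimage[of W f] continuous_bounded_clinear[of f UNIV]
  by (simp add: vimage_def continuous_on_eq_continuous_at)

lemma subspace_preimage:
  "clinear f \<Longrightarrow> complex_vector.subspace W \<Longrightarrow> complex_vector.subspace {x. f x \<in> W}"
  using clinear_0[of f] by (auto simp: complex_vector.subspace_def clinear_iff)

lemma subspace_imp_real_subspace: "complex_vector.subspace V \<Longrightarrow> subspace V"
  by (simp add: subspace_def complex_vector.subspace_def scaleR_scaleC)

section \<open>Enlarging a subspace by finitely many vectors\<close>

lemma plus_span_insert:
  fixes V :: "'a::complex_vector set"
  shows "V + complex_vector.span (insert b B)
    = (V + complex_vector.span {b}) + complex_vector.span B"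
proof -
  have "complex_vector.span (insert b B) = complex_vector.span {b} + complex_vector.span B"
    using complex_vector.span_Un[of "{b}" B] by (auto simp: set_plus_def)
  then show ?thesis by (simp add: add.assoc)
qed

lemma mem_plus_span_singleton:
  "x \<in> V + complex_vector.span {b} \<longleftrightarrow> (\<exists>v\<in>V. \<exists>c. x = v + c *\<^sub>C b)"
  by (auto simp: set_plus_def complex_vector.span_singleton)

lemma subset_plus_span: "V \<subseteq> V + complex_vector.span B"
  using complex_vector.span_zero by (force simp: set_plus_def)

lemma plus_span_absorb:
  assumes V: "complex_vector.subspace V" and "b \<in> V"
  shows "V + complex_vector.span {b} = V"
  using assms subset_plus_span
  by (auto simp: mem_plus_span_singleton complex_vector.subspace_add complex_vector.subspace_scale)

text \<open>The distance from \<open>b\<close> to a closed \<open>V\<close> not containing it is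
  positive and bounds the coefficient of \<open>b\<close> by the norm of the whole vector. So the
  coefficients along a convergent sequence are Cauchy in the complex numbers, and the components in
  \<open>V\<close> converge as well.\<close>

lemma closed_plus_line:
  fixes V :: "'a::complex_normed_vector set"
  assumes V: "complex_vector.subspace V" "closed V"
  shows "closed (V + complex_vector.span {b})"
proof (cases "b \<in> V")
  case True
  then show ?thesis using V by (simp add: plus_span_absorb)
next
  case False
  have "V \<noteq> {}" using V(1) complex_vector.subspace_0 by blast
  then have d: "infdist b V > 0" using False V(2) by (simp add: infdist_pos_not_in_closed)
  have dist: "cmod c * infdist b V \<le> norm (v + c *\<^sub>C b)" if "v \<in> V" for v c
  proof (cases "c = 0")
    case c: False
    have "(- inverse c) *\<^sub>C v \<in> V" using V(1) that by (rule complex_vector.subspace_scale)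
    then have "infdist b V \<le> dist b ((- inverse c) *\<^sub>C v)" by (rule infdist_le)
    then have "cmod c * infdist b V \<le> norm (c *\<^sub>C (b - (- inverse c) *\<^sub>C v))"
      by (simp add: dist_norm norm_scaleC mult_left_mono)
    also have "c *\<^sub>C (b - (- inverse c) *\<^sub>C v) = v + c *\<^sub>C b"
      using c by (simp add: scaleC_add_right scaleC_scaleC scaleC_one
          complex_vector.scale_minus_left add.commute)
    finally show ?thesis .
  qed simp
  show ?thesis
    unfolding closed_sequential_limits
  proof (intro allI impI, elim conjE)
    fix y l assume y: "\<forall>n. y n \<in> V + complex_vector.span {b}" and lim: "y \<longlonglongrightarrow> l"
    then obtain v c where vc: "\<And>n. v n \<in> V" "\<And>n. y n = v n + c n *\<^sub>C b"
      unfolding mem_plus_span_singleton by metis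
    have c_le: "cmod (c m - c n) * infdist b V \<le> norm (y m - y n)" for m n
    proof -
      have "y m - y n = (v m - v n) + (c m - c n) *\<^sub>C b"
        by (simp add: vc complex_vector.scale_left_diff_distrib)
      then show ?thesis using dist complex_vector.subspace_diff[OF V(1) vc(1) vc(1)] by simp
    qed
    have "Cauchy c"
    proof (rule metric_CauchyI)
      fix e :: real assume "e > 0"
      then obtain N where N: "\<And>m n. m \<ge> N \<Longrightarrow> n \<ge> N \<Longrightarrow> dist (y m) (y n) < e * infdist b V"
        using metric_CauchyD[OF LIMSEQ_imp_Cauchy[OF lim]] d by (meson mult_pos_pos)
      then have "dist (c m) (c n) < e" if "m \<ge> N" "n \<ge> N" for m n
        using le_less_trans[OF c_le N[OF that, unfolded dist_norm]] d by (simp add: dist_norm)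
      then show "\<exists>N. \<forall>m\<ge>N. \<forall>n\<ge>N. dist (c m) (c n) < e" by blast
    qed
    then obtain c' where c': "c \<longlonglongrightarrow> c'" using Cauchy_convergent_iff convergent_def by blast
    have "(\<lambda>n. c n *\<^sub>C b) \<longlonglongrightarrow> c' *\<^sub>C b"
    proof (rule LIM_zero_cancel, rule tendsto_norm_zero_cancel)
      have "(\<lambda>n. cmod (c n - c') * norm b) \<longlonglongrightarrow> 0"
        using tendsto_mult_left_zero[OF tendsto_norm_zero[OF LIM_zero[OF c']]] .
      then show "(\<lambda>n. norm (c n *\<^sub>C b - c' *\<^sub>C b)) \<longlonglongrightarrow> 0"
        by (simp add: norm_scaleC flip: complex_vector.scale_left_diff_distrib)
    qed
    from tendsto_diff[OF lim this] have "v \<longlonglongrightarrow> l - c' *\<^sub>C b"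
      by (simp add: vc(2))
    then have "l - c' *\<^sub>C b \<in> V" using V(2) vc(1) closed_sequentially by blast
    then show "l \<in> V + complex_vector.span {b}"
      unfolding mem_plus_span_singleton by (metis diff_add_cancel)
  qed
qed

lemma closed_plus_span:
  fixes V :: "'a::complex_normed_vector set"
  assumes "finite B" "complex_vector.subspace V" "closed V"
  shows "closed (V + complex_vector.span B)"
  using assms
proof (induction B arbitrary: V rule: finite_induct)
  case (insert b B)
  then show ?case
    unfolding plus_span_insert[of V b B]
    by (intro insert.IH subspace_plus closed_plus_line) auto
qed simp

lemma closed_span:
  fixes B :: "'a::complex_normed_vector set"
  shows "finite B \<Longrightarrow> closed (complex_vector.span B)"
  using closed_plus_span[of B "{0}"] by simp

text \<open>The map is twice the complex-linear part of \<open>f\<close>. It turns a real norming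
  functional into a complex functional, and the real-linear coefficients found in the operator
  ideals into complex-linear ones.\<close>

lemma bounded_clinear_complexification:
  fixes f :: "'a::complex_normed_vector \<Rightarrow> 'b::complex_normed_vector"
  assumes f: "bounded_linear f"
  shows "bounded_clinear (\<lambda>x. f x - \<i> *\<^sub>C f (\<i> *\<^sub>C x))"
proof -
  interpret f: bounded_linear f by fact
  define g where "g x = f x - \<i> *\<^sub>C f (\<i> *\<^sub>C x)" for x
  have "clinear g"
    unfolding clinear_iff
  proof (intro conjI allI)
    show "g (x + y) = g x + g y" for x y
      by (simp add: g_def f.add scaleC_add_right algebra_simps)
    show "g (c *\<^sub>C x) = c *\<^sub>C g x" for c x
    proof -
      have "c *\<^sub>C x = Re c *\<^sub>R x + Im c *\<^sub>R (\<i> *\<^sub>C x)"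
        by (subst (1) complex_eq[of c])
          (simp add: scaleC_add_left scaleR_scaleC scaleC_scaleC mult.commute)
      then have 1: "f (c *\<^sub>C x) = Re c *\<^sub>R f x + Im c *\<^sub>R f (\<i> *\<^sub>C x)"
        by (simp only: f.add f.scaleR)
      have "\<i> * c = complex_of_real (Re c) * \<i> - complex_of_real (Im c)"
        by (simp add: complex_eq_iff)
      then have "\<i> *\<^sub>C (c *\<^sub>C x) = Re c *\<^sub>R (\<i> *\<^sub>C x) - Im c *\<^sub>R x"
        by (simp add: scaleR_scaleC scaleC_scaleC complex_vector.scale_left_diff_distrib)
      then have 2: "f (\<i> *\<^sub>C (c *\<^sub>C x)) = Re c *\<^sub>R f (\<i> *\<^sub>C x) - Im c *\<^sub>R f x"
        by (simp only: f.diff f.scaleR)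
      have "g (c *\<^sub>C x)
          = (complex_of_real (Re c) + \<i> * complex_of_real (Im c)) *\<^sub>C f x
            + (complex_of_real (Im c) - \<i> * complex_of_real (Re c)) *\<^sub>C f (\<i> *\<^sub>C x)"
        unfolding g_def 1 2
        by (simp add: scaleR_scaleC scaleC_scaleC scaleC_add_left
            complex_vector.scale_left_diff_distrib complex_vector.scale_right_diff_distrib)
      also have "\<dots> = c *\<^sub>C f x + (- (c * \<i>)) *\<^sub>C f (\<i> *\<^sub>C x)"
        by (intro arg_cong2[where f = "(+)"] arg_cong2[where f = scaleC] refl)
          (simp_all add: complex_eq_iff)
      also have "\<dots> = c *\<^sub>C g x"
        by (simp add: g_def scaleC_scaleC complex_vector.scale_right_diff_distrib
            complex_vector.scale_minus_left)
      finally show ?thesis .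
    qed
  qed
  moreover have "bounded_linear g"
    unfolding g_def
    by (intro bounded_linear_sub bounded_linear_compose[OF bounded_linear_scaleC] f
        bounded_linear_compose[OF f bounded_linear_scaleC])
  ultimately show ?thesis unfolding bounded_clinear_iff g_def by blast
qed

lemma separating_functional:
  fixes x0 :: "'a::complex_normed_vector"
  assumes "x0 \<noteq> 0"
  shows "\<exists>g :: 'a \<Rightarrow> complex. bounded_clinear g \<and> g x0 = 1"
proof -
  obtain f where f: "bounded_linear f" "f x0 = norm x0" using norming_functional by blast
  define g where "g x = complex_of_real (f x) - \<i> *\<^sub>C complex_of_real (f (\<i> *\<^sub>C x))" for x
  have g: "bounded_clinear g"
    unfolding g_def
    by (rule bounded_clinear_complexification[OF bounded_linear_compose[OF bounded_linear_of_real f(1)]])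
  have "Re (g x0) = norm x0" by (simp add: g_def f(2) scaleC_complex_def)
  then have "g x0 \<noteq> 0" using assms by auto
  then show ?thesis
    using bounded_clinear_compose_scaleC[OF g, of "inverse (g x0)"]
    by (intro exI[of _ "\<lambda>x. inverse (g x0) *\<^sub>C g x"]) (simp add: scaleC_complex_def)
qed

text \<open>Write \<open>b = v + k\<close> with \<open>k\<close> in the complement \<open>K\<close>
  of \<open>V\<close>. Modulo \<open>V\<close>, the vector \<open>b\<close> may be replaced by
  \<open>k\<close>, and the part of \<open>K\<close> on which a functional with
  \<open>g k = 1\<close> vanishes is a complement of the enlarged space.\<close>

lemma has_direct_complement_plus_span:
  fixes V :: "'a::complex_normed_vector set"
  assumes "finite B" "complex_vector.subspace V" "has_direct_complement V"
  shows "has_direct_complement (V + complex_vector.span B)"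
  using assms
proof (induction B arbitrary: V rule: finite_induct)
  case (insert b B)
  have "has_direct_complement (V + complex_vector.span {b})"
  proof -
    from insert.prems(2) obtain K where K: "complex_vector.subspace K" "closed K"
      "V \<inter> K = {0}" "V + K = UNIV" unfolding has_direct_complement_def by blast
    have V: "complex_vector.subspace V" by fact
    obtain v k where vk: "v \<in> V" "k \<in> K" "b = v + k"
      using K(4) by (metis UNIV_I set_plus_elim)
    show ?thesis
    proof (cases "k = 0")
      case True
      then show ?thesis using insert.prems vk by (simp add: plus_span_absorb)
    next
      case False
      then obtain g :: "'a \<Rightarrow> complex" where g: "bounded_clinear g" "g k = 1"
        using separating_functional by blast
      note g' = bounded_clinear_clinear[OF g(1)]
      define K' where "K' = K \<inter> null_space g"
      have "complex_vector.subspace K'"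
        unfolding K'_def by (intro complex_vector.subspace_inter K subspace_null_space g')
      moreover have "closed K'"
        using closed_preimage[OF g(1), of "{0}"] K(2) by (auto simp: K'_def null_space_def)
      moreover have "(V + complex_vector.span {b}) \<inter> K' = {0}"
      proof -
        have "x = 0" if x: "x \<in> V + complex_vector.span {b}" "x \<in> K'" for x
        proof -
          obtain v' c where v': "v' \<in> V" "x = v' + c *\<^sub>C b"
            using x(1) unfolding mem_plus_span_singleton by blast
          have "x = (v' + c *\<^sub>C v) + c *\<^sub>C k"
            using v' vk by (simp add: scaleC_add_right)
          moreover have "c *\<^sub>C k \<in> K" using K(1) vk by (simp add: complex_vector.subspace_scale)
          moreover have "v' + c *\<^sub>C v \<in> V"
            using V v' vk by (simp add: complex_vector.subspace_scale complex_vector.subspace_add)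
          ultimately have "v' + c *\<^sub>C v \<in> V \<inter> K"
            using x(2) complex_vector.subspace_diff[OF K(1), of x "c *\<^sub>C k"] by (simp add: K'_def)
          then have "x = c *\<^sub>C k"
            using K(3) \<open>x = (v' + c *\<^sub>C v) + c *\<^sub>C k\<close> by simp
          moreover from this have "c = 0"
            using x(2) g(2) by (simp add: K'_def null_space_def clinear_scaleC[OF g'] scaleC_complex_def)
          ultimately show ?thesis by simp
        qed
        moreover have "0 \<in> V + complex_vector.span {b}" "0 \<in> K'"
          using subset_plus_span complex_vector.subspace_0[OF V]
            complex_vector.subspace_0[OF \<open>complex_vector.subspace K'\<close>] by auto
        ultimately show ?thesis by blast
      qed
      moreover have "V + complex_vector.span {b} + K' = UNIV"
      proof -
        have "x \<in> V + complex_vector.span {b} + K'" for x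
        proof -
          obtain v' k' where x: "v' \<in> V" "k' \<in> K" "x = v' + k'"
            using K(4) by (metis UNIV_I set_plus_elim)
          have "k' - g k' *\<^sub>C k \<in> K'"
            using x vk K(1) g(2)
            by (simp add: K'_def null_space_def clinear_diff[OF g'] clinear_scaleC[OF g']
                scaleC_complex_def complex_vector.subspace_diff complex_vector.subspace_scale)
          moreover have "(v' - g k' *\<^sub>C v) + g k' *\<^sub>C b \<in> V + complex_vector.span {b}"
            using complex_vector.subspace_diff[OF V x(1) complex_vector.subspace_scale[OF V vk(1)]]
            unfolding mem_plus_span_singleton by blast
          ultimately have "((v' - g k' *\<^sub>C v) + g k' *\<^sub>C b) + (k' - g k' *\<^sub>C k)
              \<in> V + complex_vector.span {b} + K'"
            by (rule set_plus_intro[rotated])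
          moreover have "((v' - g k' *\<^sub>C v) + g k' *\<^sub>C b) + (k' - g k' *\<^sub>C k) = x"
            using x vk by (simp add: scaleC_add_right)
          ultimately show ?thesis by simp
        qed
        then show ?thesis by blast
      qed
      ultimately show ?thesis unfolding has_direct_complement_def by blast
    qed
  qed
  then show ?case
    unfolding plus_span_insert[of V b B] using insert.prems
    by (intro insert.IH subspace_plus) auto
qed simp

lemma has_direct_complement_span:
  fixes B :: "'a::complex_normed_vector set"
  assumes "finite B"
  shows "has_direct_complement (complex_vector.span B)"
proof -
  have "has_direct_complement {0 :: 'a}"
    unfolding has_direct_complement_def by (intro exI[of _ UNIV]) (auto simp: set_plus_def)
  then show ?thesis using has_direct_complement_plus_span[of B "{0}"] assms by simp
qed

text \<open>One after another, the elements of \<open>B\<close> are discarded if they already lie in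
  the space generated so far and kept otherwise; those that are kept span a complement.\<close>

lemma finite_codim_direct_complement:
  fixes V :: "'a::complex_vector set"
  assumes "finite B" "complex_vector.subspace V" "V + complex_vector.span B = UNIV"
  shows "\<exists>C. finite C \<and> V \<inter> complex_vector.span C = {0} \<and> V + complex_vector.span C = UNIV"
  using assms
proof (induction B arbitrary: V rule: finite_induct)
  case empty
  then show ?case by (intro exI[of _ "{}"]) (auto dest: complex_vector.subspace_0)
next
  case (insert b B)
  show ?case
  proof (cases "b \<in> V")
    case True
    then show ?thesis
      using insert by (simp add: plus_span_insert[of V b B] plus_span_absorb)
  next
    case False
    let ?W = "V + complex_vector.span {b}"
    have "complex_vector.subspace ?W" by (intro subspace_plus insert.prems) auto
    then obtain C where C: "finite C" "?W \<inter> complex_vector.span C = {0}"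
      "?W + complex_vector.span C = UNIV"
      using insert.IH[of ?W] insert.prems(2) by (auto simp: plus_span_insert[of V b B])
    have "v = 0" if v: "v \<in> V" "v \<in> complex_vector.span (insert b C)" for v
    proof -
      obtain c where c: "v - c *\<^sub>C b \<in> complex_vector.span C"
        using v(2) by (auto simp: complex_vector.span_insert)
      have "v - c *\<^sub>C b \<in> ?W"
        unfolding mem_plus_span_singleton using v(1)
        by (intro bexI[of _ v] exI[of _ "- c"]) (simp_all add: complex_vector.scale_minus_left)
      with c have "v - c *\<^sub>C b \<in> {0}" unfolding C(2)[symmetric] by (rule IntI[rotated])
      then have v_eq: "v = c *\<^sub>C b" by simp
      have "c = 0"
      proof (rule ccontr)
        assume "c \<noteq> 0"
        then have "b = inverse c *\<^sub>C v" by (simp add: v_eq scaleC_scaleC scaleC_one)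
        then show False using False complex_vector.subspace_scale[OF insert.prems(1) v(1)] by simp
      qed
      then show ?thesis by (simp add: v_eq)
    qed
    then have "V \<inter> complex_vector.span (insert b C) = {0}"
      using complex_vector.subspace_0[OF insert.prems(1)] complex_vector.span_zero by blast
    then show ?thesis
      using C(1,3) by (intro exI[of _ "insert b C"]) (simp add: plus_span_insert[of V b C])
  qed
qed

section \<open>Inverses modulo finite rank and complements of kernels and ranges\<close>

lemma finite_dim_subset:
  assumes "complex_vector.subspace V" "V \<subseteq> complex_vector.span B" "finite B"
  shows "finite_dim V"
proof -
  obtain C where C: "C \<subseteq> V" "complex_vector.independent C" "V \<subseteq> complex_vector.span C"
    by (rule complex_vector.maximal_independent_subset)
  then have "finite C"
    using complex_vector.independent_span_bound[OF assms(3) C(2)] assms(2) by blast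
  moreover have "complex_vector.span C = V"
    using C(1,3) assms(1) complex_vector.span_minimal by blast
  ultimately show ?thesis unfolding finite_dim_def by blast
qed

text \<open>Preimages of a finite spanning set of the range span the whole space modulo the
  kernel.\<close>

lemma null_space_finite_codim:
  assumes F: "clinear F" and B: "finite B" "\<And>x. F x \<in> complex_vector.span B"
  shows "\<exists>C. finite C \<and> null_space F \<inter> complex_vector.span C = {0} \<and>
    null_space F + complex_vector.span C = UNIV"
proof -
  interpret F: Vector_Spaces.linear scaleC scaleC F by fact
  have "finite_dim (range F)"
    using B by (intro finite_dim_subset[OF subspace_range[OF F], of B]) auto
  then obtain D where D: "finite D" "complex_vector.span D = range F"
    unfolding finite_dim_def by blast
  then have "D \<subseteq> range F" using complex_vector.span_superset by blast
  then obtain E where E: "finite E" "D = F ` E"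
    using D(1) finite_subset_image by metis
  have "x \<in> null_space F + complex_vector.span E" for x
  proof -
    have "F x \<in> F ` complex_vector.span E"
      using D(2) by (simp add: E(2) F.span_image)
    then obtain y where y: "y \<in> complex_vector.span E" "F x = F y" by blast
    have "x - y \<in> null_space F" using y(2) by (simp add: null_space_def F.diff)
    from set_plus_intro[OF this y(1)] show ?thesis by simp
  qed
  then have "null_space F + complex_vector.span E = UNIV" by blast
  from finite_codim_direct_complement[OF E(1) subspace_null_space[OF F] this] show ?thesis .
qed

text \<open>The map sending \<open>(m, p)\<close> to \<open>U m + p\<close> is a bijection from
  \<open>M \<times> P\<close> onto the target, and \<open>A\<close> is the first component of its
  inverse. Since \<open>M\<close> and \<open>P\<close> are closed, the open mapping theorem bounds
  it. The first conclusion serves the row operator, the second the column operator.\<close>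

lemma generalised_inverse:
  fixes U :: "'a::complex_banach \<Rightarrow> 'b::complex_banach"
  assumes U: "bounded_clinear U"
    and M: "has_direct_complement (null_space U)"
    and P: "complex_vector.subspace P" "closed P" "range U \<inter> P = {0}" "range U + P = UNIV"
  shows "\<exists>A. bounded_clinear A \<and> (\<forall>y. y - U (A y) \<in> P) \<and> (\<forall>x. U (x - A (U x)) = 0)"
proof -
  from M obtain M where M: "complex_vector.subspace M" "closed M"
    "null_space U \<inter> M = {0}" "null_space U + M = UNIV"
    unfolding has_direct_complement_def by blast
  note U' = bounded_clinear_clinear[OF U]
  define f where "f q = U (fst q) + snd q" for q
  have "bounded_linear f"
    unfolding f_def using U unfolding bounded_clinear_iff
    by (intro bounded_linear_add bounded_linear_compose[of U fst] bounded_linear_fst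
        bounded_linear_snd) auto
  moreover have "subspace (M \<times> P)" "closed (M \<times> P)"
    by (intro subspace_Times closed_Times subspace_imp_real_subspace M P)+
  moreover have "f ` (M \<times> P) = UNIV"
  proof -
    have "y \<in> f ` (M \<times> P)" for y
    proof -
      obtain u p where y: "u \<in> range U" "p \<in> P" "y = u + p"
        using P(4) UNIV_I[of y] by (metis set_plus_elim)
      then obtain x where x: "u = U x" by blast
      obtain n m where nm: "n \<in> null_space U" "m \<in> M" "x = n + m"
        using M(4) UNIV_I[of x] by (metis set_plus_elim)
      have "y = f (m, p)"
        using nm by (simp add: f_def y x null_space_def clinear_add[OF U'])
      then show ?thesis using nm(2) y(2) by blast
    qed
    then show ?thesis by blast
  qed
  ultimately obtain C where "\<forall>y. \<exists>q\<in>M \<times> P. f q = y \<and> norm q \<le> C * norm y"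
    using open_mapping_subspace by blast
  then obtain h where h: "\<And>y. h y \<in> M \<times> P" "\<And>y. f (h y) = y" "\<And>y. norm (h y) \<le> C * norm y"
    by metis
  define A where "A y = fst (h y)" for y
  \<comment> \<open>Uniqueness of the decomposition: linearity of \<open>A\<close> and the value of
    \<open>A (U x)\<close> are read off from it.\<close>
  have A_eq: "A y = m" if m: "m \<in> M" "y - U m \<in> P" for y m
  proof -
    have hM: "fst (h y) \<in> M" and hP: "snd (h y) \<in> P" using h(1)[of y] by (auto simp: mem_Times_iff)
    have "U (A y) + snd (h y) = y" using h(2)[of y] by (simp add: f_def A_def)
    then have "U (A y - m) = (y - U m) - snd (h y)"
      by (simp add: clinear_diff[OF U'] algebra_simps)
    moreover have "(y - U m) - snd (h y) \<in> P"
      by (intro complex_vector.subspace_diff P(1) m(2) hP)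
    ultimately have "U (A y - m) = 0" using P(3) by (metis IntI rangeI singletonD)
    then have "A y - m \<in> null_space U \<inter> M"
      using complex_vector.subspace_diff[OF M(1) hM m(1)] by (simp add: null_space_def A_def)
    then show ?thesis using M(3) by simp
  qed
  have AM: "A y \<in> M" for y using h(1)[of y] by (auto simp: A_def mem_Times_iff)
  have AP: "y - U (A y) \<in> P" for y
  proof -
    have "y - U (A y) = snd (h y)" using h(2)[of y] by (simp add: f_def A_def algebra_simps)
    then show ?thesis using h(1)[of y] by (auto simp: mem_Times_iff)
  qed
  have "clinear A"
    unfolding clinear_iff
  proof (intro conjI allI A_eq)
    fix x y c
    show "A x + A y \<in> M" by (intro complex_vector.subspace_add M(1) AM)
    show "c *\<^sub>C A x \<in> M" by (intro complex_vector.subspace_scale M(1) AM)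
    show "x + y - U (A x + A y) \<in> P"
      using complex_vector.subspace_add[OF P(1) AP[of x] AP[of y]]
      by (simp add: clinear_add[OF U'] algebra_simps)
    show "c *\<^sub>C x - U (c *\<^sub>C A x) \<in> P"
      using complex_vector.subspace_scale[OF P(1) AP[of x], of c]
      by (simp add: clinear_scaleC[OF U'] complex_vector.scale_right_diff_distrib)
  qed
  moreover have "norm (A y) \<le> norm y * C" for y
    using norm_fst_le[of "fst (h y)" "snd (h y)"] h(3)[of y] by (simp add: A_def mult.commute)
  ultimately have "bounded_clinear A" unfolding bounded_clinear_def by blast
  moreover have "U (x - A (U x)) = 0" for x
  proof -
    obtain n m where nm: "n \<in> null_space U" "m \<in> M" "x = n + m"
      using M(4) UNIV_I[of x] by (metis set_plus_elim)
    have "U n = 0" using nm(1) by (simp add: null_space_def)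
    then have "A (U x) = m"
      using complex_vector.subspace_0[OF P(1)]
      by (intro A_eq nm(2)) (simp add: nm(3) clinear_add[OF U'])
    then show ?thesis using \<open>U n = 0\<close> by (simp add: nm(3))
  qed
  ultimately show ?thesis using AP by blast
qed

text \<open>As UA is the identity modulo finite rank, G = U - UAU has finite rank. On its kernel, AU
  is a projection along the kernel of \<open>U\<close> onto the fixed points of AU, a closed space.
  Adding a finite-dimensional complement of the kernel of \<open>G\<close> to these fixed points
  gives the complement.\<close>

lemma null_space_has_direct_complement:
  fixes U :: "'a::complex_normed_vector \<Rightarrow> 'b::complex_normed_vector"
  assumes U: "bounded_clinear U" and A: "bounded_clinear A"
    and B: "finite B" "\<And>y. y - U (A y) \<in> complex_vector.span B"
  shows "has_direct_complement (null_space U)"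
proof -
  note U' = bounded_clinear_clinear[OF U] and A' = bounded_clinear_clinear[OF A]
  define G where "G x = U x - U (A (U x))" for x
  have G: "clinear G"
    unfolding G_def
    by (rule clinear_compose_diff[OF U' clinear_compose[OF U' clinear_compose[OF A' U']]])
  obtain C where C: "finite C" "null_space G \<inter> complex_vector.span C = {0}"
    "null_space G + complex_vector.span C = UNIV"
    using null_space_finite_codim[OF G B(1)] B(2) unfolding G_def by blast
  define V where "V = {x. A (U x) = x}"
  have V: "complex_vector.subspace V" "closed V"
    unfolding V_def using bounded_clinear_compose[OF A U]
    by (auto intro!: subspace_fixed_points closed_fixed_points bounded_clinear_clinear)
  define M where "M = V + complex_vector.span C"
  have M: "complex_vector.subspace M" "closed M"
    unfolding M_def by (intro subspace_plus closed_plus_span C V complex_vector.subspace_span)+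
  have V_null: "v \<in> null_space G" if "v \<in> V" for v
    using that by (simp add: V_def G_def null_space_def)
  have "x = 0" if x: "U x = 0" "x \<in> M" for x
  proof -
    obtain v w where vw: "v \<in> V" "w \<in> complex_vector.span C" "x = v + w"
      using x(2) unfolding M_def by (rule set_plus_elim)
    have "x \<in> null_space G" using x(1) by (simp add: null_space_def G_def clinear_0[OF A'] clinear_0[OF U'])
    then have "x - v \<in> null_space G"
      by (rule complex_vector.subspace_diff[OF subspace_null_space[OF G] _ V_null[OF vw(1)]])
    then have "w \<in> {0}" unfolding C(2)[symmetric] using vw by simp
    then have "x = v" using vw(3) by simp
    then show ?thesis using vw(1) x(1) by (simp add: V_def clinear_0[OF A'])
  qed
  then have "null_space U \<inter> M = {0}"
    using complex_vector.subspace_0[OF M(1)] by (auto simp: null_space_def clinear_0[OF U'])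
  moreover have "x \<in> null_space U + M" for x
  proof -
    have "x \<in> null_space G + complex_vector.span C" using C(3) by simp
    then obtain y w where yw: "y \<in> null_space G" "w \<in> complex_vector.span C" "x = y + w"
      by (rule set_plus_elim)
    have Gy: "U (A (U y)) = U y" using yw(1) by (simp add: null_space_def G_def)
    then have "y - A (U y) \<in> null_space U" by (simp add: null_space_def clinear_diff[OF U'])
    moreover have "A (U y) + w \<in> M"
      unfolding M_def using yw(2) Gy by (intro set_plus_intro) (simp_all add: V_def)
    ultimately have "(y - A (U y)) + (A (U y) + w) \<in> null_space U + M" by (rule set_plus_intro)
    then show ?thesis using yw(3) by simp
  qed
  ultimately show ?thesis
    unfolding has_direct_complement_def using M by blast
qed

text \<open>As AU is the identity modulo finite rank, \<open>U\<close> maps the kernel of F = I - AU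
  onto the fixed points of UA, a closed space. The preimage under \<open>A\<close> of a
  finite-dimensional complement of the kernel of \<open>F\<close> is a complement of these fixed
  points, and the range of \<open>U\<close> exceeds them by finitely many dimensions only.\<close>

lemma range_has_direct_complement:
  fixes U :: "'a::complex_normed_vector \<Rightarrow> 'b::complex_normed_vector"
  assumes U: "bounded_clinear U" and A: "bounded_clinear A"
    and B: "finite B" "\<And>x. x - A (U x) \<in> complex_vector.span B"
  shows "closed (range U) \<and> has_direct_complement (range U)"
proof -
  note U' = bounded_clinear_clinear[OF U] and A' = bounded_clinear_clinear[OF A]
  define F where "F x = x - A (U x)" for x
  have F: "clinear F"
    unfolding F_def by (rule clinear_compose_diff[OF clinear_id clinear_compose[OF A' U']])
  obtain C where C: "finite C" "null_space F \<inter> complex_vector.span C = {0}"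
    "null_space F + complex_vector.span C = UNIV"
    using null_space_finite_codim[OF F B(1)] B(2) unfolding F_def by blast
  define V where "V = {y. U (A y) = y}"
  have V: "complex_vector.subspace V" "closed V"
    unfolding V_def using bounded_clinear_compose[OF U A]
    by (auto intro!: subspace_fixed_points closed_fixed_points bounded_clinear_clinear)
  define K where "K = {y. A y \<in> complex_vector.span C}"
  have K: "complex_vector.subspace K" "closed K"
    unfolding K_def
    by (intro subspace_preimage A' complex_vector.subspace_span closed_preimage A closed_span C(1))+
  have decomp: "\<exists>x w. x \<in> null_space F \<and> w \<in> complex_vector.span C \<and> y = x + w" for y
  proof -
    have "y \<in> null_space F + complex_vector.span C" using C(3) by simp
    then show ?thesis by (rule set_plus_elim) blast
  qed
  have UV: "U x \<in> V" if "x \<in> null_space F" for x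
    using that by (simp add: V_def F_def null_space_def)
  have "has_direct_complement V"
    unfolding has_direct_complement_def
  proof (intro exI[of _ K] conjI K)
    have "y = 0" if y: "y \<in> V" "y \<in> K" for y
    proof -
      have "A y \<in> null_space F \<inter> complex_vector.span C"
        using y by (simp add: V_def K_def F_def null_space_def)
      then have "A y = 0" using C(2) by simp
      then show ?thesis using y(1) by (simp add: V_def clinear_0[OF U'])
    qed
    then show "V \<inter> K = {0}"
      using complex_vector.subspace_0[OF V(1)] complex_vector.subspace_0[OF K(1)] by blast
    have "y \<in> V + K" for y
    proof -
      obtain x w where xw: "x \<in> null_space F" "w \<in> complex_vector.span C" "A y = x + w"
        using decomp[of "A y"] by blast
      have "A (U x) = x" using xw(1) by (simp add: null_space_def F_def)
      then have "y - U x \<in> K"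
        using xw(2,3) by (simp add: K_def clinear_diff[OF A'])
      from set_plus_intro[OF UV[OF xw(1)] this] show ?thesis by simp
    qed
    then show "V + K = UNIV" by blast
  qed
  moreover have "range U = V + complex_vector.span (U ` C)"
  proof -
    interpret U: Vector_Spaces.linear scaleC scaleC U by (rule U')
    have "U z \<in> V + U ` complex_vector.span C" for z
    proof -
      obtain x w where xw: "x \<in> null_space F" "w \<in> complex_vector.span C" "z = x + w"
        using decomp[of z] by blast
      show ?thesis
        unfolding xw(3) U.add by (intro set_plus_intro UV xw imageI)
    qed
    moreover have "V + U ` complex_vector.span C \<subseteq> range U"
    proof
      fix y assume "y \<in> V + U ` complex_vector.span C"
      then obtain v w where "v \<in> V" "y = v + U w" by (auto elim!: set_plus_elim)
      then have "y = U (A v + w)" by (simp add: U.add V_def)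
      then show "y \<in> range U" by blast
    qed
    ultimately show ?thesis unfolding U.span_image by blast
  qed
  ultimately show ?thesis
    using V C(1) by (simp add: closed_plus_span has_direct_complement_plus_span)
qed

section \<open>Essentially invertible tuples\<close>

definition ess_right_invertible :: "('n::finite \<Rightarrow> 'a \<Rightarrow> 'a::complex_normed_vector) \<Rightarrow> bool"
  where "ess_right_invertible T \<longleftrightarrow> (\<exists>A B. (\<forall>i. bounded_clinear (A i)) \<and> finite B \<and>
    (\<forall>x. x - (\<Sum>i\<in>UNIV. T i (A i x)) \<in> complex_vector.span B))"

definition ess_left_invertible :: "('n::finite \<Rightarrow> 'a \<Rightarrow> 'a::complex_normed_vector) \<Rightarrow> bool"
  where "ess_left_invertible T \<longleftrightarrow> (\<exists>A B. (\<forall>i. bounded_clinear (A i)) \<and> finite B \<and>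
    (\<forall>x. x - (\<Sum>i\<in>UNIV. A i (T i x)) \<in> complex_vector.span B))"

section \<open>Split semi-Browder tuples in terms of essential one-sided inverses\<close>

lemma bounded_clinear_vec_nth: "bounded_clinear (\<lambda>x. x $ i)"
  unfolding bounded_clinear_iff clinear_iff by (simp add: scaleC_vec_def bounded_linear_vec_nth)

lemma bounded_clinear_row_op:
  assumes "\<And>i. bounded_clinear (T i)"
  shows "bounded_clinear (row_op T)"
  unfolding row_op_def using assms
  by (intro bounded_clinear_sum bounded_clinear_compose[OF _ bounded_clinear_vec_nth])

lemma bounded_clinear_column_op:
  fixes T :: "'n::finite \<Rightarrow> 'a \<Rightarrow> 'a::complex_normed_vector"
  assumes T: "\<And>i. bounded_clinear (T i)"
  shows "bounded_clinear (column_op T)"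
proof -
  have "clinear (column_op T)"
    using bounded_clinear_clinear[OF T]
    by (simp add: clinear_iff column_op_def vec_eq_iff scaleC_vec_def)
  moreover have "\<exists>K. \<forall>i x. norm (T i x) \<le> norm x * K i"
    using T unfolding bounded_clinear_def by metis
  then obtain K where K: "\<And>i x. norm (T i x) \<le> norm x * K i" by blast
  have "norm (column_op T x) \<le> norm x * (\<Sum>i\<in>UNIV. K i)" for x
  proof -
    have "norm (column_op T x) \<le> (\<Sum>i\<in>UNIV. norm (T i x))"
      by (simp add: column_op_def norm_vec_def L2_set_le_sum)
    also have "\<dots> \<le> norm x * (\<Sum>i\<in>UNIV. K i)"
      by (simp add: sum_distrib_left sum_mono K)
    finally show ?thesis .
  qed
  ultimately show ?thesis unfolding bounded_clinear_def by blast
qed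

lemma bounded_clinear_axis: "bounded_clinear (axis i :: 'a::complex_normed_vector \<Rightarrow> 'a ^ 'n)"
proof -
  have "axis i = column_op (\<lambda>j (x :: 'a). if j = i then x else 0)"
    by (auto simp: column_op_def axis_def vec_eq_iff)
  moreover have "bounded_clinear (\<lambda>x :: 'a. if j = i then x else 0)" for j
    by (cases "j = i") (simp_all add: bounded_clinear_ident bounded_clinear_zero)
  ultimately show ?thesis using bounded_clinear_column_op by metis
qed

lemma finite_codim_mono: "finite_codim V \<Longrightarrow> V \<subseteq> W \<Longrightarrow> finite_codim W"
  unfolding finite_codim_def using set_plus_mono2[OF _ order_refl] by blast

lemma range_infty_subset: "k \<ge> 1 \<Longrightarrow> range_infty T \<subseteq> (\<Sum>i\<in>UNIV. range (T i ^^ k))"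
  unfolding range_infty_def by blast

lemma range_row_op:
  fixes T :: "'n::finite \<Rightarrow> 'a::complex_vector \<Rightarrow> 'a"
  shows "range (row_op T) = (\<Sum>i\<in>UNIV. range (T i))"
proof
  show "range (row_op T) \<subseteq> (\<Sum>i\<in>UNIV. range (T i))"
    by (auto simp: row_op_def intro: set_sum_memI)
  show "(\<Sum>i\<in>UNIV. range (T i)) \<subseteq> range (row_op T)"
  proof
    fix x assume "x \<in> (\<Sum>i\<in>UNIV. range (T i))"
    from set_sum_memD[OF finite this] obtain f where f: "x = (\<Sum>i\<in>UNIV. f i)"
      "\<forall>i. f i \<in> range (T i)" by blast
    then have "\<forall>i. \<exists>y. f i = T i y" by blast
    then obtain g where "\<And>i. f i = T i (g i)" by metis
    then have "x = row_op T (\<chi> i. g i)" by (simp add: f(1) row_op_def)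
    then show "x \<in> range (row_op T)" by blast
  qed
qed

text \<open>Finite codimension passes from \<open>range_infty T\<close> to the range of
  \<open>row_op T\<close>, which therefore has a finite-dimensional, hence closed, complement. A
  generalised inverse of \<open>row_op T\<close> then has its remainder in a finite span, and its
  coordinates are the coefficients.\<close>

lemma lower_split_semi_Browder_iff:
  fixes T :: "'n::finite \<Rightarrow> 'a::complex_banach \<Rightarrow> 'a"
  assumes T: "\<And>i. bounded_clinear (T i)"
  shows "lower_split_semi_Browder T \<longleftrightarrow> finite_codim (range_infty T) \<and> ess_right_invertible T"
proof (intro iffI conjI)
  note R = bounded_clinear_row_op[of T, OF T]
  assume lower: "lower_split_semi_Browder T"
  then show fin: "finite_codim (range_infty T)" by (simp add: lower_split_semi_Browder_def)
  have "range_infty T \<subseteq> range (row_op T)"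
    unfolding range_row_op using range_infty_subset[of 1 T] by simp
  with fin have "finite_codim (range (row_op T))" by (rule finite_codim_mono)
  then obtain B0 where B0: "finite B0" "range (row_op T) + complex_vector.span B0 = UNIV"
    unfolding finite_codim_def by blast
  obtain B where B: "finite B" "range (row_op T) \<inter> complex_vector.span B = {0}"
    "range (row_op T) + complex_vector.span B = UNIV"
    using finite_codim_direct_complement[OF B0(1) subspace_range B0(2)]
      bounded_clinear_clinear[OF R] by blast
  have "has_direct_complement (null_space (row_op T))"
    using lower by (simp add: lower_split_semi_Browder_def)
  from generalised_inverse[OF R this complex_vector.subspace_span closed_span[OF B(1)] B(2,3)]
  obtain A where A: "bounded_clinear A" "\<And>y. y - row_op T (A y) \<in> complex_vector.span B"
    by blast
  show "ess_right_invertible T"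
    unfolding ess_right_invertible_def
  proof (intro exI conjI allI)
    show "bounded_clinear (\<lambda>x. A x $ i)" for i
      by (rule bounded_clinear_compose[OF bounded_clinear_vec_nth A(1)])
    show "x - (\<Sum>i\<in>UNIV. T i (A x $ i)) \<in> complex_vector.span B" for x
      using A(2)[of x] by (simp add: row_op_def)
  qed (rule B(1))
next
  assume "finite_codim (range_infty T) \<and> ess_right_invertible T"
  then obtain A B where A: "finite_codim (range_infty T)" "\<And>i. bounded_clinear (A i)" "finite B"
    "\<And>x. x - (\<Sum>i\<in>UNIV. T i (A i x)) \<in> complex_vector.span B"
    unfolding ess_right_invertible_def by blast
  have "has_direct_complement (null_space (row_op T))"
    using A(3,4)
    by (intro null_space_has_direct_complement[OF bounded_clinear_row_op[of T, OF T]
          bounded_clinear_column_op[of A, OF A(2)]])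
      (simp_all add: row_op_def column_op_def)
  with A(1) show "lower_split_semi_Browder T" by (simp add: lower_split_semi_Browder_def)
qed

lemma vec_eq_sum_axis: "(\<Sum>i\<in>UNIV. axis i (v $ i)) = (v :: 'a::comm_monoid_add ^ 'n)"
  by (simp add: vec_eq_iff axis_def)

text \<open>The kernel of \<open>column_op T\<close> is finite-dimensional, hence complemented by
  the Hahn-Banach theorem. For the generalised inverse, \<open>x - A (column_op T x)\<close> lies in
  that kernel, and the restrictions of \<open>A\<close> to the coordinate axes are the
  coefficients.\<close>

lemma upper_split_semi_Browder_iff:
  fixes T :: "'n::finite \<Rightarrow> 'a::complex_banach \<Rightarrow> 'a"
  assumes T: "\<And>i. bounded_clinear (T i)"
  shows "upper_split_semi_Browder T \<longleftrightarrow> finite_dim (null_infty T) \<and> ess_left_invertible T"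
proof (intro iffI conjI)
  note R = bounded_clinear_column_op[of T, OF T]
  assume upper: "upper_split_semi_Browder T"
  then show "finite_dim (null_infty T)" by (simp add: upper_split_semi_Browder_def)
  from upper obtain B where B: "finite B" "complex_vector.span B = null_space (column_op T)"
    by (auto simp: upper_split_semi_Browder_def finite_dim_def)
  from upper obtain P where P: "complex_vector.subspace P" "closed P"
    "range (column_op T) \<inter> P = {0}" "range (column_op T) + P = UNIV"
    unfolding upper_split_semi_Browder_def has_direct_complement_def by blast
  have "has_direct_complement (null_space (column_op T))"
    using has_direct_complement_span[OF B(1)] by (simp add: B(2))
  from generalised_inverse[OF R this P]
  obtain A where A: "bounded_clinear A" "\<And>x. column_op T (x - A (column_op T x)) = 0"
    by blast
  show "ess_left_invertible T"
    unfolding ess_left_invertible_def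
  proof (intro exI conjI allI)
    show "bounded_clinear (\<lambda>x. A (axis i x))" for i
      by (rule bounded_clinear_compose[OF A(1) bounded_clinear_axis])
    have "(\<Sum>i\<in>UNIV. A (axis i (T i x))) = A (column_op T x)" for x
      using vec_eq_sum_axis[of "column_op T x"]
        clinear_sum[OF bounded_clinear_clinear[OF A(1)], of "\<lambda>i. axis i (T i x)" UNIV]
      by (simp add: column_op_def)
    then show "x - (\<Sum>i\<in>UNIV. A (axis i (T i x))) \<in> complex_vector.span B" for x
      using A(2)[of x] by (simp add: B(2) null_space_def)
  qed (rule B(1))
next
  assume "finite_dim (null_infty T) \<and> ess_left_invertible T"
  then obtain A B where A: "finite_dim (null_infty T)" "\<And>i. bounded_clinear (A i)" "finite B"
    "\<And>x. x - (\<Sum>i\<in>UNIV. A i (T i x)) \<in> complex_vector.span B"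
    unfolding ess_left_invertible_def by blast
  have R: "bounded_clinear (column_op T)" by (rule bounded_clinear_column_op[OF T])
  have "closed (range (column_op T)) \<and> has_direct_complement (range (column_op T))"
    using A(3,4)
    by (intro range_has_direct_complement[OF R bounded_clinear_row_op[of A, OF A(2)]])
      (simp_all add: row_op_def column_op_def)
  moreover have "finite_dim (null_space (column_op T))"
  proof (rule finite_dim_subset[OF subspace_null_space[OF bounded_clinear_clinear[OF R]] _ A(3)])
    show "null_space (column_op T) \<subseteq> complex_vector.span B"
    proof
      fix x assume "x \<in> null_space (column_op T)"
      then have "T i x = 0" for i by (simp add: null_space_def column_op_def vec_eq_iff)
      then show "x \<in> complex_vector.span B"
        using A(4)[of x] clinear_0[OF bounded_clinear_clinear[OF A(2)]] by simp
    qed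
  qed
  ultimately show "upper_split_semi_Browder T"
    using A(1) by (simp add: upper_split_semi_Browder_def)
qed

section \<open>Operators whose translates are all surjective\<close>

lemma sum_roots_of_unity_power:
  assumes "0 < j" "j < m"
  shows "(\<Sum>k<m. (cis (2 * pi / real m) ^ k) ^ j) = 0"
proof -
  define w where "w = cis (2 * pi / real m) ^ j"
  have w: "w = cis (2 * pi * real j / real m)"
    unfolding w_def by (simp add: Complex.DeMoivre mult.commute)
  have "w \<noteq> 1"
  proof
    assume "w = 1"
    then have "Re w = 1" by simp
    then have "cos (2 * pi * real j / real m) = 1" by (simp add: w)
    then obtain n :: int where "2 * pi * real j / real m = real_of_int n * 2 * pi"
      using cos_one_2pi_int by blast
    then have "real j = real_of_int n * real m" using assms by (simp add: field_simps)
    then have "int j = n * int m" by (metis of_int_eq_iff of_int_mult of_int_of_nat_eq)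
    then have "int m dvd int j" by simp
    then show False using assms by (simp add: nat_dvd_not_less)
  qed
  have "w ^ m = 1"
  proof -
    have "w ^ m = cis (2 * pi) ^ j"
      using assms unfolding w_def by (simp add: power_mult[symmetric] Complex.DeMoivre mult.commute)
    then show ?thesis by simp
  qed
  have "(\<Sum>k<m. (cis (2 * pi / real m) ^ k) ^ j) = (\<Sum>k<m. w ^ k)"
    unfolding w_def by (simp add: power_mult[symmetric] mult.commute)
  also have "\<dots> = 0" using \<open>w \<noteq> 1\<close> \<open>w ^ m = 1\<close> by (simp add: geometric_sum)
  finally show ?thesis .
qed

text \<open>This models the operator induced on a quotient: \<open>q\<close> may vanish on nonzero
  vectors and the space need not be complete. Homogeneity is assumed as an inequality only; the
  converse follows by scaling back.\<close>

locale seminormed_operator = vector_space sc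
  for sc :: "complex \<Rightarrow> 'v::ab_group_add \<Rightarrow> 'v" +
  fixes q :: "'v \<Rightarrow> real" and L :: "'v \<Rightarrow> 'v" and K :: real
  assumes q_add: "q (x + y) \<le> q x + q y"
    and q_scale_le: "q (sc c x) \<le> cmod c * q x"
    and L_add: "L (x + y) = L x + L y"
    and L_scale: "L (sc c x) = sc c (L x)"
    and q_L: "q (L x) \<le> K * q x"
    and K_pos: "K > 0"
begin

lemma q_0 [simp]: "q 0 = 0"
  using q_scale_le[of 0 0] q_add[of 0 0] by simp

lemma q_minus: "q (- x) \<le> q x"
  using q_scale_le[of "- 1" x] by (simp add: scale_minus_left)

lemma q_nonneg [simp]: "0 \<le> q x"
  using q_add[of x "- x"] q_minus[of x] by simp

lemma q_diff: "q (x - y) \<le> q x + q y"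
  using q_add[of x "- y"] q_minus[of y] by simp

lemma q_scale: "q (sc c x) = cmod c * q x"
proof (cases "c = 0")
  case False
  have "q x \<le> cmod (inverse c) * q (sc c x)"
    using q_scale_le[of "inverse c" "sc c x"] False by simp
  then have "cmod c * q x \<le> cmod c * (cmod (inverse c) * q (sc c x))"
    by (rule mult_left_mono) simp
  also have "\<dots> = q (sc c x)" using False by (simp add: norm_inverse)
  finally show ?thesis using q_scale_le[of c x] by simp
qed simp

lemma q_sum: "q (\<Sum>i\<in>I. f i) \<le> (\<Sum>i\<in>I. q (f i))"
proof (induction I rule: infinite_finite_induct)
  case (insert i I)
  then show ?case using q_add[of "f i" "sum f I"] by simp
qed simp_all

lemma L_0 [simp]: "L 0 = 0"
  using L_scale[of 0 0] by simp

lemma L_diff: "L (x - y) = L x - L y"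
  using L_add[of "x - y" y] by simp

lemma L_sum: "L (\<Sum>i\<in>I. f i) = (\<Sum>i\<in>I. L (f i))"
  by (induction I rule: infinite_finite_induct) (simp_all add: L_add)

lemma L_power_diff: "(L ^^ j) (x - y) = (L ^^ j) x - (L ^^ j) y"
  by (induction j) (simp_all add: L_diff)

lemma L_power_scale: "(L ^^ j) (sc c x) = sc c ((L ^^ j) x)"
  by (induction j) (simp_all add: L_scale)

lemma q_L_power: "q ((L ^^ j) x) \<le> K ^ j * q x"
proof (induction j)
  case (Suc j)
  have "q ((L ^^ Suc j) x) \<le> K * q ((L ^^ j) x)" using q_L by simp
  also have "\<dots> \<le> K * (K ^ j * q x)" using Suc K_pos by (intro mult_left_mono) auto
  finally show ?case by (simp add: mult.assoc)
qed simp

text \<open>The pencil 1 - zL replaces the translates L - l with l = 1/z, so that the set of good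
  parameters can grow as a disc around the origin, where the pencil is the identity.\<close>

definition M :: "complex \<Rightarrow> 'v \<Rightarrow> 'v"
  where "M z x = x - sc z (L x)"

definition geo :: "complex \<Rightarrow> nat \<Rightarrow> 'v \<Rightarrow> 'v"
  where "geo z m x = (\<Sum>j<m. sc (z ^ j) ((L ^^ j) x))"

text \<open>The accuracy \<open>e\<close> is arbitrary while the bound \<open>C\<close> on the
  solution does not depend on it. This form survives a perturbation of \<open>z\<close> without any
  limit having to exist.\<close>

definition solves :: "complex \<Rightarrow> real \<Rightarrow> bool"
  where "solves z C \<longleftrightarrow> (\<forall>y e. e > 0 \<longrightarrow> (\<exists>x. q (y - M z x) \<le> e * q y \<and> q x \<le> C * q y))"

text \<open>For \<open>r > 0\<close> this says that the spectral radius of \<open>L\<close> with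
  respect to \<open>q\<close> is less than 1/r. For \<open>r = 0\<close> it always holds, which
  starts the growth of the disc.\<close>

definition contracting :: "real \<Rightarrow> bool"
  where "contracting r \<longleftrightarrow> (\<exists>m\<ge>1. \<forall>x. r ^ m * q ((L ^^ m) x) \<le> q x / 2)"

lemma M_add: "M z (x + y) = M z x + M z y"
  by (simp add: M_def L_add scale_right_distrib)

lemma M_diff: "M z (x - y) = M z x - M z y"
  by (simp add: M_def L_diff scale_right_diff_distrib)

lemma M_change: "M z x = M z' x - sc (z - z') (L x)"
  by (simp add: M_def scale_left_diff_distrib)

lemma M_geo: "M z (geo z m x) = x - sc (z ^ m) ((L ^^ m) x)"
proof -
  have "M z (geo z m x) = (\<Sum>j<m. sc (z ^ j) ((L ^^ j) x) - sc (z ^ Suc j) ((L ^^ Suc j) x))"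
    by (simp add: M_def geo_def L_sum L_scale scale_sum_right sum_subtractf)
  also have "\<dots> = x - sc (z ^ m) ((L ^^ m) x)" by (subst sum_lessThan_telescope') simp
  finally show ?thesis .
qed

lemma geo_M: "geo z m (M z x) = x - sc (z ^ m) ((L ^^ m) x)"
proof -
  have "geo z m (M z x) = (\<Sum>j<m. sc (z ^ j) ((L ^^ j) x) - sc (z ^ Suc j) ((L ^^ Suc j) x))"
    unfolding geo_def M_def
    by (simp add: L_power_diff L_power_scale scale_right_diff_distrib funpow_swap1 mult.commute)
  also have "\<dots> = x - sc (z ^ m) ((L ^^ m) x)" by (subst sum_lessThan_telescope') simp
  finally show ?thesis .
qed

lemma q_geo: "q (geo z m x) \<le> (\<Sum>j<m. cmod z ^ j * K ^ j) * q x"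
proof -
  have "q (geo z m x) \<le> (\<Sum>j<m. cmod z ^ j * (K ^ j * q x))"
    unfolding geo_def
    by (intro order_trans[OF q_sum] sum_mono)
      (simp add: q_scale norm_power mult_left_mono q_L_power)
  then show ?thesis by (simp add: sum_distrib_right mult.assoc)
qed

text \<open>All exponents in the truncated Neumann series are below \<open>m\<close>, so the sum
  over the \<open>m\<close>-th roots of unity cancels every term except the one of exponent
  0.\<close>

lemma sum_geo_roots_of_unity:
  assumes "m > 0"
  shows "(\<Sum>k<m. geo (z * cis (2 * pi / real m) ^ k) m x) = sc (of_nat m) x"
proof -
  let ?w = "cis (2 * pi / real m)"
  have "(\<Sum>k<m. geo (z * ?w ^ k) m x)
      = (\<Sum>j<m. sc (z ^ j * (\<Sum>k<m. (?w ^ k) ^ j)) ((L ^^ j) x))"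
    unfolding geo_def
    by (subst sum.swap) (simp add: power_mult_distrib sum_distrib_left scale_sum_left)
  also have "\<dots> = (\<Sum>j<m. if j = 0 then sc (of_nat m) x else 0)"
    by (intro sum.cong refl) (auto simp: sum_roots_of_unity_power)
  also have "\<dots> = sc (of_nat m) x" using assms by (simp add: sum.delta)
  finally show ?thesis .
qed

text \<open>A solution at \<open>z0\<close> leaves at \<open>z\<close> a residual of at most half
  the size. Repeating the correction gives residuals (1/2)^n and corrections of total size below C(1
  + 1/2 + 1/4 + ...) = 2C.\<close>

lemma solves_near:
  assumes C: "C > 0" and exact: "\<And>y. \<exists>x. q (y - M z0 x) = 0 \<and> q x \<le> C * q y"
    and near: "cmod (z - z0) * (K * C) \<le> 1 / 2"
  shows "solves z (2 * C)"
proof -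
  have step: "\<exists>x. q (y - M z x) \<le> q y / 2 \<and> q x \<le> C * q y" for y
  proof -
    obtain x where x: "q (y - M z0 x) = 0" "q x \<le> C * q y" using exact by blast
    have "y - M z x = (y - M z0 x) + sc (z - z0) (L x)" by (simp add: M_change[of z x z0])
    also have "q ((y - M z0 x) + sc (z - z0) (L x)) \<le> cmod (z - z0) * q (L x)"
      using q_add[of "y - M z0 x" "sc (z - z0) (L x)"] x(1) by (simp add: q_scale)
    finally have "q (y - M z x) \<le> cmod (z - z0) * q (L x)" .
    also have "\<dots> \<le> cmod (z - z0) * (K * (C * q y))"
      using x(2) K_pos by (intro mult_left_mono order_trans[OF q_L] mult_left_mono) auto
    also have "\<dots> = (cmod (z - z0) * (K * C)) * q y" by (simp add: mult_ac)
    also have "\<dots> \<le> 1 / 2 * q y" by (intro mult_right_mono near) simp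
    finally show ?thesis using x(2) by auto
  qed
  have iterate: "\<exists>x. q (y - M z x) \<le> (1/2) ^ n * q y \<and> q x \<le> 2 * C * (1 - (1/2) ^ n) * q y" for n y
  proof (induction n)
    case 0
    show ?case by (intro exI[of _ 0]) (simp add: M_def)
  next
    case (Suc n)
    then obtain x where x: "q (y - M z x) \<le> (1/2) ^ n * q y"
      "q x \<le> 2 * C * (1 - (1/2) ^ n) * q y" by blast
    obtain x' where x': "q ((y - M z x) - M z x') \<le> q (y - M z x) / 2" "q x' \<le> C * q (y - M z x)"
      using step by blast
    show ?case
    proof (intro exI conjI)
      show "q (y - M z (x + x')) \<le> (1/2) ^ Suc n * q y"
        using x(1) x'(1) by (simp add: M_add algebra_simps)
      have "q (x + x') \<le> 2 * C * (1 - (1/2) ^ n) * q y + C * ((1/2) ^ n * q y)"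
        using q_add[of x x'] x(2) order_trans[OF x'(2) mult_left_mono[OF x(1)]] C by force
      also have "\<dots> = 2 * C * (1 - (1/2) ^ Suc n) * q y" by (simp add: algebra_simps)
      finally show "q (x + x') \<le> 2 * C * (1 - (1/2) ^ Suc n) * q y" .
    qed
  qed
  show ?thesis
    unfolding solves_def
  proof (intro allI impI)
    fix y and e :: real assume "e > 0"
    then obtain n where n: "(1/2 :: real) ^ n < e" using real_arch_pow_inv[of e "1/2"] by auto
    obtain x where x: "q (y - M z x) \<le> (1/2) ^ n * q y" "q x \<le> 2 * C * (1 - (1/2) ^ n) * q y"
      using iterate by blast
    have "q (y - M z x) \<le> e * q y"
      using n by (intro order_trans[OF x(1)] mult_right_mono) auto
    moreover have "q x \<le> 2 * C * q y"
      using C by (intro order_trans[OF x(2)] mult_right_mono) auto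
    ultimately show "\<exists>x. q (y - M z x) \<le> e * q y \<and> q x \<le> 2 * C * q y" by blast
  qed
qed

lemma solves_mono: "solves z C \<Longrightarrow> C \<le> C' \<Longrightarrow> solves z C'"
  unfolding solves_def by (meson mult_right_mono order_trans q_nonneg)

text \<open>Around each \<open>z\<close> the constant at most doubles on a disc of radius
  \<open>\<rho> z\<close>, and finitely many of these discs cover the compact disc.\<close>

lemma solves_uniform:
  assumes exact: "\<And>z. \<exists>C>0. \<forall>y. \<exists>x. q (y - M z x) = 0 \<and> q x \<le> C * q y"
  shows "\<exists>C\<ge>1. \<forall>z. cmod z \<le> R \<longrightarrow> solves z C"
proof -
  from exact obtain C where C: "\<And>z. C z > 0"
    "\<And>z y. \<exists>x. q (y - M z x) = 0 \<and> q x \<le> C z * q y" by metis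
  define \<rho> where "\<rho> z = 1 / (2 * K * C z)" for z
  have cover: "cball 0 R \<subseteq> (\<Union>z\<in>cball 0 R. ball z (\<rho> z))"
    using C(1) K_pos by (auto simp: \<rho>_def intro!: bexI)
  obtain D where D: "D \<subseteq> cball 0 R" "finite D" "cball 0 R \<subseteq> (\<Union>z\<in>D. ball z (\<rho> z))"
    by (rule compactE_image[OF compact_cball[of 0 R] _ cover]) auto
  define C' where "C' = Max (insert 1 ((\<lambda>z. 2 * C z) ` D))"
  have "solves z C'" if z: "cmod z \<le> R" for z
  proof -
    obtain z0 where z0: "z0 \<in> D" "z \<in> ball z0 (\<rho> z0)" using D(3) z by (auto simp: subset_iff)
    have "cmod (z - z0) \<le> \<rho> z0" using z0(2) by (simp add: dist_norm norm_minus_commute)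
    then have "cmod (z - z0) * (K * C z0) \<le> \<rho> z0 * (K * C z0)"
      using K_pos C(1)[of z0] by (intro mult_right_mono) auto
    also have "\<dots> = 1 / 2" using K_pos C(1)[of z0] by (simp add: \<rho>_def)
    finally have "solves z (2 * C z0)" using C by (intro solves_near) auto
    moreover have "2 * C z0 \<le> C'" unfolding C'_def using z0 D(2) by (intro Max_ge) auto
    ultimately show ?thesis by (rule solves_mono)
  qed
  moreover have "C' \<ge> 1" unfolding C'_def using D(2) by (intro Max_ge) auto
  ultimately show ?thesis by blast
qed

text \<open>Contraction bounds \<open>M z\<close> from below, but with a constant
  \<open>2 * D\<close> that depends on \<open>m\<close>. Comparing \<open>x\<close> with an
  approximate solution of accuracy \<open>C / (2 * D)\<close> cancels this crude factor and leaves
  \<open>2 * C\<close>. The independence of \<open>m\<close> is what makes the growth of the disc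
  uniform.\<close>

lemma contracting_bounded_below:
  assumes "contracting r" "cmod z \<le> r" "solves z C" "C > 0"
  shows "q x \<le> 2 * C * q (M z x)"
proof -
  from assms(1) obtain m where m: "\<And>x. r ^ m * q ((L ^^ m) x) \<le> q x / 2"
    unfolding contracting_def by blast
  define D where "D = (\<Sum>j<m. cmod z ^ j * K ^ j) + 1"
  have D: "D > 0" unfolding D_def using K_pos by (intro add_nonneg_pos sum_nonneg) auto
  have crude: "q e \<le> 2 * D * q (M z e)" for e
  proof -
    have "e = geo z m (M z e) + sc (z ^ m) ((L ^^ m) e)" by (simp add: geo_M)
    then have "q e \<le> q (geo z m (M z e)) + cmod z ^ m * q ((L ^^ m) e)"
      by (metis q_add q_scale norm_power)
    also have "q (geo z m (M z e)) \<le> D * q (M z e)"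
      unfolding D_def distrib_right using order_trans[OF q_geo[of z m "M z e"]] by simp
    also have "cmod z ^ m * q ((L ^^ m) e) \<le> r ^ m * q ((L ^^ m) e)"
      using assms(2) by (intro mult_right_mono power_mono) auto
    also note m[of e]
    finally show ?thesis by simp
  qed
  define y where "y = M z x"
  have "C / (2 * D) > 0" using assms(4) D by simp
  then obtain x' where x': "q (y - M z x') \<le> C / (2 * D) * q y" "q x' \<le> C * q y"
    using assms(3) unfolding solves_def by blast
  have "q (x - x') \<le> 2 * D * q (y - M z x')" using crude[of "x - x'"] by (simp add: M_diff y_def)
  also have "\<dots> \<le> 2 * D * (C / (2 * D) * q y)" using D x'(1) by (intro mult_left_mono) auto
  also have "\<dots> = C * q y" using D by simp
  finally have "q (x - x') \<le> C * q y" .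
  then show ?thesis using q_add[of "x - x'" x'] x'(2) by (simp add: y_def)
qed

lemma contracting_strong:
  assumes "contracting r" "r \<ge> 0" "e > 0"
  shows "\<exists>m\<ge>1. \<forall>x. r ^ m * q ((L ^^ m) x) \<le> e * q x"
proof -
  from assms(1) obtain m where m: "m \<ge> 1" "\<And>x. r ^ m * q ((L ^^ m) x) \<le> q x / 2"
    unfolding contracting_def by blast
  have iterate: "r ^ (m * n) * q ((L ^^ (m * n)) x) \<le> (1/2) ^ n * q x" for n x
  proof (induction n)
    case (Suc n)
    have "r ^ (m * Suc n) * q ((L ^^ (m * Suc n)) x)
        = r ^ (m * n) * (r ^ m * q ((L ^^ m) ((L ^^ (m * n)) x)))"
      by (simp add: power_add funpow_add mult_ac)
    also have "\<dots> \<le> r ^ (m * n) * (q ((L ^^ (m * n)) x) / 2)"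
      using assms(2) by (intro mult_left_mono m) auto
    also have "\<dots> \<le> (1/2) ^ Suc n * q x" using Suc by simp
    finally show ?case .
  qed simp
  obtain n where n: "(1/2 :: real) ^ n < e" using real_arch_pow_inv[of e "1/2"] assms(3) by auto
  have "(1/2 :: real) ^ Suc n \<le> e" using n assms(3) by simp
  then have "(1/2 :: real) ^ Suc n * q x \<le> e * q x" for x by (intro mult_right_mono) auto
  then show ?thesis
    using order_trans[OF iterate[of "Suc n"]] m(1) by (intro exI[of _ "m * Suc n"]) auto
qed

text \<open>
  The average of \<open>(1 - z w\<^sup>k L)\<^sup>-\<^sup>1\<close> over the powers of a primitive \<open>m\<close>-th root of unity \<open>w\<close> is
  \<open>(1 - z\<^sup>m L\<^sup>m)\<^sup>-\<^sup>1\<close>. Since the former depend on \<open>z\<close> in a Lipschitz way, uniformly in \<open>m\<close>, and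
  the latter is almost the identity for \<open>\<bar>z\<bar> = r\<close> and large \<open>m\<close>, it remains close to the identity
  for \<open>\<bar>z\<bar> = r + d\<close>, where \<open>d\<close> does not depend on \<open>r\<close>.
\<close>

lemma contracting_step:
  assumes r: "contracting r" "r \<ge> 0" and C: "C \<ge> 1" "\<And>z. cmod z \<le> r \<Longrightarrow> solves z C"
  shows "contracting (r + 1 / (96 * C\<^sup>2 * K))"
proof -
  \<comment> \<open>Two errors are to be at most 1/6 each: \<open>4 * C * e\<close> from truncating
    the series at radius \<open>r\<close>, and \<open>16 * (C\<^sup>2 * K * d)\<close> from moving
    to \<open>r'\<close>. The resulting third of \<open>q y\<close> becomes half of
    \<open>q x\<close> at the end, as \<open>q y \<le> q x + q (x - y)\<close>.\<close>
  define d where "d = 1 / (96 * C\<^sup>2 * K)"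
  define r' where "r' = r + d"
  define e where "e = 1 / (24 * C)"
  have d: "d > 0" "C\<^sup>2 * K * d = 1 / 96" using C K_pos by (auto simp: d_def)
  have "C * K * d \<le> C\<^sup>2 * K * d"
    using C K_pos d by (intro mult_right_mono) (auto simp: power2_eq_square)
  then have CKd: "C * K * d \<le> 1 / 96" using d by simp
  have e: "e > 0" "e \<le> 1" "C * e = 1 / 24" using C by (auto simp: e_def divide_simps)
  obtain m where m: "m \<ge> 1" "\<And>x. r ^ m * q ((L ^^ m) x) \<le> e * q x"
    using contracting_strong[OF r e(1)] by blast
  define w where "w = cis (2 * pi / real m)"
  have w: "w ^ m = 1" using m(1) by (simp add: w_def Complex.DeMoivre)
  have cmod_w: "cmod (w ^ k) = 1" for k by (simp add: w_def norm_power)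
  have rw: "(of_real s * w ^ k) ^ m = of_real (s ^ m)" for s k
    by (simp add: power_mult_distrib w flip: power_mult mult.commute[of m])
      (simp add: w power_mult)
  have below: "q x \<le> 2 * C * q (M (of_real r * w ^ k) x)" for x k
    using r(2) C by (intro contracting_bounded_below[OF r(1)]) (auto simp: norm_mult cmod_w)
  \<comment> \<open>The change of radius costs at most half of \<open>q x\<close>, which is absorbed
    on the left and doubles the constant.\<close>
  have below': "q x \<le> 4 * C * q (M (of_real r' * w ^ k) x)" for x k
  proof -
    have diff: "of_real r' * w ^ k - of_real r * w ^ k = of_real d * w ^ k"
      by (simp add: r'_def algebra_simps)
    have "M (of_real r * w ^ k) x = M (of_real r' * w ^ k) x + sc (of_real d * w ^ k) (L x)"
      by (simp add: M_change[of "of_real r' * w ^ k" x "of_real r * w ^ k"] diff)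
    then have "q (M (of_real r * w ^ k) x) \<le> q (M (of_real r' * w ^ k) x) + d * q (L x)"
      using q_add[of "M (of_real r' * w ^ k) x" "sc (of_real d * w ^ k) (L x)"] d
      by (simp add: q_scale norm_mult cmod_w)
    also have "d * q (L x) \<le> d * (K * q x)" using d by (intro mult_left_mono q_L) auto
    finally have "2 * C * q (M (of_real r * w ^ k) x)
        \<le> 2 * C * (q (M (of_real r' * w ^ k) x) + d * (K * q x))"
      using C by (intro mult_left_mono) auto
    also have "\<dots> = 2 * C * q (M (of_real r' * w ^ k) x) + 2 * (C * K * d) * q x"
      by (simp add: algebra_simps)
    also have "2 * (C * K * d) * q x \<le> 1 / 2 * q x" using CKd by (intro mult_right_mono) auto
    finally show ?thesis using below[of x k] by simp
  qed
  have "r' ^ m * q ((L ^^ m) x) \<le> q x / 2" for x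
  proof -
    \<comment> \<open>The \<open>u k\<close> solve the equation for \<open>y\<close> exactly at
      radius \<open>r'\<close> and have mean \<open>x\<close>; the \<open>v k\<close> solve it up to
      a small error at radius \<open>r\<close> and have mean \<open>y\<close>. So the vector
      \<open>x - y\<close>, whose seminorm is to be estimated, is the mean of the
      differences.\<close>
    define y where "y = x - sc (of_real (r' ^ m)) ((L ^^ m) x)"
    define u where "u k = geo (of_real r' * w ^ k) m x" for k
    define v where "v k = geo (of_real r * w ^ k) m y" for k
    have small: "q (sc (of_real (r ^ m)) ((L ^^ m) y)) \<le> e * q y"
      using m(2)[of y] r(2) by (simp add: q_scale norm_power)
    have Mu: "M (of_real r' * w ^ k) (u k) = y" for k
      unfolding u_def M_geo rw y_def by simp
    have Mv: "M (of_real r * w ^ k) (v k) = y - sc (of_real (r ^ m)) ((L ^^ m) y)" for k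
      unfolding v_def M_geo rw by simp
    have qv: "q (v k) \<le> 4 * C * q y" for k
    proof -
      have "q (v k) \<le> 2 * C * q (y - sc (of_real (r ^ m)) ((L ^^ m) y))"
        using below[of "v k" k] unfolding Mv .
      also have "q (y - sc (of_real (r ^ m)) ((L ^^ m) y)) \<le> q y + e * q y"
        using q_diff[of y "sc (of_real (r ^ m)) ((L ^^ m) y)"] small by simp
      then have "2 * C * q (y - sc (of_real (r ^ m)) ((L ^^ m) y)) \<le> 2 * C * (q y + e * q y)"
        using C by (intro mult_left_mono) auto
      also have "\<dots> \<le> 2 * C * (q y + 1 * q y)"
        using e C by (intro mult_left_mono add_left_mono mult_right_mono) auto
      finally show ?thesis by simp
    qed
    have "q (u k - v k) \<le> q y / 3" for k
    proof -
      have diff: "of_real r' * w ^ k - of_real r * w ^ k = of_real d * w ^ k"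
        by (simp add: r'_def algebra_simps)
      have "M (of_real r' * w ^ k) (u k - v k)
          = sc (of_real (r ^ m)) ((L ^^ m) y) + sc (of_real d * w ^ k) (L (v k))"
        by (simp add: M_diff Mu M_change[of "of_real r' * w ^ k" "v k" "of_real r * w ^ k"] diff Mv)
      then have "q (M (of_real r' * w ^ k) (u k - v k))
          \<le> q (sc (of_real (r ^ m)) ((L ^^ m) y)) + d * q (L (v k))"
        using q_add[of "sc (of_real (r ^ m)) ((L ^^ m) y)" "sc (of_real d * w ^ k) (L (v k))"] d
        by (simp add: q_scale norm_mult cmod_w)
      also have "\<dots> \<le> e * q y + d * (K * (4 * C * q y))"
        using d K_pos qv[of k]
        by (intro add_mono small mult_left_mono order_trans[OF q_L]) auto
      finally have "4 * C * q (M (of_real r' * w ^ k) (u k - v k))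
          \<le> 4 * C * (e * q y + d * (K * (4 * C * q y)))"
        using C by (intro mult_left_mono) auto
      with below'[of "u k - v k" k]
      have "q (u k - v k) \<le> 4 * C * (e * q y + d * (K * (4 * C * q y)))" by linarith
      also have "\<dots> = (4 * (C * e) + 16 * (C\<^sup>2 * K * d)) * q y"
        by (simp add: algebra_simps power2_eq_square)
      also have "\<dots> = q y / 3" using e(3) d(2) by simp
      finally show ?thesis .
    qed
    then have "q (\<Sum>k<m. u k - v k) \<le> (\<Sum>k<m. q y / 3)"
      by (intro order_trans[OF q_sum] sum_mono)
    moreover have "(\<Sum>k<m. u k - v k) = sc (of_nat m) (x - y)"
      using m(1) unfolding u_def v_def w_def
      by (simp add: sum_subtractf sum_geo_roots_of_unity scale_right_diff_distrib)
    ultimately have "real m * q (x - y) \<le> real m * (q y / 3)" by (simp add: q_scale)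
    then have "q (x - y) \<le> q y / 3" using m(1) by (simp add: mult_le_cancel_left)
    also have "q y \<le> q x + q (x - y)" using q_diff[of x "x - y"] by simp
    finally have "q (x - y) \<le> q x / 2" by simp
    moreover have "r' \<ge> 0" using r(2) d by (simp add: r'_def)
    ultimately show ?thesis by (simp add: y_def q_scale norm_power)
  qed
  then show ?thesis unfolding contracting_def r'_def d_def using m(1) by blast
qed

text \<open>Equations for \<open>L\<close> are solvable with constant \<open>R\<close>, hence those
  for its \<open>m\<close>-th power with constant \<open>R ^ m\<close>. The disc grows in equal
  steps beyond radius \<open>R\<close>, where some power of \<open>L\<close> contracts too strongly
  for this, unless \<open>q\<close> vanishes.\<close>

lemma seminorm_zero_if_translates_surjective:
  assumes surj: "\<And>l. \<exists>C. \<forall>y. \<exists>x. q (y - (L x - sc l x)) = 0 \<and> q x \<le> C * q y"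
  shows "q x = 0"
proof -
  \<comment> \<open>For nonzero \<open>z\<close>, the operator \<open>M z\<close> is
    \<open>- z\<close> times the translate of \<open>L\<close> by 1/z.\<close>
  have exact: "\<exists>C>0. \<forall>y. \<exists>x. q (y - M z x) = 0 \<and> q x \<le> C * q y" for z
  proof (cases "z = 0")
    case True
    then have "q (y - M z y) = 0 \<and> q y \<le> 1 * q y" for y by (simp add: M_def)
    then show ?thesis using zero_less_one by blast
  next
    case False
    obtain C where C: "\<And>y. \<exists>x. q (y - (L x - sc (1 / z) x)) = 0 \<and> q x \<le> C * q y"
      using surj by blast
    have "\<exists>x. q (y - M z x) = 0 \<and> q x \<le> (\<bar>C\<bar> / cmod z + 1) * q y" for y
    proof -
      obtain x where x: "q (sc (- 1 / z) y - (L x - sc (1 / z) x)) = 0"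
        "q x \<le> C * q (sc (- 1 / z) y)" using C by blast
      have "sc (- z) (sc (- 1 / z) y - (L x - sc (1 / z) x)) = y - M z x"
        using False by (simp add: M_def scale_right_diff_distrib scale_minus_left)
      then have "q (y - M z x) = 0" using x(1) by (metis q_scale mult_zero_right)
      moreover have "q x \<le> \<bar>C\<bar> / cmod z * q y"
      proof -
        have "q x \<le> C * (q y / cmod z)"
          using x(2) unfolding q_scale by (simp add: norm_divide)
        also have "\<dots> \<le> \<bar>C\<bar> * (q y / cmod z)" by (intro mult_right_mono) auto
        finally show ?thesis by simp
      qed
      ultimately show ?thesis using q_nonneg[of y] by (intro exI[of _ x]) (simp add: distrib_right add_increasing2)
    qed
    then show ?thesis by (intro exI[of _ "\<bar>C\<bar> / cmod z + 1"]) (auto intro: add_nonneg_pos)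
  qed
  obtain C0 where C0: "\<And>y. \<exists>x. q (y - (L x - sc 0 x)) = 0 \<and> q x \<le> C0 * q y"
    using surj by blast
  define R where "R = \<bar>C0\<bar> + 1"
  have C0: "\<exists>x. q (y - L x) = 0 \<and> q x \<le> R * q y" for y
  proof -
    obtain x where x: "q (y - L x) = 0" "q x \<le> C0 * q y" using C0[of y] by auto
    have "C0 * q y \<le> R * q y" unfolding R_def by (intro mult_right_mono) auto
    then show ?thesis using x by (intro exI[of _ x]) auto
  qed
  obtain C where C: "C \<ge> 1" "\<And>z. cmod z \<le> R \<Longrightarrow> solves z C"
    using solves_uniform[OF exact] by blast
  define d where "d = 1 / (96 * C\<^sup>2 * K)"
  have d: "d > 0" using C K_pos by (simp add: d_def)
  \<comment> \<open>Growing from \<open>k * d\<close> uses solvability up to that radius only. The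
    bound is therefore imposed on \<open>j < k\<close>, and the last step may pass beyond
    \<open>R\<close>.\<close>
  have "contracting (real k * d)" if "\<forall>j<k. real j * d \<le> R" for k
    using that
  proof (induction k)
    case 0
    show ?case unfolding contracting_def by (intro exI[of _ 1]) auto
  next
    case (Suc k)
    have "contracting (real k * d + d)"
      unfolding d_def
    proof (rule contracting_step)
      show "solves z C" if "cmod z \<le> real k * (1 / (96 * C\<^sup>2 * K))" for z
        using that Suc.prems by (intro C(2)) (force simp: d_def[symmetric])
    qed (use Suc C d in \<open>auto simp flip: d_def\<close>)
    then show ?case by (simp add: algebra_simps)
  qed
  moreover obtain n where "\<not> real n * d \<le> R" using reals_Archimedean3[OF d] not_le by metis
  then obtain k where k: "\<not> real k * d \<le> R" "\<forall>j<k. real j * d \<le> R"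
    using exists_least_iff[of "\<lambda>k. \<not> real k * d \<le> R"] by blast
  ultimately obtain m where m: "\<And>x. (real k * d) ^ m * q ((L ^^ m) x) \<le> q x / 2"
    unfolding contracting_def by blast
  have "\<exists>y. q (x - (L ^^ n) y) = 0 \<and> q y \<le> R ^ n * q x" for n
  proof (induction n)
    case (Suc n)
    then obtain y where y: "q (x - (L ^^ n) y) = 0" "q y \<le> R ^ n * q x" by blast
    obtain y' where y': "q (y - L y') = 0" "q y' \<le> R * q y" using C0 by blast
    have eq: "x - (L ^^ Suc n) y' = (x - (L ^^ n) y) + (L ^^ n) (y - L y')"
      by (simp add: L_power_diff funpow_swap1)
    have "q (x - (L ^^ Suc n) y') \<le> 0"
      unfolding eq using q_add[of "x - (L ^^ n) y" "(L ^^ n) (y - L y')"] y(1) q_L_power[of n "y - L y'"] y'(1)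
      by simp
    moreover have "q y' \<le> R ^ Suc n * q x"
      using mult_left_mono[OF y(2), of R] y'(2) by (simp add: R_def mult.assoc)
    ultimately show ?case using q_nonneg by (intro exI[of _ y']) (auto intro: order_antisym)
  qed (auto intro: exI[of _ x])
  then obtain y where y: "q (x - (L ^^ m) y) = 0" "q y \<le> R ^ m * q x" by blast
  have "R > 0" by (simp add: R_def)
  have "R ^ m * q x \<le> R ^ m * q ((L ^^ m) y)"
    using q_add[of "x - (L ^^ m) y" "(L ^^ m) y"] y(1) \<open>R > 0\<close> by (intro mult_left_mono) auto
  also have "\<dots> \<le> (real k * d) ^ m * q ((L ^^ m) y)"
    using k(1) \<open>R > 0\<close> by (intro mult_right_mono power_mono) auto
  also have "\<dots> \<le> R ^ m * q x / 2" using m[of y] y(2) by simp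
  finally have "R ^ m * q x \<le> R ^ m * q x / 2" .
  then have "R ^ m * q x \<le> 0" by linarith
  then show ?thesis
    using zero_less_power[OF \<open>R > 0\<close>, of m] q_nonneg[of x] by (simp add: mult_le_0_iff)
qed

end

section \<open>The spectral mapping property of essential invertibility\<close>

text \<open>The Neumann series. One of the two products serves the right ideal, the other the left
  ideal.\<close>

lemma blinfun_invertible_near_id:
  fixes X :: "'a::banach \<Rightarrow>\<^sub>L 'a"
  assumes "norm (id_blinfun - X) \<le> 1 / 2"
  shows "\<exists>V. X o\<^sub>L V = id_blinfun \<and> V o\<^sub>L X = id_blinfun"
proof -
  define D where "D = id_blinfun - X"
  define p where "p n = ((o\<^sub>L) D ^^ n) id_blinfun" for n
  have p_Suc: "p (Suc n) = D o\<^sub>L p n" for n by (simp add: p_def)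
  have X_left: "X o\<^sub>L Y = Y - (D o\<^sub>L Y)" and X_right: "Y o\<^sub>L X = Y - (Y o\<^sub>L D)" for Y
    by (auto intro!: blinfun_eqI simp: D_def blinfun.diff_left blinfun.diff_right)
  have comm: "p n o\<^sub>L D = D o\<^sub>L p n" for n
  proof (induction n)
    case 0
    show ?case by (auto intro!: blinfun_eqI simp: p_def)
  next
    case (Suc n)
    have "p (Suc n) o\<^sub>L D = D o\<^sub>L (p n o\<^sub>L D)" by (auto intro!: blinfun_eqI simp: p_Suc)
    then show ?case by (simp add: Suc p_Suc)
  qed
  have norm_p: "norm (p n) \<le> (1/2) ^ n" for n
  proof (induction n)
    case 0
    show ?case by (simp add: p_def norm_blinfun_id_le)
  next
    case (Suc n)
    have "norm (p (Suc n)) \<le> norm D * norm (p n)" by (simp add: p_Suc norm_blinfun_compose)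
    also have "\<dots> \<le> 1 / 2 * (1 / 2) ^ n"
      using assms Suc by (intro mult_mono) (auto simp: D_def)
    finally show ?case by simp
  qed
  have summable: "summable p"
    by (rule summable_comparison_test'[OF summable_geometric norm_p]) simp
  have "p \<longlonglongrightarrow> 0" by (rule summable_LIMSEQ_zero[OF summable])
  from telescope_sums'[OF this] have sums: "(\<lambda>n. p n - (D o\<^sub>L p n)) sums id_blinfun"
    by (simp add: p_Suc[symmetric]) (simp add: p_def)
  have "(\<lambda>n. X o\<^sub>L p n) sums (X o\<^sub>L suminf p)"
    by (rule bounded_linear.sums[OF
          bounded_bilinear.bounded_linear_right[OF bounded_bilinear_blinfun_compose]
          summable_sums[OF summable]])
  moreover have "(\<lambda>n. p n o\<^sub>L X) sums (suminf p o\<^sub>L X)"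
    by (rule bounded_linear.sums[OF
          bounded_bilinear.bounded_linear_left[OF bounded_bilinear_blinfun_compose]
          summable_sums[OF summable]])
  ultimately show ?thesis
    using sums by (intro exI[of _ "suminf p"]) (auto simp: X_left X_right comm dest: sums_unique2)
qed

text \<open>The distance to \<open>J\<close> is the quotient seminorm, and its vanishing is density.
  The complex multiplication \<open>sc\<close> is a parameter because complex scalars act on the
  real-linear operators in two ways, after the operator and before it.\<close>

lemma dense_if_translates_surjective:
  fixes sc :: "complex \<Rightarrow> 'v::real_normed_vector \<Rightarrow> 'v"
  assumes sc: "vector_space sc" "\<And>c x. norm (sc c x) \<le> cmod c * norm x"
    and J: "0 \<in> J" "\<And>x y. x \<in> J \<Longrightarrow> y \<in> J \<Longrightarrow> x + y \<in> J" "\<And>c x. x \<in> J \<Longrightarrow> sc c x \<in> J"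
    and L: "\<And>x y. L (x + y) = L x + L y" "\<And>c x. L (sc c x) = sc c (L x)"
      "\<And>x. norm (L x) \<le> K * norm x" "\<And>x. x \<in> J \<Longrightarrow> L x \<in> J"
    and surj: "\<And>l. \<exists>C. \<forall>y. \<exists>x. y - (L x - sc l x) \<in> J \<and> norm x \<le> C * norm y"
    and "e > 0"
  shows "\<exists>j\<in>J. norm (x - j) < e"
proof -
  interpret vector_space sc by fact
  define q where "q x = infdist x J" for x
  have J_minus: "- x \<in> J" if "x \<in> J" for x
    using J(3)[OF that, of "- 1"] by (simp add: scale_minus_left)
  have J_diff: "x - y \<in> J" if "x \<in> J" "y \<in> J" for x y
    using J(2)[OF that(1) J_minus[OF that(2)]] by simp
  have q_le: "q x \<le> norm (x - j)" if "j \<in> J" for x j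
    using infdist_le[OF that, of x] by (simp add: q_def dist_norm)
  have q_near: "\<exists>j\<in>J. norm (x - j) < r" if "q x < r" for x r
  proof -
    have "J \<noteq> {}" using J(1) by blast
    then have "Inf (dist x ` J) < r" using that by (simp add: q_def infdist_def)
    then show ?thesis using cInf_lessD[of "dist x ` J" r] \<open>J \<noteq> {}\<close> by (auto simp: dist_norm)
  qed
  have q_greatest: "a \<le> q x" if "\<And>j. j \<in> J \<Longrightarrow> a \<le> norm (x - j)" for a x
    using q_near[of x a] that by force
  have q_mono: "q y \<le> c * q x" if "c \<ge> 0" "\<And>j. j \<in> J \<Longrightarrow> q y \<le> c * norm (x - j)" for c x y
  proof (cases "c = 0")
    case True
    then show ?thesis using that(2)[OF J(1)] by simp
  next
    case False
    then have "q y / c \<le> q x"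
      using that by (intro q_greatest) (simp add: pos_divide_le_eq mult.commute)
    then show ?thesis using False that(1) by (simp add: pos_divide_le_eq mult.commute)
  qed
  have L_diff: "L (x - y) = L x - L y" for x y using L(1)[of "x - y" y] by simp
  have "seminormed_operator sc q L (\<bar>K\<bar> + 1)"
  proof (intro seminormed_operator.intro sc seminormed_operator_axioms.intro L)
    show "q (x + y) \<le> q x + q y" for x y
    proof -
      have "q (x + y) - norm (x - i) \<le> q y" if i: "i \<in> J" for i
      proof (rule q_greatest)
        fix j assume "j \<in> J"
        then have "q (x + y) \<le> norm ((x - i) + (y - j))"
          using q_le[OF J(2)[OF i], of j "x + y"] by (simp add: algebra_simps)
        then show "q (x + y) - norm (x - i) \<le> norm (y - j)"
          using norm_triangle_ineq[of "x - i" "y - j"] by linarith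
      qed
      then have "q (x + y) - q y \<le> q x" by (intro q_greatest) (simp add: algebra_simps)
      then show ?thesis by simp
    qed
    show "q (sc c x) \<le> cmod c * q x" for c x
    proof (rule q_mono)
      fix j assume "j \<in> J"
      then have "q (sc c x) \<le> norm (sc c (x - j))"
        using q_le[OF J(3)] by (simp add: scale_right_diff_distrib)
      also have "\<dots> \<le> cmod c * norm (x - j)" by (rule sc(2))
      finally show "q (sc c x) \<le> cmod c * norm (x - j)" .
    qed simp
    show "q (L x) \<le> (\<bar>K\<bar> + 1) * q x" for x
    proof (rule q_mono)
      fix j assume "j \<in> J"
      then have "q (L x) \<le> norm (L (x - j))" using q_le[OF L(4)] by (simp add: L_diff)
      also have "\<dots> \<le> K * norm (x - j)" by (rule L(3))
      also have "\<dots> \<le> (\<bar>K\<bar> + 1) * norm (x - j)" by (intro mult_right_mono) auto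
      finally show "q (L x) \<le> (\<bar>K\<bar> + 1) * norm (x - j)" .
    qed simp
  qed auto
  then interpret Q: seminormed_operator sc q L "\<bar>K\<bar> + 1" .
  have q_J: "q j = 0" if "j \<in> J" for j
    using q_le[OF that, of j] Q.q_nonneg[of j] by simp
  have "q x = 0"
  proof (rule Q.seminorm_zero_if_translates_surjective)
    fix l
    obtain C where C: "\<And>y. \<exists>x. y - (L x - sc l x) \<in> J \<and> norm x \<le> C * norm y"
      using surj by blast
    have "\<exists>x. q (y - (L x - sc l x)) = 0 \<and> q x \<le> (2 * \<bar>C\<bar>) * q y" for y
    proof (cases "q y = 0")
      case True
      then show ?thesis by (intro exI[of _ 0]) (simp add: L(2)[of 0 0, simplified])
    next
      case False
      \<comment> \<open>Solutions are bounded in terms of the norm. A representative of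
        \<open>y\<close> modulo \<open>J\<close> of norm below \<open>2 * q y\<close> converts this
        into a bound in terms of \<open>q\<close>; it is available because \<open>q y\<close> is
        nonzero.\<close>
      then have "q y < 2 * q y" using Q.q_nonneg[of y] by linarith
      then obtain j where j: "j \<in> J" "norm (y - j) < 2 * q y" using q_near by blast
      obtain x where x: "(y - j) - (L x - sc l x) \<in> J" "norm x \<le> C * norm (y - j)"
        using C by blast
      have "y - (L x - sc l x) \<in> J" using J(2)[OF x(1) j(1)] by (simp add: algebra_simps)
      moreover have "q x \<le> (2 * \<bar>C\<bar>) * q y"
      proof -
        have "q x \<le> C * norm (y - j)" using q_le[OF J(1), of x] x(2) by simp
        also have "\<dots> \<le> \<bar>C\<bar> * (2 * q y)" using j(2) by (intro mult_mono) auto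
        finally show ?thesis by simp
      qed
      ultimately show ?thesis using q_J by blast
    qed
    then show "\<exists>C. \<forall>y. \<exists>x. q (y - (L x - sc l x)) = 0 \<and> q x \<le> C * q y" by blast
  qed
  then show ?thesis using q_near[of x e] \<open>e > 0\<close> by simp
qed

section \<open>Operators modulo the one-sided ideal generated by a tuple\<close>

lemma sum_UNIV_option:
  fixes f :: "'n::finite option \<Rightarrow> 'b::comm_monoid_add"
  shows "(\<Sum>i\<in>UNIV. f i) = f None + (\<Sum>i\<in>UNIV. f (Some i))"
  by (simp add: UNIV_option_conv sum.reindex)

text \<open>A real-linear \<open>f\<close> sees the real and imaginary parts of a coefficient
  separately, so the images of \<open>b\<close> and of \<open>\<i> *\<^sub>C b\<close> are both
  taken as generators.\<close>

lemma span_real_linear_image: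
  fixes f :: "'a::complex_normed_vector \<Rightarrow> 'b::complex_normed_vector"
  assumes f: "linear f" and x: "x \<in> complex_vector.span B"
  shows "f x \<in> complex_vector.span (f ` B \<union> (\<lambda>b. f (\<i> *\<^sub>C b)) ` B)"
  using x
proof (induction rule: complex_vector.span_induct_alt)
  case base
  then show ?case using linear_0[OF f] complex_vector.span_zero by simp
next
  case (step c b y)
  have "c *\<^sub>C b = Re c *\<^sub>R b + Im c *\<^sub>R (\<i> *\<^sub>C b)"
    by (subst (1) complex_eq[of c])
      (simp add: scaleC_add_left scaleR_scaleC scaleC_scaleC mult.commute)
  then have "f (c *\<^sub>C b + y) = complex_of_real (Re c) *\<^sub>C f b
      + complex_of_real (Im c) *\<^sub>C f (\<i> *\<^sub>C b) + f y"
    by (simp add: linear_add[OF f] linear_scale[OF f] scaleR_scaleC[symmetric])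
  moreover have "f b \<in> complex_vector.span (f ` B \<union> (\<lambda>b. f (\<i> *\<^sub>C b)) ` B)"
    "f (\<i> *\<^sub>C b) \<in> complex_vector.span (f ` B \<union> (\<lambda>b. f (\<i> *\<^sub>C b)) ` B)"
    using step.hyps by (blast intro: complex_vector.span_base)+
  ultimately show ?case
    using step.IH by (simp only: complex_vector.span_add complex_vector.span_scale)
qed

lemma complexified_scaleC:
  "(1 / 2 :: complex) *\<^sub>C (x - \<i> *\<^sub>C (\<i> *\<^sub>C x)) = (x :: 'a::complex_vector)"
proof -
  have "x - \<i> *\<^sub>C (\<i> *\<^sub>C x) = (2 :: complex) *\<^sub>C x"
    using scaleC_add_left[of 1 1 x] by (simp add: scaleC_scaleC scaleC_one complex_vector.scale_minus_left)
  then show ?thesis by (simp add: scaleC_scaleC scaleC_one)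
qed

lemma bounded_clinear_blinfun_complexification:
  fixes G :: "'a::complex_normed_vector \<Rightarrow>\<^sub>L 'b::complex_normed_vector"
  shows "bounded_clinear (\<lambda>x. (1 / 2 :: complex) *\<^sub>C (G x - \<i> *\<^sub>C G (\<i> *\<^sub>C x)))"
  by (intro bounded_clinear_compose_scaleC bounded_clinear_complexification
      blinfun.bounded_linear_right)

text \<open>Let \<open>C None\<close> be the coefficient of S - l in an essential right inverse of
  the enlarged tuple. Multiplying that relation by \<open>Y\<close> from the right shows that (S -
  l)X agrees with \<open>Y\<close> modulo \<open>J\<close> for X the composite of
  \<open>C None\<close> and \<open>Y\<close>, which is bounded by a multiple of the norm of
  \<open>Y\<close>. So all translates of left multiplication by \<open>S\<close> are surjective
  modulo \<open>J\<close>.\<close>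

lemma ess_right_invertible_spectral_mapping:
  fixes T :: "'n::finite \<Rightarrow> 'a::complex_banach \<Rightarrow> 'a"
  assumes T: "\<And>i. bounded_clinear (T i)" and S: "bounded_clinear S"
    and comm: "\<And>i x. T i (S x) = S (T i x)"
    and inv: "\<And>l. ess_right_invertible (case_option (\<lambda>x. S x - l *\<^sub>C x) T)"
  shows "ess_right_invertible T"
proof -
  note T' = bounded_clinear_clinear[OF T] and S' = bounded_clinear_clinear[OF S]
  define J where "J = {X :: 'a \<Rightarrow>\<^sub>L 'a. \<exists>(A :: 'n \<Rightarrow> 'a \<Rightarrow>\<^sub>L 'a) B. finite B \<and>
    (\<forall>x. X x - (\<Sum>i\<in>UNIV. T i (A i x)) \<in> complex_vector.span B)}"
  have JI: "X \<in> J" if "finite B" "\<And>x. X x - (\<Sum>i\<in>UNIV. T i (A i x)) \<in> complex_vector.span B"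
    for X :: "'a \<Rightarrow>\<^sub>L 'a" and A :: "'n \<Rightarrow> 'a \<Rightarrow>\<^sub>L 'a" and B
    unfolding J_def using that by blast
  have JD: "\<exists>(A :: 'n \<Rightarrow> 'a \<Rightarrow>\<^sub>L 'a) B. finite B \<and>
    (\<forall>x. X x - (\<Sum>i\<in>UNIV. T i (A i x)) \<in> complex_vector.span B)" if "X \<in> J" for X
    using that unfolding J_def by (rule CollectD)
  \<comment> \<open>Scalars act on the values, where they commute with \<open>S\<close> and the
    \<open>T i\<close> because these are complex-linear.\<close>
  define sc where "sc c (X :: 'a \<Rightarrow>\<^sub>L 'a) = Blinfun (\<lambda>x. c *\<^sub>C x) o\<^sub>L X" for c X
  have sc: "sc c X x = c *\<^sub>C X x" for c X x
    by (simp add: sc_def bounded_linear_Blinfun_apply bounded_linear_scaleC)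
  define L where "L (X :: 'a \<Rightarrow>\<^sub>L 'a) = Blinfun S o\<^sub>L X" for X
  have L: "L X x = S (X x)" for X x
    using S by (simp add: L_def bounded_linear_Blinfun_apply bounded_clinear_iff)
  have "\<exists>j\<in>J. norm (id_blinfun - j) < 1 / 2"
  proof (rule dense_if_translates_surjective[where L = L and sc = sc and K = "norm (Blinfun S)"])
    show "vector_space sc"
      by standard (auto intro!: blinfun_eqI simp: sc blinfun.add_left scaleC_add_left
          scaleC_add_right scaleC_scaleC scaleC_one)
    show "norm (sc c X) \<le> cmod c * norm X" for c X
      by (intro norm_blinfun_bound) (auto simp: sc norm_scaleC mult.assoc norm_blinfun mult_left_mono)
    show "0 \<in> J"
      by (rule JI[of "{}" 0 "\<lambda>_. 0"]) (auto simp: clinear_0[OF T'])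
    show "X + Y \<in> J" if XY: "X \<in> J" "Y \<in> J" for X Y
    proof -
      obtain A :: "'n \<Rightarrow> 'a \<Rightarrow>\<^sub>L 'a" and B
        where A: "finite B" "\<And>x. X x - (\<Sum>i\<in>UNIV. T i (A i x)) \<in> complex_vector.span B"
        using JD[OF XY(1)] by blast
      obtain A' :: "'n \<Rightarrow> 'a \<Rightarrow>\<^sub>L 'a" and B'
        where A': "finite B'" "\<And>x. Y x - (\<Sum>i\<in>UNIV. T i (A' i x)) \<in> complex_vector.span B'"
        using JD[OF XY(2)] by blast
      show ?thesis
      proof (rule JI[of "B \<union> B'" _ "\<lambda>i. A i + A' i"])
        fix x
        have "(X + Y) x - (\<Sum>i\<in>UNIV. T i ((A i + A' i) x))
            = (X x - (\<Sum>i\<in>UNIV. T i (A i x))) + (Y x - (\<Sum>i\<in>UNIV. T i (A' i x)))"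
          by (simp add: blinfun.add_left clinear_add[OF T'] sum.distrib)
        also have "\<dots> \<in> complex_vector.span (B \<union> B')"
          by (intro complex_vector.span_add subsetD[OF complex_vector.span_mono A(2)]
              subsetD[OF complex_vector.span_mono A'(2)]) auto
        finally show "(X + Y) x - (\<Sum>i\<in>UNIV. T i ((A i + A' i) x))
          \<in> complex_vector.span (B \<union> B')" .
      qed (use A A' in auto)
    qed
    show "sc c X \<in> J" if X: "X \<in> J" for c X
    proof -
      obtain A :: "'n \<Rightarrow> 'a \<Rightarrow>\<^sub>L 'a" and B
        where A: "finite B" "\<And>x. X x - (\<Sum>i\<in>UNIV. T i (A i x)) \<in> complex_vector.span B"
        using JD[OF X] by blast
      show ?thesis
      proof (rule JI[OF A(1), of _ "\<lambda>i. sc c (A i)"])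
        show "sc c X x - (\<Sum>i\<in>UNIV. T i (sc c (A i) x)) \<in> complex_vector.span B" for x
          using complex_vector.span_scale[OF A(2)[of x], of c]
          by (simp add: sc clinear_scaleC[OF T'] complex_vector.scale_right_diff_distrib
              complex_vector.scale_sum_right)
      qed
    qed
    show "L (X + Y) = L X + L Y" for X Y
      by (auto intro!: blinfun_eqI simp: L blinfun.add_left clinear_add[OF S'])
    show "L (sc c X) = sc c (L X)" for c X
      by (auto intro!: blinfun_eqI simp: L sc clinear_scaleC[OF S'])
    show "norm (L X) \<le> norm (Blinfun S) * norm X" for X
      unfolding L_def by (rule norm_blinfun_compose)
    show "L X \<in> J" if X: "X \<in> J" for X
    proof -
      obtain A :: "'n \<Rightarrow> 'a \<Rightarrow>\<^sub>L 'a" and B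
        where A: "finite B" "\<And>x. X x - (\<Sum>i\<in>UNIV. T i (A i x)) \<in> complex_vector.span B"
        using JD[OF X] by blast
      interpret S: Vector_Spaces.linear scaleC scaleC S by (rule S')
      show ?thesis
      proof (rule JI[of "S ` B" _ "\<lambda>i. L (A i)"])
        show "L X x - (\<Sum>i\<in>UNIV. T i (L (A i) x)) \<in> complex_vector.span (S ` B)" for x
          using imageI[OF A(2)[of x], of S] by (simp add: L comm S.span_image S.diff S.sum)
      qed (use A in auto)
    qed
    show "\<exists>C. \<forall>Y. \<exists>X. Y - (L X - sc l X) \<in> J \<and> norm X \<le> C * norm Y" for l
    proof -
      obtain A B where A: "\<And>i. bounded_clinear (A i)" "finite B"
        "\<And>x. x - (\<Sum>i\<in>UNIV. case_option (\<lambda>x. S x - l *\<^sub>C x) T i (A i x)) \<in> complex_vector.span B"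
        using inv[of l] unfolding ess_right_invertible_def by blast
      define C where "C i = Blinfun (A i)" for i
      have C: "C i x = A i x" for i x
        using A(1)[of i] by (simp add: C_def bounded_linear_Blinfun_apply bounded_clinear_iff)
      have "Y - (L (C None o\<^sub>L Y) - sc l (C None o\<^sub>L Y)) \<in> J" for Y
      proof (rule JI[OF A(2), of _ "\<lambda>i. C (Some i) o\<^sub>L Y"])
        show "(Y - (L (C None o\<^sub>L Y) - sc l (C None o\<^sub>L Y))) x
            - (\<Sum>i\<in>UNIV. T i ((C (Some i) o\<^sub>L Y) x)) \<in> complex_vector.span B" for x
          using A(3)[of "Y x"] by (simp add: sum_UNIV_option blinfun.diff_left L sc C diff_diff_eq)
      qed
      then show ?thesis
        using norm_blinfun_compose[of "C None"] by (intro exI[of _ "norm (C None)"]) blast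
    qed
  qed simp
  then obtain X where X: "X \<in> J" "norm (id_blinfun - X) \<le> 1 / 2" by force
  obtain V where V: "X o\<^sub>L V = id_blinfun" using blinfun_invertible_near_id[OF X(2)] by blast
  obtain A :: "'n \<Rightarrow> 'a \<Rightarrow>\<^sub>L 'a" and B
        where A: "finite B" "\<And>x. X x - (\<Sum>i\<in>UNIV. T i (A i x)) \<in> complex_vector.span B"
    using JD[OF X(1)] by blast
  \<comment> \<open>Composition with the inverse on the right changes only the coefficients; the
    remainder keeps its values in the span of the same \<open>B\<close>.\<close>
  define G where "G i = A i o\<^sub>L V" for i
  have G: "x - (\<Sum>i\<in>UNIV. T i (G i x)) \<in> complex_vector.span B" for x
    using A(2)[of "V x"] arg_cong[OF V, of "\<lambda>f. blinfun_apply f x"] by (simp add: G_def)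
  show ?thesis
    unfolding ess_right_invertible_def
  proof (intro exI conjI allI)
    show "bounded_clinear (\<lambda>x. (1 / 2 :: complex) *\<^sub>C (G i x - \<i> *\<^sub>C G i (\<i> *\<^sub>C x)))" for i
      by (rule bounded_clinear_blinfun_complexification)
    fix x
    let ?R = "\<lambda>x. x - (\<Sum>i\<in>UNIV. T i (G i x))"
    \<comment> \<open>Averaging the remainder keeps it in a complex subspace, and on the terms of
      the sum it passes through the complex-linear \<open>T i\<close> to the coefficients.\<close>
    have "(1 / 2 :: complex) *\<^sub>C (?R x - \<i> *\<^sub>C ?R (\<i> *\<^sub>C x)) \<in> complex_vector.span B"
      by (intro complex_vector.span_scale complex_vector.span_diff G)
    also have "(1 / 2 :: complex) *\<^sub>C (?R x - \<i> *\<^sub>C ?R (\<i> *\<^sub>C x))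
        = (1 / 2 :: complex) *\<^sub>C (x - \<i> *\<^sub>C (\<i> *\<^sub>C x))
          - (\<Sum>i\<in>UNIV. T i ((1 / 2 :: complex) *\<^sub>C (G i x - \<i> *\<^sub>C G i (\<i> *\<^sub>C x))))"
      by (simp only: clinear_scaleC[OF T'] clinear_diff[OF T']
          complex_vector.scale_right_diff_distrib complex_vector.scale_sum_right sum_subtractf)
        (simp add: algebra_simps)
    finally show "x - (\<Sum>i\<in>UNIV. T i ((1 / 2 :: complex) *\<^sub>C (G i x - \<i> *\<^sub>C G i (\<i> *\<^sub>C x))))
      \<in> complex_vector.span B"
      unfolding complexified_scaleC .
  qed (rule A(1))
qed

text \<open>All products are reversed compared with the right-invertible case. The finite-rank
  remainder is now followed by a real-linear operator, so its generators have to be supplemented by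
  the images of the vectors \<open>\<i> *\<^sub>C b\<close>.\<close>

lemma ess_left_invertible_spectral_mapping:
  fixes T :: "'n::finite \<Rightarrow> 'a::complex_banach \<Rightarrow> 'a"
  assumes T: "\<And>i. bounded_clinear (T i)" and S: "bounded_clinear S"
    and comm: "\<And>i x. T i (S x) = S (T i x)"
    and inv: "\<And>l. ess_left_invertible (case_option (\<lambda>x. S x - l *\<^sub>C x) T)"
  shows "ess_left_invertible T"
proof -
  note T' = bounded_clinear_clinear[OF T] and S' = bounded_clinear_clinear[OF S]
  define J where "J = {X :: 'a \<Rightarrow>\<^sub>L 'a. \<exists>(A :: 'n \<Rightarrow> 'a \<Rightarrow>\<^sub>L 'a) B. finite B \<and>
    (\<forall>x. X x - (\<Sum>i\<in>UNIV. A i (T i x)) \<in> complex_vector.span B)}"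
  have JI: "X \<in> J" if "finite B" "\<And>x. X x - (\<Sum>i\<in>UNIV. A i (T i x)) \<in> complex_vector.span B"
    for X :: "'a \<Rightarrow>\<^sub>L 'a" and A :: "'n \<Rightarrow> 'a \<Rightarrow>\<^sub>L 'a" and B
    unfolding J_def using that by blast
  have JD: "\<exists>(A :: 'n \<Rightarrow> 'a \<Rightarrow>\<^sub>L 'a) B. finite B \<and>
    (\<forall>x. X x - (\<Sum>i\<in>UNIV. A i (T i x)) \<in> complex_vector.span B)" if "X \<in> J" for X
    using that unfolding J_def by (rule CollectD)
  \<comment> \<open>Scalars act on the arguments: for a real-linear \<open>X\<close>, it is
    \<open>X (S x - l *\<^sub>C x)\<close> that equals the value of \<open>L X - sc l X\<close> at
    \<open>x\<close>.\<close>
  define sc where "sc c (X :: 'a \<Rightarrow>\<^sub>L 'a) = X o\<^sub>L Blinfun (\<lambda>x. c *\<^sub>C x)" for c X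
  have sc: "sc c X x = X (c *\<^sub>C x)" for c X x
    by (simp add: sc_def bounded_linear_Blinfun_apply bounded_linear_scaleC)
  define L where "L (X :: 'a \<Rightarrow>\<^sub>L 'a) = X o\<^sub>L Blinfun S" for X
  have L: "L X x = X (S x)" for X x
    using S by (simp add: L_def bounded_linear_Blinfun_apply bounded_clinear_iff)
  have "\<exists>j\<in>J. norm (id_blinfun - j) < 1 / 2"
  proof (rule dense_if_translates_surjective[where L = L and sc = sc and K = "norm (Blinfun S)"])
    show "vector_space sc"
      by standard (auto intro!: blinfun_eqI simp: sc blinfun.add_left blinfun.add_right
          scaleC_add_left scaleC_scaleC scaleC_one mult.commute)
    show "norm (sc c X) \<le> cmod c * norm X" for c X
    proof (intro norm_blinfun_bound)
      show "norm (sc c X x) \<le> cmod c * norm X * norm x" for x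
        using norm_blinfun[of X "c *\<^sub>C x"] by (simp add: sc norm_scaleC mult_ac)
    qed simp
    show "0 \<in> J"
      by (rule JI[of "{}" 0 "\<lambda>_. 0"]) auto
    show "X + Y \<in> J" if XY: "X \<in> J" "Y \<in> J" for X Y
    proof -
      obtain A :: "'n \<Rightarrow> 'a \<Rightarrow>\<^sub>L 'a" and B
        where A: "finite B" "\<And>x. X x - (\<Sum>i\<in>UNIV. A i (T i x)) \<in> complex_vector.span B"
        using JD[OF XY(1)] by blast
      obtain A' :: "'n \<Rightarrow> 'a \<Rightarrow>\<^sub>L 'a" and B'
        where A': "finite B'" "\<And>x. Y x - (\<Sum>i\<in>UNIV. A' i (T i x)) \<in> complex_vector.span B'"
        using JD[OF XY(2)] by blast
      show ?thesis
      proof (rule JI[of "B \<union> B'" _ "\<lambda>i. A i + A' i"])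
        fix x
        have "(X + Y) x - (\<Sum>i\<in>UNIV. (A i + A' i) (T i x))
            = (X x - (\<Sum>i\<in>UNIV. A i (T i x))) + (Y x - (\<Sum>i\<in>UNIV. A' i (T i x)))"
          by (simp add: blinfun.add_left sum.distrib)
        also have "\<dots> \<in> complex_vector.span (B \<union> B')"
          by (intro complex_vector.span_add subsetD[OF complex_vector.span_mono A(2)]
              subsetD[OF complex_vector.span_mono A'(2)]) auto
        finally show "(X + Y) x - (\<Sum>i\<in>UNIV. (A i + A' i) (T i x))
          \<in> complex_vector.span (B \<union> B')" .
      qed (use A A' in auto)
    qed
    show "sc c X \<in> J" if X: "X \<in> J" for c X
    proof -
      obtain A :: "'n \<Rightarrow> 'a \<Rightarrow>\<^sub>L 'a" and B
        where A: "finite B" "\<And>x. X x - (\<Sum>i\<in>UNIV. A i (T i x)) \<in> complex_vector.span B"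
        using JD[OF X] by blast
      show ?thesis
      proof (rule JI[OF A(1), of _ "\<lambda>i. sc c (A i)"])
        show "sc c X x - (\<Sum>i\<in>UNIV. sc c (A i) (T i x)) \<in> complex_vector.span B" for x
          using A(2)[of "c *\<^sub>C x"] by (simp add: sc clinear_scaleC[OF T'])
      qed
    qed
    show "L (X + Y) = L X + L Y" for X Y
      by (auto intro!: blinfun_eqI simp: L blinfun.add_left)
    show "L (sc c X) = sc c (L X)" for c X
      by (auto intro!: blinfun_eqI simp: L sc clinear_scaleC[OF S'])
    show "norm (L X) \<le> norm (Blinfun S) * norm X" for X
      unfolding L_def using norm_blinfun_compose[of X "Blinfun S"] by (simp add: mult.commute)
    show "L X \<in> J" if X: "X \<in> J" for X
    proof -
      obtain A :: "'n \<Rightarrow> 'a \<Rightarrow>\<^sub>L 'a" and B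
        where A: "finite B" "\<And>x. X x - (\<Sum>i\<in>UNIV. A i (T i x)) \<in> complex_vector.span B"
        using JD[OF X] by blast
      show ?thesis
      proof (rule JI[OF A(1), of _ "\<lambda>i. L (A i)"])
        show "L X x - (\<Sum>i\<in>UNIV. L (A i) (T i x)) \<in> complex_vector.span B" for x
          using A(2)[of "S x"] by (simp add: L comm)
      qed
    qed
    show "\<exists>C. \<forall>Y. \<exists>X. Y - (L X - sc l X) \<in> J \<and> norm X \<le> C * norm Y" for l
    proof -
      obtain A B where A: "\<And>i. bounded_clinear (A i)" "finite B"
        "\<And>x. x - (\<Sum>i\<in>UNIV. A i (case_option (\<lambda>x. S x - l *\<^sub>C x) T i x)) \<in> complex_vector.span B"
        using inv[of l] unfolding ess_left_invertible_def by blast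
      define C where "C i = Blinfun (A i)" for i
      have C: "C i x = A i x" for i x
        using A(1)[of i] by (simp add: C_def bounded_linear_Blinfun_apply bounded_clinear_iff)
      have "Y - (L (Y o\<^sub>L C None) - sc l (Y o\<^sub>L C None)) \<in> J" for Y
      proof (rule JI[of "Y ` B \<union> (\<lambda>b. Y (\<i> *\<^sub>C b)) ` B" _ "\<lambda>i. Y o\<^sub>L C (Some i)"])
        fix x
        have "(Y - (L (Y o\<^sub>L C None) - sc l (Y o\<^sub>L C None))) x
            - (\<Sum>i\<in>UNIV. (Y o\<^sub>L C (Some i)) (T i x))
          = Y (x - (\<Sum>i\<in>UNIV. A i (case_option (\<lambda>x. S x - l *\<^sub>C x) T i x)))"
          by (simp add: sum_UNIV_option blinfun.diff_left L sc C blinfun.diff_right blinfun.add_right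
              blinfun.sum_right clinear_diff[OF bounded_clinear_clinear[OF A(1)]] diff_diff_eq)
        also have "\<dots> \<in> complex_vector.span (Y ` B \<union> (\<lambda>b. Y (\<i> *\<^sub>C b)) ` B)"
          by (rule span_real_linear_image[OF _ A(3)])
            (rule bounded_linear.linear[OF blinfun.bounded_linear_right])
        finally show "(Y - (L (Y o\<^sub>L C None) - sc l (Y o\<^sub>L C None))) x
            - (\<Sum>i\<in>UNIV. (Y o\<^sub>L C (Some i)) (T i x))
          \<in> complex_vector.span (Y ` B \<union> (\<lambda>b. Y (\<i> *\<^sub>C b)) ` B)" .
      qed (use A(2) in auto)
      moreover have "norm (Y o\<^sub>L C None) \<le> norm (C None) * norm Y" for Y
        using norm_blinfun_compose[of Y "C None"] by (simp add: mult.commute)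
      ultimately show ?thesis by blast
    qed
  qed simp
  then obtain X where X: "X \<in> J" "norm (id_blinfun - X) \<le> 1 / 2" by force
  obtain V where V: "V o\<^sub>L X = id_blinfun" using blinfun_invertible_near_id[OF X(2)] by blast
  obtain A :: "'n \<Rightarrow> 'a \<Rightarrow>\<^sub>L 'a" and B
        where A: "finite B" "\<And>x. X x - (\<Sum>i\<in>UNIV. A i (T i x)) \<in> complex_vector.span B"
    using JD[OF X(1)] by blast
  define G where "G i = V o\<^sub>L A i" for i
  define B' where "B' = V ` B \<union> (\<lambda>b. V (\<i> *\<^sub>C b)) ` B"
  have G: "x - (\<Sum>i\<in>UNIV. G i (T i x)) \<in> complex_vector.span B'" for x
  proof -
    have "x - (\<Sum>i\<in>UNIV. G i (T i x)) = V (X x - (\<Sum>i\<in>UNIV. A i (T i x)))"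
      using arg_cong[OF V, of "\<lambda>f. blinfun_apply f x"]
      by (simp add: G_def blinfun.diff_right blinfun.sum_right)
    also have "\<dots> \<in> complex_vector.span B'"
      unfolding B'_def
      by (rule span_real_linear_image[OF _ A(2)])
        (rule bounded_linear.linear[OF blinfun.bounded_linear_right])
    finally show ?thesis .
  qed
  show ?thesis
    unfolding ess_left_invertible_def
  proof (intro exI conjI allI)
    show "bounded_clinear (\<lambda>x. (1 / 2 :: complex) *\<^sub>C (G i x - \<i> *\<^sub>C G i (\<i> *\<^sub>C x)))" for i
      by (rule bounded_clinear_blinfun_complexification)
    show "finite B'" using A(1) by (simp add: B'_def)
    fix x
    let ?R = "\<lambda>x. x - (\<Sum>i\<in>UNIV. G i (T i x))"
    have "(1 / 2 :: complex) *\<^sub>C (?R x - \<i> *\<^sub>C ?R (\<i> *\<^sub>C x)) \<in> complex_vector.span B'"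
      by (intro complex_vector.span_scale complex_vector.span_diff G)
    also have "(1 / 2 :: complex) *\<^sub>C (?R x - \<i> *\<^sub>C ?R (\<i> *\<^sub>C x))
        = (1 / 2 :: complex) *\<^sub>C (x - \<i> *\<^sub>C (\<i> *\<^sub>C x))
          - (\<Sum>i\<in>UNIV. (1 / 2 :: complex) *\<^sub>C (G i (T i x) - \<i> *\<^sub>C G i (\<i> *\<^sub>C T i x)))"
      by (simp only: clinear_scaleC[OF T'] complex_vector.scale_right_diff_distrib
          complex_vector.scale_sum_right sum_subtractf) (simp add: algebra_simps)
    finally show "x - (\<Sum>i\<in>UNIV. (1 / 2 :: complex) *\<^sub>C (G i (T i x) - \<i> *\<^sub>C G i (\<i> *\<^sub>C T i x)))
      \<in> complex_vector.span B'"
      unfolding complexified_scaleC .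
  qed
qed

section \<open>Powers of the operators of a tuple\<close>

lemma funpow_commute:
  fixes R S :: "'a \<Rightarrow> 'a"
  assumes "\<And>x. R (S x) = S (R x)"
  shows "(R ^^ k) (S x) = S ((R ^^ k) x)"
  by (induction k) (simp_all add: assms)

lemma subspace_sum_range_powers:
  fixes T :: "'n::finite \<Rightarrow> 'a::complex_vector \<Rightarrow> 'a"
  assumes "\<And>i. clinear (T i)"
  shows "complex_vector.subspace (\<Sum>i\<in>UNIV. range (T i ^^ k i))"
  by (intro subspace_set_sum subspace_range clinear_funpow assms)

lemma range_power_subset:
  fixes T :: "'n::finite \<Rightarrow> 'a::complex_vector \<Rightarrow> 'a"
  assumes "\<And>i. clinear (T i)"
  shows "(T j ^^ k j) y \<in> (\<Sum>i\<in>UNIV. range (T i ^^ k i))"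
  using set_sum_member_subset[of UNIV j "\<lambda>i. range (T i ^^ k i)"]
  by (auto intro!: subspace_range clinear_funpow assms)

lemma subspace_range_infty:
  fixes T :: "'n::finite \<Rightarrow> 'a::complex_vector \<Rightarrow> 'a"
  assumes "\<And>i. clinear (T i)"
  shows "complex_vector.subspace (range_infty T)"
  unfolding range_infty_def
  by (intro complex_vector.subspace_Inter) (auto intro!: subspace_sum_range_powers assms)

lemma null_infty_iff: "x \<in> null_infty T \<longleftrightarrow> (\<exists>k\<ge>1. \<forall>i. (T i ^^ k) x = 0)"
  by (auto simp: null_infty_def null_space_def)

lemma funpow_zero_mono:
  fixes f :: "'a::complex_vector \<Rightarrow> 'a"
  assumes "clinear f" "(f ^^ k) x = 0" "k \<le> m"
  shows "(f ^^ m) x = 0"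
proof -
  have "(f ^^ m) x = (f ^^ (m - k)) ((f ^^ k) x)"
    using assms(3) by (simp add: funpow_add[symmetric, unfolded comp_def, THEN fun_cong])
  then show ?thesis using assms(1,2) by (simp add: clinear_0[OF clinear_funpow])
qed

lemma subspace_null_infty:
  fixes T :: "'n::finite \<Rightarrow> 'a::complex_vector \<Rightarrow> 'a"
  assumes T: "\<And>i. clinear (T i)"
  shows "complex_vector.subspace (null_infty T)"
  unfolding complex_vector.subspace_def
proof (intro conjI ballI allI impI)
  note Tk = clinear_funpow[OF T]
  show "0 \<in> null_infty T"
    unfolding null_infty_iff by (intro exI[of _ 1]) (simp add: clinear_0[OF T])
  show "c *\<^sub>C x \<in> null_infty T" if "x \<in> null_infty T" for c x
    using that by (auto simp: null_infty_iff clinear_scaleC[OF Tk])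
  show "x + y \<in> null_infty T" if xy: "x \<in> null_infty T" "y \<in> null_infty T" for x y
  proof -
    obtain k m where k: "k \<ge> 1" "\<And>i. (T i ^^ k) x = 0" and m: "\<And>i. (T i ^^ m) y = 0"
      using xy by (auto simp: null_infty_iff)
    have "(T i ^^ max k m) (x + y) = 0" for i
      using funpow_zero_mono[OF T k(2), of "max k m" i] funpow_zero_mono[OF T m, of "max k m" i]
      by (simp add: clinear_add[OF Tk])
    then show ?thesis using k(1) by (auto simp: null_infty_iff intro!: exI[of _ "max k m"])
  qed
qed

text \<open>Induction on the total exponent, with the exponents varying independently. Write
  \<open>P x\<close> as the sum of the \<open>T j (y j)\<close>; with \<open>k j\<close> lowered by
  one the hypothesis applies to \<open>(P ^^ m) (y j)\<close>, and \<open>T j\<close> restores that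
  exponent while preserving the other ranges.\<close>

lemma range_powers:
  fixes T :: "'n::finite \<Rightarrow> 'a::complex_vector \<Rightarrow> 'a"
  assumes T: "\<And>i. clinear (T i)" and Tcomm: "\<And>i j x. T i (T j x) = T j (T i x)"
    and P: "clinear P" and comm: "\<And>i x. T i (P x) = P (T i x)"
    and P_range: "\<And>x. P x \<in> (\<Sum>i\<in>UNIV. range (T i))"
  shows "(P ^^ (\<Sum>i\<in>UNIV. k i)) x \<in> (\<Sum>i\<in>UNIV. range (T i ^^ k i))"
proof (induction "\<Sum>i\<in>UNIV. k i" arbitrary: k x)
  case 0
  then have "k i = 0" for i by simp
  then show ?case using range_power_subset[of T k _ x, OF T] 0 by (simp flip: 0)
next
  case (Suc m)
  show ?case
  proof (cases "\<exists>i. k i = 0")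
    \<comment> \<open>A zero exponent contributes the range of the identity, that is, the whole
      space.\<close>
    case True
    then obtain i where "k i = 0" by blast
    then show ?thesis using range_power_subset[of T k i, OF T] by simp
  next
    case False
    then have pos: "k i > 0" for i by simp
    have sub: "complex_vector.subspace (\<Sum>i\<in>UNIV. range (T i ^^ k i))"
      by (rule subspace_sum_range_powers[OF T])
    obtain f where f: "P x = (\<Sum>i\<in>UNIV. f i)" "\<forall>i\<in>UNIV. f i \<in> range (T i)"
      using set_sum_memD[OF finite P_range[of x]] by blast
    then have "\<forall>i. \<exists>y. f i = T i y" by blast
    then obtain y where y: "\<And>i. f i = T i (y i)" by metis
    have "T j ((P ^^ m) (y j)) \<in> (\<Sum>i\<in>UNIV. range (T i ^^ k i))" for j
    proof -
      define k' where "k' = k(j := k j - 1)"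
      have "(\<Sum>i\<in>UNIV. k i) = Suc (\<Sum>i\<in>UNIV. k' i)"
        using pos[of j] by (simp add: k'_def sum.remove[of UNIV j])
      then have m: "m = (\<Sum>i\<in>UNIV. k' i)" using Suc.hyps(2) by simp
      obtain g where g: "(P ^^ m) (y j) = (\<Sum>i\<in>UNIV. g i)" "\<forall>i\<in>UNIV. g i \<in> range (T i ^^ k' i)"
        using set_sum_memD[OF finite Suc.hyps(1)[OF m, of "y j", folded m]] by blast
      have "T j (g i) \<in> range (T i ^^ k i)" for i
      proof -
        obtain z where z: "g i = (T i ^^ k' i) z" using g(2) by blast
        show ?thesis
        proof (cases "i = j")
          case True
          then have "T j (g i) = (T i ^^ Suc (k' i)) z" using z by simp
          also have "Suc (k' i) = k i" using True pos[of j] by (simp add: k'_def)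
          finally show ?thesis by blast
        next
          case False
          then have "T j (g i) = (T i ^^ k i) (T j z)"
            using funpow_commute[of "T i" "T j", OF Tcomm] z by (simp add: k'_def)
          then show ?thesis by blast
        qed
      qed
      then show ?thesis
        unfolding g(1) clinear_sum[OF T] by (intro set_sum_memI) auto
    qed
    then have "(\<Sum>j\<in>UNIV. T j ((P ^^ m) (y j))) \<in> (\<Sum>i\<in>UNIV. range (T i ^^ k i))"
      by (intro complex_vector.subspace_sum sub)
    also have "(\<Sum>j\<in>UNIV. T j ((P ^^ m) (y j))) = (P ^^ m) (P x)"
      using funpow_commute[of P "T _", OF comm[symmetric]]
      by (simp add: f(1) y clinear_sum[OF clinear_funpow[OF P]])
    also have "\<dots> = (P ^^ (\<Sum>i\<in>UNIV. k i)) x"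
      by (simp add: Suc.hyps(2)[symmetric] funpow_swap1)
    finally show ?thesis .
  qed
qed

text \<open>Dually, \<open>T j x\<close> satisfies the assumptions with \<open>k j\<close> lowered
  by one. Hence \<open>(P ^^ m) x\<close> lies in the joint kernel, and one more \<open>P\<close>
  annihilates it.\<close>

lemma null_powers:
  fixes T :: "'n::finite \<Rightarrow> 'a::complex_vector \<Rightarrow> 'a"
  assumes T: "\<And>i. clinear (T i)" and Tcomm: "\<And>i j x. T i (T j x) = T j (T i x)"
    and P: "clinear P" and comm: "\<And>i x. T i (P x) = P (T i x)"
    and P_null: "\<And>x. (\<And>i. T i x = 0) \<Longrightarrow> P x = 0"
    and x: "\<And>i. (T i ^^ k i) x = 0"
  shows "(P ^^ (\<Sum>i\<in>UNIV. k i)) x = 0"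
  using x
proof (induction "\<Sum>i\<in>UNIV. k i" arbitrary: k x)
  case 0
  then have "k i = 0" for i by simp
  then have "x = 0" using 0(2) by (metis funpow_0)
  then show ?case by (simp add: clinear_0[OF clinear_funpow[OF P]])
next
  case (Suc m)
  show ?case
  proof (cases "\<exists>i. k i = 0")
    case True
    then have "x = 0" using Suc.prems by (metis funpow_0)
    then show ?thesis by (simp add: clinear_0[OF clinear_funpow[OF P]])
  next
    case False
    then have pos: "k i > 0" for i by simp
    have "T j ((P ^^ m) x) = 0" for j
    proof -
      define k' where "k' = k(j := k j - 1)"
      have "(\<Sum>i\<in>UNIV. k i) = Suc (\<Sum>i\<in>UNIV. k' i)"
        using pos[of j] by (simp add: k'_def sum.remove[of UNIV j])
      then have m: "m = (\<Sum>i\<in>UNIV. k' i)" using Suc.hyps(2) by simp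
      have "(T i ^^ k' i) (T j x) = 0" for i
      proof (cases "i = j")
        case True
        have "(T j ^^ (k j - 1)) (T j x) = (T j ^^ Suc (k j - 1)) x" by (simp add: funpow_swap1)
        then show ?thesis using True pos[of j] Suc.prems[of j] by (simp add: k'_def)
      next
        case False
        then show ?thesis
          using funpow_commute[of "T i" "T j" "k i" x, OF Tcomm] Suc.prems[of i]
          by (simp add: k'_def clinear_0[OF T])
      qed
      then have "(P ^^ m) (T j x) = 0" using Suc.hyps(1)[OF m] m by simp
      then show ?thesis using funpow_commute[of P "T j" m x, OF comm[symmetric]] by simp
    qed
    then have "P ((P ^^ m) x) = 0" by (rule P_null)
    then show ?thesis by (simp add: Suc.hyps(2)[symmetric])
  qed
qed

text \<open>Enlarging \<open>V\<close> by one vector enlarges its intersection with \<open>W\<close>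
  by at most one dimension: any \<open>w\<close> in the new intersection outside \<open>V\<close>
  generates it over the old one.\<close>

lemma finite_codim_Int:
  fixes V W :: "'a::complex_vector set"
  assumes V: "complex_vector.subspace V" "finite_codim V"
    and W: "complex_vector.subspace W" "finite_codim W"
  shows "finite_codim (V \<inter> W)"
proof -
  obtain B where B: "finite B" "V + complex_vector.span B = UNIV"
    using V(2) unfolding finite_codim_def by blast
  show ?thesis
    using B V(1)
  proof (induction B arbitrary: V rule: finite_induct)
    case empty
    then show ?case using W(2) by simp
  next
    case (insert b B)
    note V = insert.prems(2)
    define V1 where "V1 = V + complex_vector.span {b}"
    have "complex_vector.subspace V1"
      unfolding V1_def by (intro subspace_plus V complex_vector.subspace_span)
    then have "finite_codim (V1 \<inter> W)"
      using insert.IH[of V1] insert.prems(1) by (simp add: V1_def plus_span_insert[of V b B])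
    then obtain D where D: "finite D" "(V1 \<inter> W) + complex_vector.span D = UNIV"
      unfolding finite_codim_def by blast
    have "\<exists>w. V1 \<inter> W \<subseteq> (V \<inter> W) + complex_vector.span {w}"
    proof (cases "V1 \<inter> W \<subseteq> V")
      case True
      then show ?thesis using subset_plus_span[of "V \<inter> W"] by blast
    next
      case False
      then obtain w where w: "w \<in> V1" "w \<in> W" "w \<notin> V" by blast
      obtain v c where vc: "v \<in> V" "w = v + c *\<^sub>C b"
        using w(1) unfolding V1_def mem_plus_span_singleton by blast
      have "c \<noteq> 0" using vc w(3) by auto
      have "u \<in> (V \<inter> W) + complex_vector.span {w}" if u: "u \<in> V1" "u \<in> W" for u
      proof -
        obtain v' c' where vc': "v' \<in> V" "u = v' + c' *\<^sub>C b"
          using u(1) unfolding V1_def mem_plus_span_singleton by blast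
        have "u - (c' / c) *\<^sub>C w = v' - (c' / c) *\<^sub>C v"
          using \<open>c \<noteq> 0\<close> by (simp add: vc vc' scaleC_add_right scaleC_scaleC)
        then have "u - (c' / c) *\<^sub>C w \<in> V"
          using complex_vector.subspace_diff[OF V vc'(1) complex_vector.subspace_scale[OF V vc(1)]]
          by simp
        moreover have "u - (c' / c) *\<^sub>C w \<in> W"
          by (intro complex_vector.subspace_diff complex_vector.subspace_scale W(1) u(2) w(2))
        moreover have "u = (u - (c' / c) *\<^sub>C w) + (c' / c) *\<^sub>C w" by simp
        ultimately show ?thesis unfolding mem_plus_span_singleton by blast
      qed
      then show ?thesis by blast
    qed
    then obtain w where w: "V1 \<inter> W \<subseteq> (V \<inter> W) + complex_vector.span {w}" by blast
    have "(V \<inter> W) + complex_vector.span (insert w D) = UNIV"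
      using set_plus_mono2[OF w order_refl, of "complex_vector.span D"] D(2)
      unfolding plus_span_insert[of "V \<inter> W" w D] by blast
    then show ?case unfolding finite_codim_def using D(1) by blast
  qed
qed

lemma finite_codim_INT:
  assumes "finite I" "\<And>i. i \<in> I \<Longrightarrow> complex_vector.subspace (V i)"
    "\<And>i. i \<in> I \<Longrightarrow> finite_codim (V i)"
  shows "finite_codim (\<Inter>i\<in>I. V i)"
  using assms
proof (induction I rule: finite_induct)
  case empty
  show ?case unfolding finite_codim_def by (intro exI[of _ "{}"]) (simp add: set_plus_def)
next
  case (insert i I)
  then show ?case
    by (simp add: finite_codim_Int complex_vector.subspace_Inter)
qed

section \<open>From the roots of an annihilating polynomial to the original tuple\<close>

lemma poly_root_decomp:
  fixes f :: "complex poly"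
  assumes "f \<noteq> 0"
  shows "\<exists>n g. f = [:- l, 1:] ^ n * g \<and> poly g l \<noteq> 0"
  using order_decomp[OF assms, of l] by (auto simp: poly_eq_0_iff_dvd)

lemma peval_power:
  assumes "clinear S"
  shows "peval S (p ^ m) x = (peval S p ^^ m) x"
  by (induction m arbitrary: x) (simp_all add: peval_mult[OF assms])

text \<open>For fixed \<open>k\<close> and \<open>x\<close> in \<open>E\<close>, the polynomials g
  with g(S)x in \<open>A\<close> form an ideal. It contains a power \<open>f\<close> of
  \<open>p\<close>, so only roots of \<open>p\<close> could be common roots. At such a root
  \<open>l\<close>, membership of \<open>x\<close> in the range for the enlarged tuple puts the
  cofactor of the power of t - l in \<open>f\<close> into the ideal.\<close>

lemma range_infty_spectral_mapping:
  fixes T :: "'n::finite \<Rightarrow> 'a::complex_vector \<Rightarrow> 'a"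
  assumes T: "\<And>i. clinear (T i)" and Tcomm: "\<And>i j x. T i (T j x) = T j (T i x)"
    and S: "clinear S" and comm: "\<And>i x. T i (S x) = S (T i x)"
    and fin: "finite_codim (\<Sum>i\<in>UNIV. range (T i))"
    and fin_l: "\<And>l. finite_codim (range_infty (case_option (\<lambda>x. S x - l *\<^sub>C x) T))"
  shows "finite_codim (range_infty T)"
proof -
  define Sl where "Sl l x = S x - l *\<^sub>C x" for l x
  have Sl: "clinear (Sl l)" for l
    unfolding Sl_def by (rule clinear_compose_diff[OF S clinear_compose_scaleC[OF clinear_id]])
  define Tl where "Tl l = case_option (Sl l) T" for l
  have Tl: "clinear (Tl l i)" for l i by (cases i) (simp_all add: Tl_def T Sl)
  have Sl_power: "peval S ([:- l, 1:] ^ k) x = (Sl l ^^ k) x" for l k x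
    by (simp add: peval_power_linear[OF S] Sl_def[abs_def])
  have p_comm: "T i (peval S g x) = peval S g (T i x)" for i g x
    by (rule peval_commute[of "T i" S, OF T comm])
  have S_range: "S x \<in> (\<Sum>i\<in>UNIV. range (T i ^^ k i))"
    if x: "x \<in> (\<Sum>i\<in>UNIV. range (T i ^^ k i))" for k x
  proof -
    obtain f where f: "x = (\<Sum>i\<in>UNIV. f i)" "\<forall>i\<in>UNIV. f i \<in> range (T i ^^ k i)"
      using set_sum_memD[OF finite x] by blast
    have "S (f i) \<in> range (T i ^^ k i)" for i
    proof -
      obtain y where "f i = (T i ^^ k i) y" using f(2) by blast
      then have "S (f i) = (T i ^^ k i) (S y)"
        using funpow_commute[of "T i" S, OF comm] by simp
      then show ?thesis by blast
    qed
    then show ?thesis unfolding f(1) clinear_sum[OF S] by (intro set_sum_memI) auto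
  qed
  obtain B where B: "finite B" "(\<Sum>i\<in>UNIV. range (T i)) + complex_vector.span B = UNIV"
    using fin unfolding finite_codim_def by blast
  obtain p where p: "p \<noteq> 0" "\<And>x. peval S p x \<in> (\<Sum>i\<in>UNIV. range (T i))"
    using annihilating_polynomial[OF S _ _ B(1), of "\<Sum>i\<in>UNIV. range (T i)"] B(2)
      subspace_sum_range_powers[of T "\<lambda>_. 1", OF T] S_range[of _ "\<lambda>_. 1"] by auto
  define E where "E = (\<Inter>l\<in>{l. poly p l = 0}. range_infty (Tl l))"
  have "finite_codim E"
    unfolding E_def
  proof (rule finite_codim_INT)
    show "finite {l. poly p l = 0}" using p(1) by (rule poly_roots_finite)
    show "complex_vector.subspace (range_infty (Tl l))" for l by (rule subspace_range_infty[OF Tl])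
    show "finite_codim (range_infty (Tl l))" for l
      using fin_l[of l] by (simp add: Tl_def Sl_def[abs_def])
  qed
  moreover have "E \<subseteq> range_infty T"
  proof
    fix x assume x: "x \<in> E"
    show "x \<in> range_infty T"
      unfolding range_infty_def
    proof
      fix k :: nat
      define A where "A = (\<Sum>i\<in>UNIV. range (T i ^^ k))"
      have A: "complex_vector.subspace A" "\<And>x. x \<in> A \<Longrightarrow> S x \<in> A"
        unfolding A_def by (rule subspace_sum_range_powers[OF T], rule S_range)
      \<comment> \<open>The exponent is \<open>k\<close> times the number of operators, the price of
        reaching the sum of the ranges of the \<open>k\<close>-th powers.\<close>
      define f where "f = p ^ (\<Sum>i\<in>(UNIV :: 'n set). k)"
      have f: "f \<noteq> 0" using p(1) by (simp add: f_def)
      have f_range: "peval S f y \<in> A" for y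
        unfolding f_def A_def peval_power[OF S]
        by (rule range_powers[of T, OF T Tcomm clinear_peval[OF S] p_comm p(2)])
      define I where "I = {g. peval S g x \<in> A}"
      have "1 \<in> I"
      proof (rule ideal_without_common_root)
        show "g + h \<in> I" if "g \<in> I" "h \<in> I" for g h
          using that A(1) by (simp add: I_def peval_add complex_vector.subspace_add)
        show "h * g \<in> I" if "g \<in> I" for g h
          using that peval_in_subspace[OF A] by (simp add: I_def peval_mult[OF S])
        show "\<exists>g\<in>I. poly g l \<noteq> 0" for l
        proof (cases "poly p l = 0")
          case False
          then show ?thesis
            using f_range by (intro bexI[of _ f]) (simp_all add: I_def f_def poly_power)
        next
          case True
          obtain n g where g: "f = [:- l, 1:] ^ n * g" "poly g l \<noteq> 0"
            using poly_root_decomp[OF f] by blast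
          \<comment> \<open>At least \<open>n\<close>, so that the power of S - l supplies the
            factor missing from \<open>g\<close>; at least \<open>k\<close>, so that the
            contribution of the \<open>T i\<close> lies in \<open>A\<close>; and at least 1, where
            the intersection in \<open>range_infty\<close> begins.\<close>
          define m where "m = max 1 (max n k)"
          have m: "m \<ge> 1" "n \<le> m" "k \<le> m" by (auto simp: m_def)
          have "x \<in> (\<Sum>i\<in>UNIV. range (Tl l i ^^ m))"
            using x True range_infty_subset[OF m(1)] unfolding E_def by blast
          then have "x \<in> range (Sl l ^^ m) + (\<Sum>i\<in>UNIV. range (T i ^^ m))"
            by (simp add: sum_UNIV_option Tl_def)
          then obtain y a where ya: "x = (Sl l ^^ m) y + a" "a \<in> (\<Sum>i\<in>UNIV. range (T i ^^ m))"
            by (auto elim!: set_plus_elim)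
          have "a \<in> A"
          proof -
            have "range (T i ^^ m) \<subseteq> range (T i ^^ k)" for i
            proof
              fix z assume "z \<in> range (T i ^^ m)"
              then obtain w where "z = (T i ^^ (k + (m - k))) w" using m(3) by auto
              then show "z \<in> range (T i ^^ k)" by (simp only: funpow_add comp_apply) blast
            qed
            then have "(\<Sum>i\<in>UNIV. range (T i ^^ m)) \<subseteq> A" unfolding A_def by (intro set_sum_mono)
            then show ?thesis using ya(2) by (rule subsetD)
          qed
          have "(Sl l ^^ m) y = (Sl l ^^ n) ((Sl l ^^ (m - n)) y)"
            using m(2) by (simp add: funpow_add[symmetric, unfolded comp_def, THEN fun_cong])
          moreover have "f = g * [:- l, 1:] ^ n" using g(1) by (simp only: mult.commute)
          ultimately have "peval S g ((Sl l ^^ m) y) = peval S f ((Sl l ^^ (m - n)) y)"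
            by (simp only: peval_mult[OF S] Sl_power)
          then have "peval S g x \<in> A"
            using complex_vector.subspace_add[OF A(1) f_range peval_in_subspace[OF A \<open>a \<in> A\<close>]]
            by (simp add: ya(1) clinear_add[OF clinear_peval[OF S]])
          then show ?thesis using g(2) by (auto simp: I_def)
        qed
      qed
      then show "x \<in> (\<Sum>i\<in>UNIV. range (T i ^^ k))" by (simp add: I_def A_def)
    qed
  qed
  ultimately show ?thesis by (rule finite_codim_mono)
qed

text \<open>The polynomials g with g(S)x in \<open>W\<close> form an ideal because \<open>W\<close>
  is invariant under \<open>S\<close>. At a root \<open>l\<close> of \<open>p\<close>, let g be the
  cofactor of the power of t - l in \<open>f\<close>. Then g(S)x is annihilated by that power of S -
  l, since f(S)x = 0, and by the powers of the \<open>T i\<close> that annihilate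
  \<open>x\<close>.\<close>

lemma null_infty_spectral_mapping:
  fixes T :: "'n::finite \<Rightarrow> 'a::complex_vector \<Rightarrow> 'a"
  assumes T: "\<And>i. clinear (T i)" and Tcomm: "\<And>i j x. T i (T j x) = T j (T i x)"
    and S: "clinear S" and comm: "\<And>i x. T i (S x) = S (T i x)"
    and B: "finite B" "\<And>x. (\<And>i. T i x = 0) \<Longrightarrow> x \<in> complex_vector.span B"
    and fin_l: "\<And>l. finite_dim (null_infty (case_option (\<lambda>x. S x - l *\<^sub>C x) T))"
  shows "finite_dim (null_infty T)"
proof -
  define Sl where "Sl l x = S x - l *\<^sub>C x" for l x
  have Sl: "clinear (Sl l)" for l
    unfolding Sl_def by (rule clinear_compose_diff[OF S clinear_compose_scaleC[OF clinear_id]])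
  define Tl where "Tl l = case_option (Sl l) T" for l
  have Tl: "clinear (Tl l i)" for l i by (cases i) (simp_all add: Tl_def T Sl)
  have Tl_S: "Tl l i (S x) = S (Tl l i x)" for l i x
    by (cases i) (simp_all add: Tl_def comm Sl_def clinear_diff[OF S] clinear_scaleC[OF S])
  have Sl_power: "peval S ([:- l, 1:] ^ k) x = (Sl l ^^ k) x" for l k x
    by (simp add: peval_power_linear[OF S] Sl_def[abs_def])
  have p_comm: "T i (peval S g x) = peval S g (T i x)" for i g x
    by (rule peval_commute[of "T i" S, OF T comm])
  define N where "N = (\<Inter>i. null_space (T i))"
  have "complex_vector.subspace N"
    unfolding N_def by (intro complex_vector.subspace_Inter) (auto intro: subspace_null_space T)
  moreover have "N \<subseteq> complex_vector.span B" using B(2) by (auto simp: N_def null_space_def)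
  ultimately have "finite_dim N" using B(1) by (rule finite_dim_subset)
  then obtain C where C: "finite C" "complex_vector.span C = N" unfolding finite_dim_def by blast
  have "S x \<in> N" if "x \<in> N" for x
    using that by (simp add: N_def null_space_def comm clinear_0[OF S])
  then obtain p where p: "p \<noteq> 0" "\<And>x. x \<in> N \<Longrightarrow> peval S p x = 0"
    using annihilating_polynomial[OF S _ _ C(1), of "{0}"] by (auto simp: C(2) clinear_0[OF S])
  have "\<exists>D. finite D \<and> complex_vector.span D = null_infty (Tl l)" for l
    using fin_l[of l] by (simp add: Tl_def Sl_def[abs_def] finite_dim_def)
  then obtain D where D: "\<And>l. finite (D l)" "\<And>l. complex_vector.span (D l) = null_infty (Tl l)"
    by metis
  define W where "W = complex_vector.span (\<Union>l\<in>{l. poly p l = 0}. D l)"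
  have sub_W: "complex_vector.subspace W" by (simp add: W_def)
  have null_W: "null_infty (Tl l) \<subseteq> W" if "poly p l = 0" for l
    unfolding W_def D(2)[symmetric] using that by (intro complex_vector.span_mono) blast
  have S_null: "S x \<in> null_infty (Tl l)" if "x \<in> null_infty (Tl l)" for x l
    using that funpow_commute[of "Tl l _" S, OF Tl_S]
    by (auto simp: null_infty_iff clinear_0[OF S])
  have S_W: "S x \<in> W" if "x \<in> W" for x
  proof -
    have "W \<subseteq> {x. S x \<in> W}"
      unfolding W_def
    proof (rule complex_vector.span_minimal)
      show "(\<Union>l\<in>{l. poly p l = 0}. D l)
          \<subseteq> {x. S x \<in> complex_vector.span (\<Union>l\<in>{l. poly p l = 0}. D l)}"
        using S_null null_W complex_vector.span_base D(2) unfolding W_def by blast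
    qed (intro subspace_preimage S complex_vector.subspace_span)
    then show ?thesis using that by blast
  qed
  have "null_infty T \<subseteq> W"
  proof
    fix x assume "x \<in> null_infty T"
    then obtain k where k: "\<And>i. (T i ^^ k) x = 0" by (auto simp: null_infty_iff)
    define f where "f = p ^ (\<Sum>i\<in>(UNIV :: 'n set). k)"
    have f: "f \<noteq> 0" using p(1) by (simp add: f_def)
    have fx: "peval S f x = 0"
      unfolding f_def peval_power[OF S]
      by (rule null_powers[of T, OF T Tcomm clinear_peval[OF S] p_comm p(2) k])
        (simp add: N_def null_space_def)
    define I where "I = {g. peval S g x \<in> W}"
    have "1 \<in> I"
    proof (rule ideal_without_common_root)
      show "g + h \<in> I" if "g \<in> I" "h \<in> I" for g h
        using that sub_W by (simp add: I_def peval_add complex_vector.subspace_add)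
      show "h * g \<in> I" if "g \<in> I" for g h
        using that peval_in_subspace[OF sub_W S_W] by (simp add: I_def peval_mult[OF S])
      show "\<exists>g\<in>I. poly g l \<noteq> 0" for l
      proof (cases "poly p l = 0")
        case False
        then show ?thesis
          using fx complex_vector.subspace_0[OF sub_W]
          by (intro bexI[of _ f]) (simp_all add: I_def f_def poly_power)
      next
        case True
        obtain n g where g: "f = [:- l, 1:] ^ n * g" "poly g l \<noteq> 0"
          using poly_root_decomp[OF f] by blast
        define m where "m = max 1 (max n k)"
        have m: "m \<ge> 1" "n \<le> m" "k \<le> m" by (auto simp: m_def)
        have "(Tl l i ^^ m) (peval S g x) = 0" for i
        proof (cases i)
          case None
          have "(Sl l ^^ n) (peval S g x) = 0"
            using fx by (simp only: g(1) peval_mult[OF S] Sl_power)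
          then show ?thesis using funpow_zero_mono[OF Sl _ m(2)] None by (simp add: Tl_def)
        next
          case (Some j)
          have "(T j ^^ k) (peval S g x) = peval S g ((T j ^^ k) x)"
            by (rule funpow_commute[of "T j"]) (rule p_comm)
          then have "(T j ^^ k) (peval S g x) = 0"
            using k by (simp add: clinear_0[OF clinear_peval[OF S]])
          then show ?thesis using funpow_zero_mono[OF T _ m(3)] Some by (simp add: Tl_def)
        qed
        then have "peval S g x \<in> null_infty (Tl l)" using m(1) by (auto simp: null_infty_iff)
        then show ?thesis using g(2) null_W[OF True] by (auto simp: I_def)
      qed
    qed
    then show "x \<in> W" by (simp add: I_def)
  qed
  then show ?thesis
    unfolding W_def
    by (rule finite_dim_subset[OF subspace_null_infty[OF T]])
      (use p(1) D(1) poly_roots_finite in blast)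
qed

section \<open>Enlarging the tuple by one operator\<close>

text \<open>The new operator receives the coefficient 0, so the remainder is unchanged, and the sums
  of ranges can only grow.\<close>

lemma lower_split_semi_Browder_extend:
  fixes T :: "'n::finite \<Rightarrow> 'a::complex_banach \<Rightarrow> 'a"
  assumes T: "\<And>i. bounded_clinear (T i)" and S: "bounded_clinear S"
    and lower: "lower_split_semi_Browder T"
  shows "lower_split_semi_Browder (case_option S T)"
proof -
  have bc: "bounded_clinear (case_option S T i)" for i by (cases i) (simp_all add: T S)
  from lower have fin: "finite_codim (range_infty T)" and "ess_right_invertible T"
    using lower_split_semi_Browder_iff[of T, OF T] by auto
  then obtain A B where A: "\<And>i. bounded_clinear (A i)" "finite B"
    "\<And>x. x - (\<Sum>i\<in>UNIV. T i (A i x)) \<in> complex_vector.span B"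
    unfolding ess_right_invertible_def by blast
  have "range_infty T \<subseteq> range_infty (case_option S T)"
    unfolding range_infty_def
  proof (intro INF_superset_mono order_refl)
    fix k
    have "0 \<in> range (S ^^ k)"
      using clinear_0[OF clinear_funpow[OF bounded_clinear_clinear[OF S]], of k] by (metis rangeI)
    from set_zero_plus2[OF this]
    show "(\<Sum>i\<in>UNIV. range (T i ^^ k)) \<subseteq> (\<Sum>i\<in>UNIV. range (case_option S T i ^^ k))"
      by (simp add: sum_UNIV_option)
  qed
  moreover have "ess_right_invertible (case_option S T)"
    unfolding ess_right_invertible_def
  proof (intro exI conjI allI)
    show "bounded_clinear (case_option (\<lambda>x. 0) A i)" for i
      by (cases i) (simp_all add: A bounded_clinear_zero)
    show "x - (\<Sum>i\<in>UNIV. case_option S T i (case_option (\<lambda>x. 0) A i x)) \<in> complex_vector.span B" for x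
      using A(3) by (simp add: sum_UNIV_option clinear_0[OF bounded_clinear_clinear[OF S]])
  qed (rule A(2))
  ultimately show ?thesis
    using lower_split_semi_Browder_iff[of "case_option S T", OF bc] finite_codim_mono[OF fin] by blast
qed

lemma upper_split_semi_Browder_extend:
  fixes T :: "'n::finite \<Rightarrow> 'a::complex_banach \<Rightarrow> 'a"
  assumes T: "\<And>i. bounded_clinear (T i)" and S: "bounded_clinear S"
    and upper: "upper_split_semi_Browder T"
  shows "upper_split_semi_Browder (case_option S T)"
proof -
  have bc: "bounded_clinear (case_option S T i)" for i by (cases i) (simp_all add: T S)
  from upper have "finite_dim (null_infty T)" and "ess_left_invertible T"
    using upper_split_semi_Browder_iff[of T, OF T] by auto
  then obtain A B C where A: "\<And>i. bounded_clinear (A i)" "finite B"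
    "\<And>x. x - (\<Sum>i\<in>UNIV. A i (T i x)) \<in> complex_vector.span B"
    and C: "finite C" "complex_vector.span C = null_infty T"
    unfolding ess_left_invertible_def finite_dim_def by blast
  have "null_infty (case_option S T) \<subseteq> complex_vector.span C"
  proof
    fix x assume "x \<in> null_infty (case_option S T)"
    then obtain k where k: "k \<ge> 1" "\<And>i. (case_option S T i ^^ k) x = 0"
      by (auto simp: null_infty_iff)
    have "(T i ^^ k) x = 0" for i using k(2)[of "Some i"] by simp
    then show "x \<in> complex_vector.span C" using k(1) by (auto simp: C(2) null_infty_iff)
  qed
  from finite_dim_subset[OF subspace_null_infty[OF bounded_clinear_clinear[OF bc]] this C(1)]
  have "finite_dim (null_infty (case_option S T))" .
  moreover have "ess_left_invertible (case_option S T)"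
    unfolding ess_left_invertible_def
  proof (intro exI conjI allI)
    show "bounded_clinear (case_option (\<lambda>x. 0) A i)" for i
      by (cases i) (simp_all add: A bounded_clinear_zero)
    show "x - (\<Sum>i\<in>UNIV. case_option (\<lambda>x. 0) A i (case_option S T i x)) \<in> complex_vector.span B" for x
      using A(3) by (simp add: sum_UNIV_option)
  qed (rule A(2))
  ultimately show ?thesis
    using upper_split_semi_Browder_iff[of "case_option S T", OF bc] by blast
qed

text \<open>Essential right invertibility of \<open>T\<close> is obtained first, since it gives the
  sum of the ranges finite codimension, from which the algebraic statement on
  \<open>range_infty\<close> starts.\<close>

lemma lower_split_semi_Browder_restrict:
  fixes T :: "'n::finite \<Rightarrow> 'a::complex_banach \<Rightarrow> 'a"
  assumes T: "\<And>i. bounded_clinear (T i)" and Tcomm: "\<And>i j x. T i (T j x) = T j (T i x)"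
    and S: "bounded_clinear S" and comm: "\<And>i x. T i (S x) = S (T i x)"
    and lower: "\<And>l. lower_split_semi_Browder (case_option (\<lambda>x. S x - l *\<^sub>C x) T)"
  shows "lower_split_semi_Browder T"
proof -
  have bc: "bounded_clinear (case_option (\<lambda>x. S x - l *\<^sub>C x) T i)" for i l
    by (cases i) (simp_all add: T bounded_clinear_compose_diff[OF S
          bounded_clinear_compose_scaleC[OF bounded_clinear_ident]])
  have "finite_codim (range_infty (case_option (\<lambda>x. S x - l *\<^sub>C x) T))"
    "ess_right_invertible (case_option (\<lambda>x. S x - l *\<^sub>C x) T)" for l
    using lower[of l]
      lower_split_semi_Browder_iff[of "case_option (\<lambda>x. S x - l *\<^sub>C x) T", OF bc] by auto
  note lower' = this
  have inv: "ess_right_invertible T"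
    by (rule ess_right_invertible_spectral_mapping[OF T S comm lower'(2)])
  then obtain A B where A: "finite B"
    "\<And>x. x - (\<Sum>i\<in>UNIV. T i (A i x)) \<in> complex_vector.span B"
    unfolding ess_right_invertible_def by blast
  have "x \<in> (\<Sum>i\<in>UNIV. range (T i)) + complex_vector.span B" for x
  proof -
    have "(\<Sum>i\<in>UNIV. T i (A i x)) \<in> (\<Sum>i\<in>UNIV. range (T i))" by (intro set_sum_memI) auto
    from set_plus_intro[OF this A(2)[of x]] show ?thesis by simp
  qed
  then have "finite_codim (\<Sum>i\<in>UNIV. range (T i))" unfolding finite_codim_def using A(1) by blast
  from range_infty_spectral_mapping[OF bounded_clinear_clinear[OF T] Tcomm
      bounded_clinear_clinear[OF S] comm this lower'(1)] inv
  show ?thesis using lower_split_semi_Browder_iff[of T, OF T] by blast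
qed

text \<open>Essential left invertibility of \<open>T\<close> confines the joint kernel to a finite
  span, from which the algebraic statement on \<open>null_infty\<close> starts.\<close>

lemma upper_split_semi_Browder_restrict:
  fixes T :: "'n::finite \<Rightarrow> 'a::complex_banach \<Rightarrow> 'a"
  assumes T: "\<And>i. bounded_clinear (T i)" and Tcomm: "\<And>i j x. T i (T j x) = T j (T i x)"
    and S: "bounded_clinear S" and comm: "\<And>i x. T i (S x) = S (T i x)"
    and upper: "\<And>l. upper_split_semi_Browder (case_option (\<lambda>x. S x - l *\<^sub>C x) T)"
  shows "upper_split_semi_Browder T"
proof -
  have bc: "bounded_clinear (case_option (\<lambda>x. S x - l *\<^sub>C x) T i)" for i l
    by (cases i) (simp_all add: T bounded_clinear_compose_diff[OF S
          bounded_clinear_compose_scaleC[OF bounded_clinear_ident]])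
  have "finite_dim (null_infty (case_option (\<lambda>x. S x - l *\<^sub>C x) T))"
    "ess_left_invertible (case_option (\<lambda>x. S x - l *\<^sub>C x) T)" for l
    using upper[of l]
      upper_split_semi_Browder_iff[of "case_option (\<lambda>x. S x - l *\<^sub>C x) T", OF bc] by auto
  note upper' = this
  have inv: "ess_left_invertible T"
    by (rule ess_left_invertible_spectral_mapping[OF T S comm upper'(2)])
  then obtain A B where A: "\<And>i. bounded_clinear (A i)" "finite B"
    "\<And>x. x - (\<Sum>i\<in>UNIV. A i (T i x)) \<in> complex_vector.span B"
    unfolding ess_left_invertible_def by blast
  have "x \<in> complex_vector.span B" if "\<And>i. T i x = 0" for x
    using A(3)[of x] by (simp add: that clinear_0[OF bounded_clinear_clinear[OF A(1)]])
  from null_infty_spectral_mapping[OF bounded_clinear_clinear[OF T] Tcomm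
      bounded_clinear_clinear[OF S] comm A(2) this upper'(1)] inv
  show ?thesis using upper_split_semi_Browder_iff[of T, OF T] by blast
qed

text \<open>A point lies in the projection exactly if some last coordinate \<open>z\<close> makes
  \<open>P\<close> fail: \<open>extend\<close> excludes this when \<open>Q\<close> holds, and
  \<open>restrict\<close> provides such a \<open>z\<close> when \<open>Q\<close> fails. Leaving
  \<open>P\<close> and \<open>Q\<close> arbitrary covers both spectra.\<close>

lemma first_coords_image:
  fixes P :: "('n::finite option \<Rightarrow> 'a::complex_vector \<Rightarrow> 'a) \<Rightarrow> bool"
    and Q :: "('n \<Rightarrow> 'a \<Rightarrow> 'a) \<Rightarrow> bool"
  assumes extend: "\<And>l z. Q (shift_tuple (\<lambda>i. T (Some i)) l)
      \<Longrightarrow> P (case_option (\<lambda>x. T None x - z *\<^sub>C x) (shift_tuple (\<lambda>i. T (Some i)) l))"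
    and restrict: "\<And>l. (\<And>z. P (case_option (\<lambda>x. T None x - z *\<^sub>C x)
      (shift_tuple (\<lambda>i. T (Some i)) l))) \<Longrightarrow> Q (shift_tuple (\<lambda>i. T (Some i)) l)"
  shows "first_coords ` {l. \<not> P (shift_tuple T l)} = {l. \<not> Q (shift_tuple (\<lambda>i. T (Some i)) l)}"
proof -
  have shift: "shift_tuple T l = case_option (\<lambda>x. T None x - (l $ None) *\<^sub>C x)
      (shift_tuple (\<lambda>i. T (Some i)) (first_coords l))" for l
    by (auto simp: fun_eq_iff shift_tuple_def first_coords_def split: option.split)
  show ?thesis
  proof (intro equalityI subsetI)
    fix l assume "l \<in> first_coords ` {l. \<not> P (shift_tuple T l)}"
    then show "l \<in> {l. \<not> Q (shift_tuple (\<lambda>i. T (Some i)) l)}" using extend shift by auto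
  next
    fix l assume "l \<in> {l. \<not> Q (shift_tuple (\<lambda>i. T (Some i)) l)}"
    then obtain z where z: "\<not> P (case_option (\<lambda>x. T None x - z *\<^sub>C x)
      (shift_tuple (\<lambda>i. T (Some i)) l))" using restrict by blast
    define l' where "l' = (\<chi> i. case_option z (($) l) i)"
    have l': "first_coords l' = l" "l' $ None = z" by (simp_all add: first_coords_def l'_def vec_eq_iff)
    then have "\<not> P (shift_tuple T l')" using z by (simp add: shift)
    then show "l \<in> first_coords ` {l. \<not> P (shift_tuple T l)}" using l'(1) by blast
  qed
qed

theorem proposition3p2:
  fixes T :: "'n::finite option \<Rightarrow> 'a::complex_banach \<Rightarrow> 'a"
  assumes "\<And>i. bounded_clinear (T i)"
    and "\<And>i j. T i \<circ> T j = T j \<circ> T i"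
  shows "first_coords ` lower_sB_spectrum T = lower_sB_spectrum (\<lambda>i. T (Some i)) \<and>
    first_coords ` upper_sB_spectrum T = upper_sB_spectrum (\<lambda>i. T (Some i))"
proof -
  have comm: "T i (T j x) = T j (T i x)" for i j x
    using fun_cong[OF assms(2)[of i j], of x] by simp
  note T' = bounded_clinear_clinear[OF assms(1)]
  have translate: "bounded_clinear (\<lambda>x. T i x - z *\<^sub>C x)" for i z
    by (rule bounded_clinear_compose_diff[OF assms(1)
          bounded_clinear_compose_scaleC[OF bounded_clinear_ident]])
  have shift: "bounded_clinear (shift_tuple (\<lambda>i. T (Some i)) l i)" for l i
    unfolding shift_tuple_def by (rule translate)
  have shift_comm: "shift_tuple (\<lambda>i. T (Some i)) l i (shift_tuple (\<lambda>i. T (Some i)) l j x)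
      = shift_tuple (\<lambda>i. T (Some i)) l j (shift_tuple (\<lambda>i. T (Some i)) l i x)" for l i j x
    by (simp add: shift_tuple_def clinear_diff[OF T'] clinear_scaleC[OF T'] comm[of "Some i"]
        complex_vector.scale_right_diff_distrib scaleC_scaleC mult.commute algebra_simps)
  have shift_comm': "shift_tuple (\<lambda>i. T (Some i)) l i (T None x)
      = T None (shift_tuple (\<lambda>i. T (Some i)) l i x)" for l i x
    by (simp add: shift_tuple_def clinear_diff[OF T'] clinear_scaleC[OF T'] comm[of "Some i"])
  show ?thesis
    unfolding lower_sB_spectrum_def upper_sB_spectrum_def
  proof (intro conjI first_coords_image)
    fix l :: "complex ^ 'n" and z
    let ?T = "shift_tuple (\<lambda>i. T (Some i)) l" and ?S = "\<lambda>x. T None x - z *\<^sub>C x"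
    show "lower_split_semi_Browder (case_option ?S ?T)" if "lower_split_semi_Browder ?T"
      by (rule lower_split_semi_Browder_extend[of ?T, OF shift translate that])
    show "upper_split_semi_Browder (case_option ?S ?T)" if "upper_split_semi_Browder ?T"
      by (rule upper_split_semi_Browder_extend[of ?T, OF shift translate that])
  next
    fix l :: "complex ^ 'n"
    let ?T = "shift_tuple (\<lambda>i. T (Some i)) l" and ?S = "\<lambda>z x. T None x - z *\<^sub>C x"
    show "lower_split_semi_Browder ?T" if "\<And>z. lower_split_semi_Browder (case_option (?S z) ?T)"
      by (rule lower_split_semi_Browder_restrict[of ?T "T None",
            OF shift shift_comm assms(1) shift_comm' that])
    show "upper_split_semi_Browder ?T" if "\<And>z. upper_split_semi_Browder (case_option (?S z) ?T)"
      by (rule upper_split_semi_Browder_restrict[of ?T "T None",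
            OF shift shift_comm assms(1) shift_comm' that])
  qed
qed

end
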